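(* Let $\mathbb{K}$ be a field of arbitrary characteristic and let $\mathcal{A}$ be an affine line arrangement in $V=\mathbb{K}^2$ such that $|\mathcal{A}|=2n+r$ with $n,r\in\mathbb{Z}_{\ge0}$ and $\chi(\mathcal{A},t)=(t-n)(t-n-r)$. Assume that $\mathcal{A}$ contains an arrangement $\mathcal{B}$ with $\chi(\mathcal{B},t)=(t-\alpha)(t-\beta)$ such that $\alpha\le\beta$ are real numbers with $\alpha\le n$ and $n-1\le\beta$. Then $\mathcal{A}$ is free if and only if there is a line $H\in\mathcal{A}$ such that $n_H\in\{n,n+r\}$. In particular, the freeness of such $\mathcal{A}$ depends only on the combinatorics.
   Context: An affine line arrangement $\mathcal{A}$ in $V=\mathbb{K}^2$ is a finite set of affine lines in $V$. $L(\mathcal{A})$ is the set of all nonempty intersections of subsets of $\mathcal{A}$ (including $V$, the empty intersection), a poset under inclusion. Define $\mu(V)=1$ and $\mu(X)=-\sum_{Y\in L(\mathcal{A}),\,X\subsetneq Y\subset V}\mu(Y)$; the characteristic polynomial is $\chi(\mathcal{A},t)=\sum_{X\in L(\mathcal{A})}\mu(X)t^{\dim X}$. For a line $H$, $n_H:=|\mathcal{A}\cap H|$ where $\mathcal{A}\cap H:=\{H\cap H'\mid H'\in\mathcal{A},\ H'\ne H,\ H\cap H'\neq\emptyset\}$. "The freeness of such $\mathcal{A}$ depends only on the combinatorics" means: for two arrangements in $V$ that both satisfy the hypotheses and have isomorphic posets $L$, one is free if and only if the other is. Freeness: let $S=\mathbb{K}[x,y,z]$. The cone $c\mathcal{A}$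 is the central arrangement in $\mathbb{K}^3$ consisting of the plane $z=0$ and the planes $cH=\{\alpha_{cH}=0\}$, $H\in\mathcal{A}$, where $\alpha_{cH}$ is the homogenization by $z$ of a degree one polynomial defining $H$. Let $D(c\mathcal{A})=\{\theta\in\mathrm{Der}\,S\mid \theta(\alpha_{cH})\in S\alpha_{cH}\ (\forall H\in\mathcal{A}),\ \theta(z)\in Sz\}$, where $\mathrm{Der}\,S$ is the module of $\mathbb{K}$-derivations of $S$. $\mathcal{A}$ is free with exponents $\exp_0(\mathcal{A})=(d_1,d_2)$ if $D(c\mathcal{A})$ is a free $S$-module with a homogeneous basis $\theta_E=x\partial_x+y\partial_y+z\partial_z,\theta_1,\theta_2$ with $\deg\theta_i=d_i$ (the degree of a homogeneous derivation is the polynomial degree of its coefficients).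
   Formalization: "A contains an arrangement B" is taken as proper containment, B ≠ A; with B = A the condition on B is void and the claim fails, e.g. for the dual Hesse arrangement with one line at infinity (free, n = 4, r = 0, all n_H = 3). *)

theory Defs
  imports "HOL-Analysis.Analysis" "HOL-Computational_Algebra.Polynomial"
begin

section \<open>Affine line arrangements in the plane over a field\<close>

definition line_of :: "'a::field \<Rightarrow> 'a \<Rightarrow> 'a \<Rightarrow> ('a^2) set" where
  "line_of a b c = {p. a * p$1 + b * p$2 + c = 0}"

definition affine_line :: "('a::field^2) set \<Rightarrow> bool" where
  "affine_line H \<longleftrightarrow> (\<exists>a b c. (a, b) \<noteq> (0, 0) \<and> H = line_of a b c)"

definition line_arrangement :: "('a::field^2) set set \<Rightarrow> bool" where
  "line_arrangement A \<longleftrightarrow> finite A \<and> (\<forall>H\<in>A. affine_line H)"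

text \<open>The empty subfamily contributes the whole plane, since \<open>\<Inter>{} = UNIV\<close>.\<close>

definition flats :: "('a^2) set set \<Rightarrow> ('a^2) set set" where
  "flats A = {\<Inter>B | B. B \<subseteq> A} - {{}}"

lemma finite_flats: "finite A \<Longrightarrow> finite (flats A)"
  by (simp add: flats_def setcompr_eq_image flip: Pow_def)

text \<open>The guard on finiteness only serves to make the recursion terminate for every argument.\<close>

function moebius :: "('a^2) set set \<Rightarrow> ('a^2) set \<Rightarrow> int" where
  "moebius A X =
     (if infinite A then 0
      else if X = UNIV then 1
      else - (\<Sum>Y\<in>{Y \<in> flats A. X \<subset> Y}. moebius A Y))"
  by pat_completeness auto
termination
proof (relation "Wellfounded.measure (\<lambda>(A, X). card {Y \<in> flats A. X \<subset> Y})", goal_cases)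
  case (2 A X Y)
  then have "finite (flats A)" by (simp add: finite_flats)
  moreover from 2 have "{Z \<in> flats A. Y \<subset> Z} \<subset> {Z \<in> flats A. X \<subset> Z}" by auto
  ultimately show ?case by (auto intro!: psubset_card_mono)
qed simp

declare moebius.simps [simp del]

text \<open>Dimension of a nonempty affine subspace, that is, of its space of directions.\<close>

definition flat_dim :: "('a::field^2) set \<Rightarrow> nat" where
  "flat_dim X = vec.dim {p - q | p q. p \<in> X \<and> q \<in> X}"

definition charpoly_arr :: "('a::field^2) set set \<Rightarrow> int poly" where
  "charpoly_arr A = (\<Sum>X\<in>flats A. monom (moebius A X) (flat_dim X))"

definition restriction :: "('a^2) set set \<Rightarrow> ('a^2) set \<Rightarrow> ('a^2) set set" where
  "restriction A H = {H \<inter> H' | H'. H' \<in> A \<and> H' \<noteq> H \<and> H \<inter> H' \<noteq> {}}"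

definition n_points :: "('a^2) set set \<Rightarrow> ('a^2) set \<Rightarrow> nat" where
  "n_points A H = card (restriction A H)"

definition poset_iso :: "'b set set \<Rightarrow> 'c set set \<Rightarrow> bool" where
  "poset_iso P Q \<longleftrightarrow>
     (\<exists>f. bij_betw f P Q \<and> (\<forall>X\<in>P. \<forall>Y\<in>P. X \<subseteq> Y \<longleftrightarrow> f X \<subseteq> f Y))"


section \<open>Derivations of \<open>K[x,y,z]\<close>\<close>

text \<open>
  \<open>K[x,y,z]\<close> is represented as \<open>K[x][y][z]\<close>: \<open>z\<close> is the outermost variable and \<open>x\<close> the
  innermost one.
\<close>

type_synonym 'a poly3 = "'a poly poly poly"

definition const3 :: "'a::field \<Rightarrow> 'a poly3" where "const3 c = [:[:[:c:]:]:]"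
definition X3 :: "'a::field poly3" where "X3 = [:[:[:0, 1:]:]:]"
definition Y3 :: "'a::field poly3" where "Y3 = [:[:0, 1:]:]"
definition Z3 :: "'a::field poly3" where "Z3 = [:0, 1:]"

definition homogeneous3 :: "nat \<Rightarrow> 'a::field poly3 \<Rightarrow> bool" where
  "homogeneous3 d p \<longleftrightarrow>
     (\<forall>i j k. coeff (coeff (coeff p k) j) i \<noteq> 0 \<longrightarrow> i + j + k = d)"

definition derivation3 :: "('a::field poly3 \<Rightarrow> 'a poly3) \<Rightarrow> bool" where
  "derivation3 \<theta> \<longleftrightarrow>
     (\<forall>p q. \<theta> (p + q) = \<theta> p + \<theta> q) \<and>
     (\<forall>c p. \<theta> (const3 c * p) = const3 c * \<theta> p) \<and>
     (\<forall>p q. \<theta> (p * q) = p * \<theta> q + q * \<theta> p)"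

text \<open>A derivation is \<open>\<theta>(x) \<partial>\<^sub>x + \<theta>(y) \<partial>\<^sub>y + \<theta>(z) \<partial>\<^sub>z\<close>, so its coefficients are \<open>\<theta>(x), \<theta>(y), \<theta>(z)\<close>.\<close>

definition homogeneous_der :: "nat \<Rightarrow> ('a::field poly3 \<Rightarrow> 'a poly3) \<Rightarrow> bool" where
  "homogeneous_der d \<theta> \<longleftrightarrow>
     homogeneous3 d (\<theta> X3) \<and> homogeneous3 d (\<theta> Y3) \<and> homogeneous3 d (\<theta> Z3)"

definition euler_der :: "'a::field poly3 \<Rightarrow> 'a poly3" where
  "euler_der p =
     X3 * map_poly (map_poly pderiv) p + Y3 * map_poly pderiv p + Z3 * pderiv p"


section \<open>Freeness\<close>

text \<open>The homogenization by \<open>z\<close> of \<open>a x + b y + c\<close>.\<close>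

definition cone_form :: "'a::field \<Rightarrow> 'a \<Rightarrow> 'a \<Rightarrow> 'a poly3" where
  "cone_form a b c = const3 a * X3 + const3 b * Y3 + const3 c * Z3"

text \<open>
  The module \<open>D(cA)\<close>.  The equation of a line is unique up to a nonzero scalar, so asking the
  condition for all equations of \<open>H\<close> is the same as asking it for a chosen one.
\<close>

definition cone_derivations :: "('a::field^2) set set \<Rightarrow> ('a poly3 \<Rightarrow> 'a poly3) set" where
  "cone_derivations A =
     {\<theta>. derivation3 \<theta> \<and>
         (\<forall>H\<in>A. \<forall>a b c. (a, b) \<noteq> (0, 0) \<and> H = line_of a b c \<longrightarrow>
            cone_form a b c dvd \<theta> (cone_form a b c)) \<and>
         Z3 dvd \<theta> Z3}"

definition is_basis3 ::
  "('a::field poly3 \<Rightarrow> 'a poly3) set \<Rightarrow> ('a poly3 \<Rightarrow> 'a poly3) \<Rightarrow> ('a poly3 \<Rightarrow> 'a poly3) \<Rightarrow>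
   ('a poly3 \<Rightarrow> 'a poly3) \<Rightarrow> bool" where
  "is_basis3 D \<theta>\<^sub>0 \<theta>\<^sub>1 \<theta>\<^sub>2 \<longleftrightarrow>
     \<theta>\<^sub>0 \<in> D \<and> \<theta>\<^sub>1 \<in> D \<and> \<theta>\<^sub>2 \<in> D \<and>
     (\<forall>\<theta>\<in>D. \<exists>!(f, g, h). \<theta> = (\<lambda>p. f * \<theta>\<^sub>0 p + g * \<theta>\<^sub>1 p + h * \<theta>\<^sub>2 p))"

definition free_with_exponents :: "('a::field^2) set set \<Rightarrow> nat \<Rightarrow> nat \<Rightarrow> bool" where
  "free_with_exponents A d\<^sub>1 d\<^sub>2 \<longleftrightarrow>
     (\<exists>\<theta>\<^sub>1 \<theta>\<^sub>2. homogeneous_der d\<^sub>1 \<theta>\<^sub>1 \<and> homogeneous_der d\<^sub>2 \<theta>\<^sub>2 \<and>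
        is_basis3 (cone_derivations A) euler_der \<theta>\<^sub>1 \<theta>\<^sub>2)"

definition free_arrangement :: "('a::field^2) set set \<Rightarrow> bool" where
  "free_arrangement A \<longleftrightarrow> (\<exists>d\<^sub>1 d\<^sub>2. free_with_exponents A d\<^sub>1 d\<^sub>2)"


section \<open>The condition on the roots of the characteristic polynomials\<close>

text \<open>
  The subarrangement \<open>B\<close> is proper.  For \<open>B = A\<close> the inequalities hold trivially, with
  \<open>\<alpha> = n\<close> and \<open>\<beta> = n + r\<close>, so the existence of \<open>B\<close> would be no condition at all, and the asserted criterion
  would fail: the dual Hesse arrangement with one line at infinity is free with exponents
  \<open>(4, 4)\<close>, but each of its lines has three intersection points.
\<close>

definition roots_condition :: "('a::field^2) set set \<Rightarrow> nat \<Rightarrow> nat \<Rightarrow> bool" where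
  "roots_condition A n r \<longleftrightarrow>
     line_arrangement A \<and>
     card A = 2 * n + r \<and>
     charpoly_arr A = [:- int n, 1:] * [:- int (n + r), 1:] \<and>
     (\<exists>B \<alpha> \<beta>. B \<subset> A \<and>
        map_poly real_of_int (charpoly_arr B) = [:- \<alpha>, 1:] * [:- \<beta>, 1:] \<and>
        \<alpha> \<le> \<beta> \<and> \<alpha> \<le> real n \<and> real n - 1 \<le> \<beta>)"

end

theory Submission
  imports Defs
begin

text \<open>
  Modulo the Euler derivation, homogeneous elements of \<open>D(cA)\<close> are the same as polynomial vector
  fields \<open>(f, g)\<close> on the plane that are tangent to all lines of \<open>A\<close>, filtered by degree.  Let \<open>H\<close>
  be a line of \<open>A\<close> with equation \<open>\<alpha>\<close>, and \<open>A' = A - {H}\<close>.  Two maps into the polynomials on \<open>H\<close>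
  control everything: \<open>\<sigma>\<close> sends a field \<open>\<theta>\<close> of \<open>A'\<close> to \<open>\<theta>(\<alpha>)\<close> restricted to \<open>H\<close>, with kernel the
  fields of \<open>A\<close>, and \<open>\<rho>\<close> sends a field of \<open>A\<close> to its tangential component on \<open>H\<close>, with kernel \<open>\<alpha>\<close>
  times the fields of \<open>A'\<close>.  The values of \<open>\<sigma>\<close> have prescribed zeros of total order
  \<open>|A'| - n\<^sub>H\<close> (counting the point at infinity), and those of \<open>\<rho>\<close> vanish at the \<open>n\<^sub>H\<close> points.  In large
  degree the image of \<open>\<sigma>\<close> is as large as these zeros permit, so that adding the lines one by one gives
  the number of fields of large degree in terms of \<open>|A|\<close> and the constant coefficient \<open>b\<^sub>2\<close> of the
  characteristic polynomial.

  If \<open>n\<^sub>H\<close> is a root of the characteristic polynomial, the upper bound for this number which follows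
  from \<open>\<rho>\<close> and \<open>\<sigma>\<close> is attained.  Hence both images are as large as possible in every degree, and the
  preimages of their generators form a basis.  Conversely, if \<open>A\<close> is free with exponents \<open>d \<le> e\<close>, then
  counting gives \<open>d + e = |A|\<close> and \<open>d e = b\<^sub>2\<close>, and comparing degrees under \<open>\<rho>\<close> and \<open>\<sigma>\<close> shows
  \<open>n\<^sub>H \<le> d\<close> or \<open>n\<^sub>H = e\<close>.  So if no \<open>n\<^sub>H\<close> is a root, all \<open>n\<^sub>H\<close> are at most \<open>n - 1\<close>; removing the lines
  outside \<open>B\<close> then gives \<open>\<chi>(B, n - 1) \<ge> r + 1\<close> and \<open>\<chi>(B, n) > 0\<close>, which is impossible with roots
  \<open>\<alpha> \<le> n\<close> and \<open>\<beta> \<ge> n - 1\<close>.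
\<close>

section \<open>Dimension of finitely generated subspaces\<close>

text \<open>The scalar multiplication is a parameter because maps between spaces over different
  types are compared. Finiteness must be carried along: \<open>dim\<close> is the cardinality of a
  basis, and so is 0 when the basis is infinite.\<close>

definition fin_dim :: "('k::field \<Rightarrow> 'v::ab_group_add \<Rightarrow> 'v) \<Rightarrow> 'v set \<Rightarrow> bool" where
  "fin_dim s U \<longleftrightarrow> module.subspace s U \<and> (\<exists>B. finite B \<and> U \<subseteq> module.span s B)"

context vector_space
begin

lemma fin_dim_subset:
  assumes "fin_dim scale W" "subspace U" "U \<subseteq> W"
  shows "fin_dim scale U"
  using assms unfolding fin_dim_def by (meson subset_trans)

lemma fin_dim_obtain_basis:
  assumes "fin_dim scale U" "independent C" "C \<subseteq> U"
  obtains B where "C \<subseteq> B" "B \<subseteq> U" "finite B" "independent B" "span B = U" "card B = dim U"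
proof -
  from assms(1) obtain S where S: "finite S" "U \<subseteq> span S" and sub: "subspace U"
    by (auto simp: fin_dim_def)
  obtain B where B: "C \<subseteq> B" "B \<subseteq> U" "independent B" "U \<subseteq> span B"
    using maximal_independent_subset_extend[OF assms(3,2)] by blast
  have "finite B"
    using independent_span_bound[OF S(1) B(3)] B(2) S(2) by blast
  moreover have "span B = U"
    using B(2,4) sub by (simp add: span_minimal subset_antisym)
  ultimately show ?thesis
    using that B dim_eq_card_independent[of B] dim_span[of B] by metis
qed

lemma dim_mono_fin:
  assumes "fin_dim scale W" "subspace U" "U \<subseteq> W"
  shows "dim U \<le> dim W"
proof -
  obtain B where B: "B \<subseteq> U" "independent B" "card B = dim U" "finite B"
    using fin_dim_obtain_basis[OF fin_dim_subset[OF assms] independent_empty] by auto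
  have "B \<subseteq> W" using B(1) assms(3) by simp
  obtain B' where B': "B \<subseteq> B'" "finite B'" "card B' = dim W"
    by (rule fin_dim_obtain_basis[OF assms(1) B(2) \<open>B \<subseteq> W\<close>])
  show ?thesis using card_mono[OF B'(2,1)] B(3) B'(3) by simp
qed

lemma fin_dim_zero: "fin_dim scale {0}" "dim {0} = 0"
  using dim_span[of "{}"] dim_eq_card_independent[OF independent_empty]
  by (auto simp: fin_dim_def intro!: exI[of _ "{}"])

end

context vector_space_pair
begin

lemma fin_dim_image:
  assumes "fin_dim s1 U" "Vector_Spaces.linear s1 s2 f"
  shows "fin_dim s2 (f ` U)"
proof -
  interpret l: Vector_Spaces.linear s1 s2 f by fact
  from assms(1) obtain S where S: "finite S" "U \<subseteq> vs1.span S" "vs1.subspace U"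
    by (auto simp: fin_dim_def)
  have "finite (f ` S)" "f ` U \<subseteq> vs2.span (f ` S)" "vs2.subspace (f ` U)"
    using S l.subspace_image[OF S(3)] l.spans_image[OF S(2)] by simp_all
  then show ?thesis unfolding fin_dim_def by blast
qed

text \<open>A basis \<open>C\<close> of the kernel is extended to a basis \<open>B\<close> of
  \<open>U\<close>; the images of \<open>B - C\<close> are then a basis of the image.\<close>

lemma rank_nullity:
  assumes "fin_dim s1 U" "Vector_Spaces.linear s1 s2 f"
  shows "vs1.dim U = vs1.dim {x \<in> U. f x = 0} + vs2.dim (f ` U)"
proof -
  interpret l: Vector_Spaces.linear s1 s2 f by fact
  let ?K = "{x \<in> U. f x = 0}"
  have sub: "vs1.subspace U" using assms(1) by (simp add: fin_dim_def)
  have subK: "vs1.subspace ?K"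
    using vs1.subspace_inter[OF sub l.subspace_kernel] by (simp add: Int_def)
  have fK: "fin_dim s1 ?K"
    using vs1.fin_dim_subset[OF assms(1) subK] by blast
  obtain C where C: "C \<subseteq> ?K" "finite C" "vs1.independent C" "vs1.span C = ?K" "card C = vs1.dim ?K"
    using vs1.fin_dim_obtain_basis[OF fK vs1.independent_empty] by auto
  obtain B where B: "C \<subseteq> B" "B \<subseteq> U" "finite B" "vs1.independent B" "vs1.span B = U"
    "card B = vs1.dim U"
    using vs1.fin_dim_obtain_basis[OF assms(1) C(3)] C(1) by blast
  have indD: "vs1.independent (B - C)" using B(4) vs1.independent_mono by blast
  \<comment> \<open>A vector of \<open>vs1.span (B - C)\<close> killed by \<open>f\<close> also lies
    in \<open>vs1.span C\<close>. Its coordinates with respect to \<open>B\<close> are supported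
    both in \<open>B - C\<close> and in \<open>C\<close>, hence vanish.\<close>
  have inj: "inj_on f (vs1.span (B - C))"
  proof (subst l.inj_on_iff_eq_0)
    show "\<forall>x\<in>vs1.span (B - C). f x = 0 \<longrightarrow> x = 0"
    proof (intro ballI impI)
      fix x assume x: "x \<in> vs1.span (B - C)" "f x = 0"
      then have "x \<in> U" using B(5) vs1.span_mono[of "B - C" B] by blast
      then have xC: "x \<in> vs1.span C" using C(4) x(2) by blast
      show "x = 0"
      proof -
        have 1: "vs1.representation B x = vs1.representation C x"
          using vs1.representation_extend[OF B(4) xC B(1)] .
        have 2: "vs1.representation B x = vs1.representation (B - C) x"
          using vs1.representation_extend[OF B(4) x(1)] by blast
        have "vs1.representation B x b = 0" for b
        proof (cases "b \<in> C")
          case True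
          then show ?thesis using 2 vs1.representation_ne_zero[of "B - C" x b] by auto
        next
          case False
          then show ?thesis using 1 vs1.representation_ne_zero[of C x b] by auto
        qed
        moreover have "x \<in> vs1.span B" using \<open>x \<in> U\<close> B(5) by simp
        ultimately show "x = 0"
          using vs1.sum_representation_eq[OF B(4) _ B(3) subset_refl, of x] by simp
      qed
    qed
  qed auto
  have ind2: "vs2.independent (f ` (B - C))"
    by (rule l.independent_injective_image[OF indD inj])
  have card2: "card (f ` (B - C)) = card B - card C"
    using card_image[OF inj_on_subset[OF inj vs1.span_superset]] card_Diff_subset[OF C(2) B(1)] by simp
  have "f ` U = f ` vs1.span ((B - C) \<union> C)" using B(1,5) by (simp add: Un_absorb2)
  also have "\<dots> = f ` vs1.span (B - C)"
  proof
    show "f ` vs1.span (B - C \<union> C) \<subseteq> f ` vs1.span (B - C)"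
    proof
      fix y assume "y \<in> f ` vs1.span (B - C \<union> C)"
      then obtain u w where "y = f (u + w)" "u \<in> vs1.span (B - C)" "w \<in> vs1.span C"
        unfolding vs1.span_Un by blast
      moreover from this have "f w = 0" using C(4) by blast
      ultimately show "y \<in> f ` vs1.span (B - C)" by (simp add: l.add)
    qed
  qed (use vs1.span_mono in blast)
  also have "\<dots> = vs2.span (f ` (B - C))" by (simp add: l.span_image)
  finally have "vs2.dim (f ` U) = card B - card C"
    using vs2.dim_span_eq_card_independent[OF ind2] card2 by simp
  then show ?thesis using B(1,3,6) C(5) card_mono[OF B(3,1)] by simp
qed

end

text \<open>The form in which upper bounds are obtained: \<open>K\<close> and \<open>W\<close> only
  have to contain the kernel and the image.\<close>

lemma rank_nullity_le:
  assumes "vector_space s1" "vector_space s2" "fin_dim s1 U" "Vector_Spaces.linear s1 s2 f"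
    "\<And>x. x \<in> U \<Longrightarrow> f x \<in> W" "fin_dim s2 W"
    "\<And>x. x \<in> U \<Longrightarrow> f x = 0 \<Longrightarrow> x \<in> K" "fin_dim s1 K"
  shows "vector_space.dim s1 U \<le> vector_space.dim s1 K + vector_space.dim s2 W"
proof -
  interpret vector_space_pair s1 s2 using assms(1,2) by (simp add: vector_space_pair_def)
  interpret l: Vector_Spaces.linear s1 s2 f by fact
  have "vs1.subspace {x \<in> U. f x = 0}"
    using vs1.subspace_inter[OF _ l.subspace_kernel, of U] assms(3) by (simp add: Int_def fin_dim_def)
  then have "vs1.dim {x \<in> U. f x = 0} \<le> vs1.dim K"
    using assms(7,8) by (intro vs1.dim_mono_fin) auto
  moreover have "vs2.dim (f ` U) \<le> vs2.dim W"
    using fin_dim_image[OF assms(3,4)] assms(5,6) by (intro vs2.dim_mono_fin) (auto simp: fin_dim_def)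
  ultimately show ?thesis using rank_nullity[OF assms(3,4)] by linarith
qed

text \<open>Preimages of finitely many generators of the image, together with generators of the
  kernel, generate \<open>U\<close>. This gives finiteness for the spaces of polynomials, which are
  built up one coefficient or component at a time.\<close>

lemma fin_dim_by_map:
  assumes "vector_space s1" "vector_space s2" "module.subspace s1 U" "Vector_Spaces.linear s1 s2 f"
    "fin_dim s2 (f ` U)" "fin_dim s1 {x \<in> U. f x = 0}"
  shows "fin_dim s1 U"
proof -
  interpret vector_space_pair s1 s2 using assms(1,2) by (simp add: vector_space_pair_def)
  interpret l: Vector_Spaces.linear s1 s2 f by fact
  obtain B where B: "B \<subseteq> f ` U" "finite B" "vs2.span B = f ` U"
    by (rule vs2.fin_dim_obtain_basis[OF assms(5) vs2.independent_empty empty_subsetI])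
  obtain C where C: "finite C" "{x \<in> U. f x = 0} \<subseteq> vs1.span C"
    using assms(6) by (auto simp: fin_dim_def)
  obtain D where D: "D \<subseteq> U" "finite D" "f ` D = B"
    using finite_subset_image[OF B(2,1)] by auto
  have "x \<in> vs1.span (D \<union> C)" if x: "x \<in> U" for x
  proof -
    have "f x \<in> vs2.span (f ` D)" using x B(3) D(3) by blast
    then obtain y where y: "y \<in> vs1.span D" "f x = f y" by (auto simp: l.span_image)
    then have "y \<in> U" using vs1.span_minimal[OF D(1) assms(3)] by auto
    then have "x - y \<in> vs1.span C"
      using C(2) y(2) x assms(3) by (auto simp: l.diff vs1.subspace_diff)
    then have "y + (x - y) \<in> vs1.span (D \<union> C)"
      using vs1.span_mono[of D "D \<union> C"] vs1.span_mono[of C "D \<union> C"] y(1)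
      by (intro vs1.span_add) auto
    then show ?thesis by simp
  qed
  then have "U \<subseteq> vs1.span (D \<union> C)" by blast
  moreover have "finite (D \<union> C)" using C(1) D(2) by simp
  ultimately show ?thesis unfolding fin_dim_def using assms(3) by blast
qed

section \<open>Polynomials of bounded degree and restriction to a line\<close>

text \<open>Degrees are bounded strictly: the bound \<open>0\<close> then means the zero polynomial, which is what
  truncated subtraction of degrees should produce.\<close>

definition deg_lt :: "nat \<Rightarrow> 'a::zero poly \<Rightarrow> bool" where
  "deg_lt M q \<longleftrightarrow> (\<forall>i\<ge>M. coeff q i = 0)"

text \<open>\<open>K[x,y]\<close> is \<open>K[x][y]\<close> with \<open>x\<close> inside, so
  \<open>i\<close> and \<open>j\<close> are the exponents of \<open>x\<close> and
  \<open>y\<close>.\<close>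

definition tdeg_lt :: "nat \<Rightarrow> 'a::zero poly poly \<Rightarrow> bool" where
  "tdeg_lt M p \<longleftrightarrow> (\<forall>i j. i + j \<ge> M \<longrightarrow> coeff (coeff p j) i = 0)"

lemma deg_lt_iff_degree: "deg_lt M q \<longleftrightarrow> q = 0 \<or> degree q < M"
  unfolding deg_lt_def by (metis coeff_0 coeff_eq_0 leading_coeff_0_iff linorder_not_less order_less_le_trans)

lemma deg_lt_0 [simp]: "deg_lt M 0" by (simp add: deg_lt_def)
lemma deg_lt_zero_iff [simp]: "deg_lt 0 q \<longleftrightarrow> q = 0" by (simp add: deg_lt_def poly_eq_iff)
lemma deg_lt_add: "deg_lt M p \<Longrightarrow> deg_lt M q \<Longrightarrow> deg_lt M (p + q)" by (simp add: deg_lt_def)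
lemma deg_lt_diff: "deg_lt M p \<Longrightarrow> deg_lt M q \<Longrightarrow> deg_lt M (p - q)" for p :: "'a::ab_group_add poly" by (simp add: deg_lt_def)
lemma deg_lt_smult: "deg_lt M q \<Longrightarrow> deg_lt M (smult c q)" by (simp add: deg_lt_def)
lemma deg_lt_sum: "(\<And>x. x \<in> I \<Longrightarrow> deg_lt M (f x)) \<Longrightarrow> deg_lt M (sum f I)"
  by (simp add: deg_lt_def coeff_sum)
lemma deg_lt_pCons: "deg_lt M (pCons a q) \<longleftrightarrow> deg_lt (M - 1) q \<and> (M = 0 \<longrightarrow> a = 0)"
  by (cases M) (auto simp: deg_lt_iff_degree)

text \<open>One bound is shifted: a degree at most \<open>a\<close> and a degree below
  \<open>b\<close> add up to one below \<open>a + b\<close>, and this stays correct for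
  \<open>b = 0\<close>.\<close>

lemma deg_lt_mult:
  fixes p q :: "'a::comm_ring_1 poly"
  assumes "deg_lt (Suc a) p" "deg_lt b q" shows "deg_lt (a + b) (p * q)"
  unfolding deg_lt_def
proof (intro allI impI)
  fix i assume i: "a + b \<le> i"
  show "coeff (p * q) i = 0" unfolding coeff_mult
  proof (rule sum.neutral, rule ballI)
    fix k assume "k \<in> {..i}"
    show "coeff p k * coeff q (i - k) = 0"
      using assms i unfolding deg_lt_def by (cases "k \<le> a") auto
  qed
qed

lemma tdeg_lt_0 [simp]: "tdeg_lt M 0" by (simp add: tdeg_lt_def)
lemma tdeg_lt_zero_iff [simp]: "tdeg_lt 0 q \<longleftrightarrow> q = 0" by (auto simp: tdeg_lt_def poly_eq_iff)
lemma tdeg_lt_add: "tdeg_lt M p \<Longrightarrow> tdeg_lt M q \<Longrightarrow> tdeg_lt M (p + q)" by (simp add: tdeg_lt_def)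
lemma tdeg_lt_diff: "tdeg_lt M p \<Longrightarrow> tdeg_lt M q \<Longrightarrow> tdeg_lt M (p - q)" for p :: "'a::ab_group_add poly poly"
  by (simp add: tdeg_lt_def)
lemma tdeg_lt_mono: "tdeg_lt M q \<Longrightarrow> M \<le> N \<Longrightarrow> tdeg_lt N q" by (simp add: tdeg_lt_def)
lemma tdeg_lt_smult_const: "tdeg_lt M q \<Longrightarrow> tdeg_lt M (smult [:c:] q)"
  by (simp add: tdeg_lt_def)
lemma tdeg_lt_pCons: "tdeg_lt M (pCons q p) \<longleftrightarrow> deg_lt M q \<and> tdeg_lt (M - 1) p"
proof
  assume *: "tdeg_lt M (pCons q p)"
  have "deg_lt M q" unfolding deg_lt_def
  proof (intro allI impI)
    fix i assume "M \<le> i"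
    then show "coeff q i = 0" using *[unfolded tdeg_lt_def, rule_format, of i 0] by simp
  qed
  moreover have "tdeg_lt (M - 1) p" unfolding tdeg_lt_def
  proof (intro allI impI)
    fix i j assume "M - 1 \<le> i + j"
    then show "coeff (coeff p j) i = 0" using *[unfolded tdeg_lt_def, rule_format, of i "Suc j"] by simp
  qed
  ultimately show "deg_lt M q \<and> tdeg_lt (M - 1) p" ..
next
  assume *: "deg_lt M q \<and> tdeg_lt (M - 1) p"
  show "tdeg_lt M (pCons q p)" unfolding tdeg_lt_def
  proof (intro allI impI)
    fix i j assume "M \<le> i + j"
    then show "coeff (coeff (pCons q p) j) i = 0"
      using * by (cases j) (auto simp: deg_lt_def tdeg_lt_def)
  qed
qed

lemma tdeg_lt_mult:
  fixes p q :: "'a::comm_ring_1 poly poly"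
  assumes "tdeg_lt (Suc a) p" "tdeg_lt b q" shows "tdeg_lt (a + b) (p * q)"
  unfolding tdeg_lt_def
proof (intro allI impI)
  fix i j assume ij: "a + b \<le> i + j"
  have "coeff (coeff p j' * coeff q (j - j')) i = 0" if "j' \<in> {..j}" for j'
    unfolding coeff_mult[of "coeff p j'"]
  proof (rule sum.neutral, rule ballI)
    fix k assume "k \<in> {..i}"
    then show "coeff (coeff p j') k * coeff (coeff q (j - j')) (i - k) = 0"
      using assms ij that unfolding tdeg_lt_def by (cases "k + j' \<le> a") auto
  qed
  then show "coeff (coeff (p * q) j) i = 0"
    unfolding coeff_mult[of p] coeff_sum by (intro sum.neutral) blast
qed

lemma ex_tdeg_lt: "\<exists>K. tdeg_lt K p"
proof (induction p)
  case (pCons q p)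
  then obtain K where "tdeg_lt K p" by blast
  then have "tdeg_lt (Suc K + Suc (degree q)) (pCons q p)"
    by (auto simp: tdeg_lt_pCons deg_lt_iff_degree intro: tdeg_lt_mono)
  then show ?case ..
qed (rule exI[of _ 0], simp)

section \<open>Forms of degree one and their cancellation\<close>

definition lin :: "'a::field \<Rightarrow> 'a \<Rightarrow> 'a \<Rightarrow> 'a poly poly" where
  "lin a b c = [:[:c, a:], [:b:]:]"

lemma tdeg_lt_lin: "tdeg_lt 2 (lin a b c)"
  by (simp add: lin_def tdeg_lt_pCons deg_lt_pCons)

lemma lin_eq_0_iff: "lin a b c = 0 \<longleftrightarrow> a = 0 \<and> b = 0 \<and> c = 0"
  by (auto simp: lin_def)

lemma coeff_lin_mult:
  "coeff (coeff (lin a b c * p) j) i =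
     c * coeff (coeff p j) i + (if i = 0 then 0 else a * coeff (coeff p j) (i - 1)) +
     (if j = 0 then 0 else b * coeff (coeff p (j - 1)) i)"
  by (auto simp: lin_def coeff_pCons algebra_simps split: nat.splits)

text \<open>The top homogeneous part of the product is that of \<open>p\<close> times
  \<open>a x + b y\<close>, which is not zero. Multiplication by the form therefore raises the
  degree by exactly one.\<close>

lemma tdeg_lt_lin_cancel:
  assumes nz: "(a, b) \<noteq> (0, 0)" and t: "tdeg_lt M (lin a b c * p)"
  shows "tdeg_lt (M - 1) p"
proof (rule ccontr)
  assume not: "\<not> tdeg_lt (M - 1) p"
  \<comment> \<open>The least strict bound, so that the degree of \<open>p\<close> is
    \<open>K - 1\<close>.\<close>
  define K where "K = (LEAST K. tdeg_lt K p)"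
  have K: "tdeg_lt K p" unfolding K_def using ex_tdeg_lt by (rule LeastI_ex)
  have "M - 1 < K" using not K tdeg_lt_mono by (metis not_less)
  then have Kp: "K > 0" by simp
  have "\<not> tdeg_lt (K - 1) p" using Kp not_less_Least[of "K - 1" "\<lambda>K. tdeg_lt K p"] K_def by simp
  then obtain i0 j0 where "K - 1 \<le> i0 + j0" "coeff (coeff p j0) i0 \<noteq> 0"
    unfolding tdeg_lt_def by blast
  moreover from this have "i0 + j0 < K" using K unfolding tdeg_lt_def by (meson not_less)
  ultimately have ij0: "i0 + j0 = K - 1" "coeff (coeff p j0) i0 \<noteq> 0" by auto
  have high: "coeff (coeff p j) i = 0" if "i + j \<ge> K" for i j
    using K that unfolding tdeg_lt_def by blast
  have res: "coeff (coeff (lin a b c * p) j) i = 0" if "i + j = K" for i j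
    using t that \<open>M - 1 < K\<close> unfolding tdeg_lt_def by simp
  show False
  proof (cases "b = 0")
    case True
    have "coeff (coeff (lin a b c * p) j0) (Suc i0) = 0" using ij0(1) Kp by (intro res) simp
    moreover have "coeff (coeff p j0) (Suc i0) = 0" using ij0(1) Kp by (intro high) simp
    ultimately show False using True nz ij0(2) by (simp add: coeff_lin_mult split: if_splits)
  next
    case False
    \<comment> \<open>Among the top monomials, the one with the highest power of \<open>y\<close> is
      chosen: after multiplication by \<open>b y\<close> no other term can cancel it.\<close>
    define J where "J = {j. j \<le> K - 1 \<and> coeff (coeff p j) (K - 1 - j) \<noteq> 0}"
    have "i0 = K - 1 - j0" using ij0(1) by simp
    then have J: "finite J" "J \<noteq> {}" unfolding J_def using ij0 by (auto intro!: exI[of _ j0])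
    define j where "j = Max J"
    have j: "j \<le> K - 1" "coeff (coeff p j) (K - 1 - j) \<noteq> 0"
      using Max_in[OF J] unfolding j_def J_def by auto
    let ?i = "K - 1 - j"
    have "Suc j \<notin> J" using Max_ge[OF J(1), of "Suc j"] unfolding j_def by auto
    then have z: "?i \<noteq> 0 \<Longrightarrow> coeff (coeff p (Suc j)) (?i - 1) = 0"
      unfolding J_def by (auto simp: diff_Suc split: nat.splits)
    have "coeff (coeff (lin a b c * p) (Suc j)) ?i = 0" using j(1) Kp by (intro res) simp
    moreover have "coeff (coeff p (Suc j)) ?i = 0" using j(1) by (intro high) simp
    ultimately show False using z False j(2) by (simp add: coeff_lin_mult split: if_splits)
  qed
qed

section \<open>Substitutions and restriction to a line\<close>

definition ev2 :: "'a::field poly \<Rightarrow> 'a poly \<Rightarrow> 'a poly poly \<Rightarrow> 'a poly" where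
  "ev2 u w p = poly (map_poly (\<lambda>q. pcompose q u) p) w"

lemma ev2_0 [simp]: "ev2 u w 0 = 0" by (simp add: ev2_def)
lemma ev2_pCons: "ev2 u w (pCons q p) = pcompose q u + w * ev2 u w p"
  by (simp add: ev2_def map_poly_pCons)
lemma ev2_add: "ev2 u w (p + q) = ev2 u w p + ev2 u w q"
  by (induction p q rule: poly_induct2) (simp_all add: ev2_pCons pcompose_add algebra_simps)
lemma ev2_smult: "ev2 u w (smult q p) = pcompose q u * ev2 u w p"
  by (induction p) (simp_all add: ev2_pCons pcompose_mult algebra_simps)
lemma ev2_mult: "ev2 u w (p * q) = ev2 u w p * ev2 u w q"
  by (induction p) (simp_all add: ev2_pCons ev2_add ev2_smult algebra_simps)
lemma ev2_uminus: "ev2 u w (- p) = - ev2 u w p"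
  using ev2_add[of u w p "-p"] by (simp add: eq_neg_iff_add_eq_0 add.commute)
lemma ev2_diff: "ev2 u w (p - q) = ev2 u w p - ev2 u w q"
  using ev2_add[of u w p "-q"] by (simp add: ev2_uminus)
lemma ev2_1 [simp]: "ev2 u w 1 = 1"
  unfolding one_pCons[where 'a="'a poly"] ev2_pCons by (simp add: pcompose_1)

lemma deg_lt_pcompose:
  fixes q u :: "'a::comm_ring_1 poly"
  assumes "deg_lt M q" "deg_lt 2 u" shows "deg_lt M (pcompose q u)"
  using assms(1)
proof (induction q arbitrary: M)
  case (pCons c q)
  show ?case
  proof (cases M)
    case 0
    with pCons show ?thesis by simp
  next
    case (Suc N)
    then have "deg_lt N (pcompose q u)" using pCons by (simp add: deg_lt_pCons)
    then have "deg_lt M (u * pcompose q u)" using deg_lt_mult[of 1 u N] assms(2) Suc by (simp add: numeral_2_eq_2)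
    then show ?thesis using Suc by (simp add: pcompose_pCons deg_lt_add deg_lt_pCons)
  qed
qed simp

lemma deg_lt_ev2:
  assumes "tdeg_lt M p" "deg_lt 2 u" "deg_lt 2 w" shows "deg_lt M (ev2 u w p)"
  using assms(1)
proof (induction p arbitrary: M)
  case (pCons q p)
  show ?case
  proof (cases M)
    case 0
    with pCons.prems have "pCons q p = 0" by (simp only: tdeg_lt_zero_iff)
    then show ?thesis by (simp only: ev2_0 deg_lt_0)
  next
    case (Suc N)
    then have "deg_lt N (ev2 u w p)" using pCons by (simp add: tdeg_lt_pCons)
    then have "deg_lt M (w * ev2 u w p)" using deg_lt_mult[of 1 w N] assms(3) Suc by (simp add: numeral_2_eq_2)
    then show ?thesis using Suc pCons.prems assms(2) by (simp add: ev2_pCons deg_lt_add deg_lt_pcompose tdeg_lt_pCons)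
  qed
qed simp

text \<open>Goes the opposite way to \<open>ev2\<close>: the variable of \<open>q\<close> is
  replaced by a polynomial in two variables, in order to extend functions from a line to the
  plane.\<close>

definition subst_poly :: "'a::field poly poly \<Rightarrow> 'a poly \<Rightarrow> 'a poly poly" where
  "subst_poly w q = poly (map_poly (\<lambda>c. [:[:c:]:]) q) w"

lemma subst_poly_0 [simp]: "subst_poly w 0 = 0" by (simp add: subst_poly_def)
lemma subst_poly_pCons: "subst_poly w (pCons c q) = [:[:c:]:] + w * subst_poly w q"
  by (simp add: subst_poly_def map_poly_pCons)
lemma subst_poly_add: "subst_poly w (p + q) = subst_poly w p + subst_poly w q"
  by (induction p q rule: poly_induct2) (simp_all add: subst_poly_pCons algebra_simps)
lemma subst_poly_smult: "subst_poly w (smult c p) = [:[:c:]:] * subst_poly w p"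
  by (induction p) (simp_all add: subst_poly_pCons algebra_simps)
lemma subst_poly_mult: "subst_poly w (p * q) = subst_poly w p * subst_poly w q"
  by (induction p) (simp_all add: subst_poly_pCons subst_poly_add subst_poly_smult algebra_simps)

lemma tdeg_lt_subst_poly:
  assumes "deg_lt M q" "tdeg_lt 2 w" shows "tdeg_lt M (subst_poly w q)"
  using assms(1)
proof (induction q arbitrary: M)
  case (pCons c q)
  show ?case
  proof (cases M)
    case 0
    with pCons show ?thesis by simp
  next
    case (Suc N)
    then have "tdeg_lt N (subst_poly w q)" using pCons by (simp add: deg_lt_pCons)
    then have "tdeg_lt M (w * subst_poly w q)" using tdeg_lt_mult[of 1 w N] assms(2) Suc by (simp add: numeral_2_eq_2)
    then show ?thesis using Suc by (simp add: subst_poly_pCons tdeg_lt_add tdeg_lt_pCons deg_lt_pCons)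
  qed
qed simp

text \<open>The line \<open>a x + b y + c = 0\<close> is parametrised by \<open>t \<mapsto> (x0 + b t, y0 - a t)\<close>, and the parameter
  is recovered as \<open>t1 (x - x0) + t2 (y - y0)\<close>.\<close>

locale line_param =
  fixes a b c x0 y0 t1 t2 :: "'a::field"
  assumes base: "a * x0 + b * y0 + c = 0" and dual: "t1 * b - t2 * a = 1"
begin

definition res :: "'a poly poly \<Rightarrow> 'a poly" where
  "res = ev2 [:x0, b:] [:y0, - a:]"

definition lift :: "'a poly \<Rightarrow> 'a poly poly" where
  "lift = subst_poly (lin t1 t2 (- (t1 * x0 + t2 * y0)))"

lemma nonzero: "(a, b) \<noteq> (0, 0)" using dual by auto

lemma res_0 [simp]: "res 0 = 0" and res_1 [simp]: "res 1 = 1"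
  and res_add: "res (p + q) = res p + res q"
  and res_diff: "res (p - q) = res p - res q"
  and res_mult: "res (p * q) = res p * res q"
  by (simp_all add: res_def ev2_add ev2_diff ev2_mult)

lemma res_smult: "res (smult [:k:] p) = smult k (res p)"
  by (simp add: res_def ev2_smult)

lemma res_prod: "res (prod f I) = (\<Prod>i\<in>I. res (f i))"
  by (induction I rule: infinite_finite_induct) (simp_all add: res_mult)

lemma res_lin: "res (lin a' b' c') = [:a' * x0 + b' * y0 + c', a' * b - b' * a:]"
  by (simp add: res_def lin_def ev2_pCons pcompose_pCons algebra_simps)

lemma res_self [simp]: "res (lin a b c) = 0"
  using base by (simp add: res_lin)

lemma deg_lt_res: "tdeg_lt M p \<Longrightarrow> deg_lt M (res p)"
  unfolding res_def by (rule deg_lt_ev2) (simp_all add: deg_lt_pCons)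

lemma tdeg_lt_lift: "deg_lt M q \<Longrightarrow> tdeg_lt M (lift q)"
  unfolding lift_def by (rule tdeg_lt_subst_poly) (simp_all add: tdeg_lt_lin)

lemma res_lift [simp]: "res (lift q) = q"
proof (induction q)
  case (pCons k q)
  have "res (lin t1 t2 (- (t1 * x0 + t2 * y0))) = [:0, 1:]"
    using dual by (simp add: res_lin)
  moreover have "res [:[:k:]:] = [:k:]" by (simp add: res_def ev2_pCons)
  ultimately show ?case using pCons
    by (simp add: lift_def subst_poly_pCons res_add res_mult)
qed (simp add: lift_def)

text \<open>For \<open>x\<close> and for \<open>y\<close> the difference is a constant multiple of
  \<open>lin a b c\<close>, by \<open>base\<close> and \<open>dual\<close>. Both maps are ring
  homomorphisms, so the claim passes to all polynomials along the Horner scheme.\<close>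

lemma lift_res: "lin a b c dvd p - lift (res p)"
proof -
  define T where "T = lin t1 t2 (- (t1 * x0 + t2 * y0))"
  have lx: "[:[:0, 1:]:] - subst_poly T [:x0, b:] = smult [:- t2:] (lin a b c)"
  proof -
    have 1: "b * t1 = 1 + a * t2" using dual by (simp add: algebra_simps)
    have 2: "c = - (a * x0) - b * y0" using base by (simp add: algebra_simps eq_neg_iff_add_eq_0)
    have "b * (t1 * x0) = x0 + a * (t2 * x0)" using arg_cong[OF 1, of "\<lambda>z. z * x0"] by (simp add: algebra_simps)
    then show ?thesis using 1 unfolding 2
      by (simp add: T_def subst_poly_pCons lin_def algebra_simps)
  qed
  have ly: "[:0, 1:] - subst_poly T [:y0, - a:] = smult [:t1:] (lin a b c)"
  proof -
    have 1: "a * t2 = b * t1 - 1" using dual by (simp add: algebra_simps)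
    have 2: "c = - (a * x0) - b * y0" using base by (simp add: algebra_simps eq_neg_iff_add_eq_0)
    have "a * (t2 * y0) = b * (t1 * y0) - y0" using arg_cong[OF 1, of "\<lambda>z. z * y0"] by (simp add: algebra_simps)
    then show ?thesis using 1 unfolding 2
      by (simp add: T_def subst_poly_pCons lin_def algebra_simps one_pCons)
  qed
  have dx: "lin a b c dvd [:[:0, 1:]:] - subst_poly T [:x0, b:]" unfolding lx by (rule dvd_smult) simp
  have dy: "lin a b c dvd [:0, 1:] - subst_poly T [:y0, - a:]" unfolding ly by (rule dvd_smult) simp
  have one: "lin a b c dvd [:q:] - subst_poly T (pcompose q [:x0, b:])" for q
  proof (induction q)
    case (pCons k q)
    have "[:pCons k q:] - subst_poly T (pcompose (pCons k q) [:x0, b:]) =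
        ([:[:0, 1:]:] - subst_poly T [:x0, b:]) * [:q:]
        + subst_poly T [:x0, b:] * ([:q:] - subst_poly T (pcompose q [:x0, b:]))"
    proof -
      have "[:pCons k q:] = [:[:k:]:] + [:[:0, 1:]:] * [:q:]" by simp
      moreover have "subst_poly T (pcompose (pCons k q) [:x0, b:]) =
          [:[:k:]:] + subst_poly T [:x0, b:] * subst_poly T (pcompose q [:x0, b:])"
        by (simp only: pcompose_pCons subst_poly_add subst_poly_mult) (simp add: subst_poly_pCons)
      ultimately show ?thesis by (simp only:) (simp only: algebra_simps)
    qed
    then show ?case using dx pCons by (simp only:) (intro dvd_add dvd_mult dvd_mult2)
  qed simp
  show ?thesis unfolding res_def lift_def T_def[symmetric]
  proof (induction p)
    case (pCons q p)
    have "pCons q p - subst_poly T (ev2 [:x0, b:] [:y0, - a:] (pCons q p)) =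
        ([:q:] - subst_poly T (pcompose q [:x0, b:])) + ([:0, 1:] - subst_poly T [:y0, - a:]) * p
        + subst_poly T [:y0, - a:] * (p - subst_poly T (ev2 [:x0, b:] [:y0, - a:] p))"
    proof -
      have 1: "pCons q p = [:q:] + [:0, 1:] * p" by simp
      have 2: "subst_poly T (ev2 [:x0, b:] [:y0, - a:] (pCons q p)) =
          subst_poly T (pcompose q [:x0, b:]) + subst_poly T [:y0, - a:] * subst_poly T (ev2 [:x0, b:] [:y0, - a:] p)"
        by (simp only: ev2_pCons subst_poly_add subst_poly_mult)
      show ?thesis unfolding 2 unfolding 1 by (simp only: algebra_simps)
    qed
    then show ?case using one[of q] dy pCons by (simp only:) (intro dvd_add dvd_mult dvd_mult2)
  qed simp
qed

lemma res_eq_0_iff: "res p = 0 \<longleftrightarrow> lin a b c dvd p"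
proof
  assume "res p = 0"
  then show "lin a b c dvd p" using lift_res[of p] by (simp add: lift_def)
next
  assume "lin a b c dvd p"
  then show "res p = 0" by (auto simp: res_mult elim!: dvdE)
qed

lemma direction_proportional:
  assumes "a' * b = b' * a"
  shows "\<exists>l. a' = l * a \<and> b' = l * b"
proof -
  \<comment> \<open>The functional \<open>(t1, t2)\<close> has value 1 on the direction
    \<open>(b, - a)\<close>; its value on \<open>(b', - a')\<close> must be the factor.\<close>
  define l where "l = t1 * b' - t2 * a'"
  have "l * b = b' * (t1 * b) - t2 * (a' * b)" by (simp add: l_def algebra_simps)
  also have "\<dots> = b' * (t1 * b - t2 * a)" unfolding assms by (simp add: algebra_simps)
  finally have b: "b' = l * b" using dual by simp
  have "l * a = t1 * (b' * a) - a' * (t2 * a)" by (simp add: l_def algebra_simps)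
  also have "\<dots> = a' * (t1 * b - t2 * a)" unfolding assms[symmetric] by (simp add: algebra_simps)
  finally have "a' = l * a" using dual by simp
  with b show ?thesis by blast
qed

lemma proportional:
  assumes "a' * x0 + b' * y0 + c' = 0" "a' * b = b' * a"
  shows "\<exists>l. a' = l * a \<and> b' = l * b \<and> c' = l * c"
proof -
  obtain l where l: "a' = l * a" "b' = l * b" using direction_proportional[OF assms(2)] by blast
  have "c' - l * c = (a' * x0 + b' * y0 + c') - l * (a * x0 + b * y0 + c)"
    by (simp add: l algebra_simps)
  then have "c' = l * c" using assms(1) base by simp
  with l show ?thesis by blast
qed

text \<open>The ideal of the form is the kernel of restriction to the line, whose values lie in a
  domain.\<close>

lemma lin_prime: "lin a b c dvd p * q \<longleftrightarrow> lin a b c dvd p \<or> lin a b c dvd q"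
  by (simp add: res_mult flip: res_eq_0_iff)

end

lemma ex_line_param:
  assumes "(a, b) \<noteq> (0, 0::'a::field)"
  shows "\<exists>x0 y0 t1 t2. line_param a b c x0 y0 t1 t2"
proof (cases "b = 0")
  case True
  then have "line_param a b c (- c / a) 0 0 (- 1 / a)" using assms by unfold_locales auto
  then show ?thesis by blast
next
  case False
  then have "line_param a b c 0 (- c / b) (1 / b) 0" by unfold_locales auto
  then show ?thesis by blast
qed

section \<open>Adding a line to an arrangement\<close>

text \<open>A fixed equation for every line, so that forms and derivatives are functions of the
  line. Another choice would change them by a nonzero scalar only.\<close>

definition line_eq :: "('a::field^2) set \<Rightarrow> 'a \<times> 'a \<times> 'a" where
  "line_eq H = (SOME (a, b, c). (a, b) \<noteq> (0, 0) \<and> H = line_of a b c)"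

definition eqx :: "('a::field^2) set \<Rightarrow> 'a" where "eqx H = fst (line_eq H)"
definition eqy :: "('a::field^2) set \<Rightarrow> 'a" where "eqy H = fst (snd (line_eq H))"
definition eqc :: "('a::field^2) set \<Rightarrow> 'a" where "eqc H = snd (snd (line_eq H))"

definition lform :: "('a::field^2) set \<Rightarrow> 'a poly poly" where
  "lform H = lin (eqx H) (eqy H) (eqc H)"

lemma line_eq:
  assumes "affine_line H"
  shows "(eqx H, eqy H) \<noteq> (0, 0)" "H = line_of (eqx H) (eqy H) (eqc H)"
proof -
  from assms obtain a b c where *: "(a, b) \<noteq> (0, 0) \<and> H = line_of a b c"
    unfolding affine_line_def by blast
  have e: "case line_eq H of (a, b, c) \<Rightarrow> (a, b) \<noteq> (0, 0) \<and> H = line_of a b c"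
    unfolding line_eq_def by (rule someI[where x = "(a, b, c)"]) (unfold prod.case, rule *)
  obtain a' b' c' where p: "line_eq H = (a', b', c')" by (cases "line_eq H")
  have c: "eqx H = a'" "eqy H = b'" "eqc H = c'" by (simp_all add: eqx_def eqy_def eqc_def p)
  show "(eqx H, eqy H) \<noteq> (0, 0)" "H = line_of (eqx H) (eqy H) (eqc H)"
    unfolding c using e[unfolded p prod.case] by blast+
qed

text \<open>The value on the equation of \<open>H\<close> of the derivation whose components are
  \<open>fst \<theta>\<close> along \<open>x\<close> and \<open>snd \<theta>\<close> along
  \<open>y\<close>.\<close>

definition act :: "('a::field^2) set \<Rightarrow> 'a poly poly \<times> 'a poly poly \<Rightarrow> 'a poly poly" where
  "act H \<theta> = smult [:eqx H:] (fst \<theta>) + smult [:eqy H:] (snd \<theta>)"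

definition vscale :: "'a::field poly poly \<Rightarrow> 'a poly poly \<times> 'a poly poly \<Rightarrow> 'a poly poly \<times> 'a poly poly" where
  "vscale p \<theta> = (p * fst \<theta>, p * snd \<theta>)"

text \<open>Logarithmic derivations of the affine arrangement, filtered by degree. The strict bound
  makes \<open>lfields 0 A\<close> the zero space.\<close>

definition lfields :: "nat \<Rightarrow> ('a::field^2) set set \<Rightarrow> ('a poly poly \<times> 'a poly poly) set" where
  "lfields M A = {\<theta>. tdeg_lt M (fst \<theta>) \<and> tdeg_lt M (snd \<theta>) \<and> (\<forall>H\<in>A. lform H dvd act H \<theta>)}"

lemma act_add: "act H (\<theta> + \<eta>) = act H \<theta> + act H \<eta>"
  and act_diff: "act H (\<theta> - \<eta>) = act H \<theta> - act H \<eta>"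
  and act_vscale: "act H (vscale p \<theta>) = p * act H \<theta>"
  and act_0 [simp]: "act H 0 = 0" "act H (0, 0) = 0"
  by (simp_all add: act_def vscale_def algebra_simps smult_add_right smult_diff_right)

lemma fst_vscale [simp]: "fst (vscale p \<theta>) = p * fst \<theta>" and snd_vscale [simp]: "snd (vscale p \<theta>) = p * snd \<theta>"
  by (simp_all add: vscale_def)

lemma vscale_add: "vscale p (\<theta> + \<eta>) = vscale p \<theta> + vscale p \<eta>"
  and vscale_add_left: "vscale (p + q) \<theta> = vscale p \<theta> + vscale q \<theta>"
  and vscale_vscale: "vscale p (vscale q \<theta>) = vscale (p * q) \<theta>"
  and vscale_0 [simp]: "vscale p 0 = 0" and vscale_0_left [simp]: "vscale 0 \<theta> = 0"
  by (simp_all add: prod_eq_iff algebra_simps)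

lemma lfields_0 [simp]: "0 \<in> lfields M A" by (simp add: lfields_def)
lemma lfields_add: "\<theta> \<in> lfields M A \<Longrightarrow> \<eta> \<in> lfields M A \<Longrightarrow> \<theta> + \<eta> \<in> lfields M A"
  by (simp add: lfields_def tdeg_lt_add act_add)
lemma lfields_diff: "\<theta> \<in> lfields M A \<Longrightarrow> \<eta> \<in> lfields M A \<Longrightarrow> \<theta> - \<eta> \<in> lfields M A"
  by (simp add: lfields_def tdeg_lt_diff act_diff)
lemma lfields_vscale:
  assumes "tdeg_lt n p" "\<theta> \<in> lfields (Suc d) A" shows "vscale p \<theta> \<in> lfields (n + d) A"
proof -
  have "tdeg_lt (n + d) (p * q)" if "tdeg_lt (Suc d) q" for q
    using tdeg_lt_mult[OF that assms(1)] by (simp add: ac_simps)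
  then show ?thesis using assms(2) by (auto simp: lfields_def act_vscale)
qed
lemma lfields_zero_eq: "lfields 0 A = {0}" by (auto simp: lfields_def prod_eq_iff)
lemma lfields_mono: "\<theta> \<in> lfields M A \<Longrightarrow> M \<le> N \<Longrightarrow> \<theta> \<in> lfields N A" by (auto simp: lfields_def intro: tdeg_lt_mono)
lemma lfields_insert: "lfields M (insert H A) = {\<theta> \<in> lfields M A. lform H dvd act H \<theta>}"
  by (auto simp: lfields_def)

lemma tdeg_lt_lin_mult: "tdeg_lt M p \<Longrightarrow> tdeg_lt (Suc M) (lin a b c * p)"
  using tdeg_lt_mult[of 1 "lin a b c" M p] tdeg_lt_lin[of a b c] by (simp add: numeral_2_eq_2)

lemma deg_lt_cancel:
  fixes B :: "'a::field poly"
  assumes "B \<noteq> 0" "deg_lt M (B * q)" shows "deg_lt (M - degree B) q"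
proof (cases "q = 0")
  case False
  then have "degree B + degree q < M" using assms by (simp add: deg_lt_iff_degree degree_mult_eq)
  then show ?thesis unfolding deg_lt_iff_degree by linarith
qed simp

text \<open>Powers of different linear factors are coprime: the multiplicity at \<open>s\<close> is
  measured by \<open>order\<close>, to which the product over the other roots contributes
  nothing.\<close>

lemma prod_linear_powers_dvd:
  fixes p :: "'a::field poly"
  assumes "finite T" "\<And>t. t \<in> T \<Longrightarrow> [:- t, 1:] ^ e t dvd p"
  shows "(\<Prod>t\<in>T. [:- t, 1:] ^ e t) dvd p"
  using assms
proof (induction T)
  case (insert s T)
  let ?P = "\<Prod>t\<in>T. [:- t, 1:] ^ e t"
  from insert have "?P dvd p" by simp
  then obtain r where r: "p = ?P * r" ..
  have nz: "poly ?P s \<noteq> 0" using insert.hyps by (auto simp: poly_prod)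
  have "[:- s, 1:] ^ e s dvd r"
  proof (cases "p = 0")
    case True
    then show ?thesis using r nz by auto
  next
    case False
    then have "e s \<le> order s p" using insert.prems[of s] order_divides by auto
    also have "order s p = order s ?P + order s r" using False r by (simp add: order_mult)
    also have "order s ?P = 0" using nz by (rule order_0I)
    finally show ?thesis by (simp add: order_divides)
  qed
  then show ?case using insert.hyps r by (simp add: mult_dvd_mono mult.commute)
qed simp

lemma lform_prime:
  assumes "affine_line H" "lform H dvd p * q" shows "lform H dvd p \<or> lform H dvd q"
proof -
  obtain x0 y0 t1 t2 where "line_param (eqx H) (eqy H) (eqc H) x0 y0 t1 t2"
    using ex_line_param[OF line_eq(1)[OF assms(1)]] by blast
  then show ?thesis using assms(2) line_param.lin_prime unfolding lform_def by blast
qed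

text \<open>Vanishing of \<open>lform H'\<close> on \<open>H\<close> forces equal directions and a
  common point, so the equations are proportional.\<close>

lemma lform_dvd_lform:
  assumes "affine_line H" "affine_line H'" "lform H dvd lform H'" shows "H = H'"
proof -
  let ?a = "eqx H" let ?b = "eqy H" let ?c = "eqc H"
  let ?a' = "eqx H'" let ?b' = "eqy H'" let ?c' = "eqc H'"
  obtain x0 y0 t1 t2 where "line_param ?a ?b ?c x0 y0 t1 t2"
    using ex_line_param[OF line_eq(1)[OF assms(1)]] by blast
  then interpret line_param ?a ?b ?c x0 y0 t1 t2 .
  have "res (lform H') = 0" using assms(3) by (simp add: res_eq_0_iff lform_def)
  then have e: "?a' * x0 + ?b' * y0 + ?c' = 0" "?a' * ?b = ?b' * ?a" by (auto simp: lform_def res_lin)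
  obtain l where a: "?a' = l * ?a" and b: "?b' = l * ?b" and c: "?c' = l * ?c"
    using proportional[OF e] by blast
  have "l \<noteq> 0" using a b line_eq(1)[OF assms(2)] by auto
  have "?a' * u + ?b' * v + ?c' = l * (?a * u + ?b * v + ?c)" for u v
    unfolding a b c by (simp add: algebra_simps)
  then have "line_of ?a' ?b' ?c' = line_of ?a ?b ?c"
    using \<open>l \<noteq> 0\<close> by (simp add: line_of_def)
  then show ?thesis using line_eq(2) assms(1,2) by metis
qed

lemma not_lform_dvd_prod:
  assumes "finite G" "\<And>H. H \<in> G \<Longrightarrow> affine_line H" "affine_line K" "K \<notin> G"
  shows "\<not> lform K dvd (\<Prod>H\<in>G. lform H)"
  using assms(1,2,4)
proof (induction G)
  case empty
  obtain x0 y0 t1 t2 where "line_param (eqx K) (eqy K) (eqc K) x0 y0 t1 t2"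
    using ex_line_param[OF line_eq(1)[OF assms(3)]] by blast
  then interpret line_param "eqx K" "eqy K" "eqc K" x0 y0 t1 t2 .
  show ?case using res_eq_0_iff[of 1] by (simp add: lform_def)
next
  case (insert L G)
  show ?case
  proof
    assume "lform K dvd (\<Prod>H\<in>insert L G. lform H)"
    then have "lform K dvd lform L \<or> lform K dvd (\<Prod>H\<in>G. lform H)"
      using insert.hyps lform_prime[OF assms(3)] by simp
    moreover have "\<not> lform K dvd lform L" using lform_dvd_lform[of K L] assms(3) insert.prems by auto
    moreover have "\<not> lform K dvd (\<Prod>H\<in>G. lform H)" using insert by auto
    ultimately show False by blast
  qed
qed

text \<open>Forms of different lines are primes that do not divide each other.\<close>

lemma prod_lform_dvd:
  assumes "finite G" "\<And>H. H \<in> G \<Longrightarrow> affine_line H \<and> lform H dvd p"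
  shows "(\<Prod>H\<in>G. lform H) dvd p"
  using assms
proof (induction G)
  case (insert K G)
  then obtain r where r: "p = (\<Prod>H\<in>G. lform H) * r" by (auto elim: dvdE)
  have "\<not> lform K dvd (\<Prod>H\<in>G. lform H)"
    using not_lform_dvd_prod[of G K] insert.hyps insert.prems by auto
  then have "lform K dvd r" using r insert.prems[of K] lform_prime[of K "\<Prod>H\<in>G. lform H" r] by auto
  then show ?case using insert.hyps r by (simp add: mult_dvd_mono mult.commute)
qed simp

lemma tdeg_lt_prod_lform_cancel:
  assumes "finite G" "\<And>H. H \<in> G \<Longrightarrow> affine_line H" "tdeg_lt M ((\<Prod>H\<in>G. lform H) * p)"
  shows "tdeg_lt (M - card G) p"
  using assms
proof (induction G arbitrary: M)
  case (insert K G)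
  have "tdeg_lt (M - 1) ((\<Prod>H\<in>G. lform H) * p)"
    by (rule tdeg_lt_lin_cancel[OF line_eq(1)[of K]])
       (use insert in \<open>auto simp: lform_def ac_simps\<close>)
  from insert.IH[OF _ this] insert show ?case by simp
qed simp

lemma tdeg_lt_prod_lform:
  assumes "finite G" shows "tdeg_lt (Suc (card G)) (\<Prod>H\<in>G. lform H)"
  using assms
proof (induction G)
  case empty
  then show ?case by (simp add: one_pCons tdeg_lt_pCons deg_lt_pCons)
next
  case (insert K G)
  then show ?case using tdeg_lt_lin_mult[OF insert.IH] by (simp add: lform_def)
qed

section \<open>Intersection of a line with the lines of an arrangement\<close>

lemma vec2_eq_iff: "p = q \<longleftrightarrow> p $ 1 = q $ 1 \<and> p $ 2 = q $ 2" for p q :: "'a^2"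
  by (simp add: vec_eq_iff forall_2)

text \<open>Here \<open>A\<close> is the arrangement without \<open>H\<close> and
  \<open>insert H A\<close> the larger one, so the locale serves for adding a line as well as for
  removing one.\<close>

locale added_line = line_param "eqx H" "eqy H" "eqc H" x0 y0 t1 t2
  for H :: "('a::field^2) set" and x0 y0 t1 t2 +
  fixes A :: "('a^2) set set"
  assumes arr: "line_arrangement A" and line_H: "affine_line H" and notin: "H \<notin> A"
begin

lemma fin: "finite A" and line_A: "K \<in> A \<Longrightarrow> affine_line K"
  using arr by (auto simp: line_arrangement_def)

definition pt :: "'a \<Rightarrow> 'a^2" where
  "pt t = vector [x0 + eqy H * t, y0 - eqx H * t]"

lemma pt_nth [simp]: "pt t $ 1 = x0 + eqy H * t" "pt t $ 2 = y0 - eqx H * t"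
  by (simp_all add: pt_def)

lemma inj_pt: "inj pt"
proof (rule injI)
  fix s t assume "pt s = pt t"
  then have "eqy H * s = eqy H * t" "eqx H * s = eqx H * t"
    using pt_nth[of s] pt_nth[of t] by auto
  then show "s = t" using nonzero by auto
qed

lemma pt_in_iff:
  assumes "affine_line K"
  shows "pt t \<in> K \<longleftrightarrow> poly (res (lform K)) t = 0"
proof -
  have "pt t \<in> K \<longleftrightarrow> pt t \<in> line_of (eqx K) (eqy K) (eqc K)" using line_eq(2)[OF assms] by simp
  also have "\<dots> \<longleftrightarrow> poly (res (lform K)) t = 0"
    by (simp add: line_of_def lform_def res_lin algebra_simps)
  finally show ?thesis .
qed

lemma H_eq: "H = range pt"
proof
  show "range pt \<subseteq> H"
    using pt_in_iff[OF line_H] by (auto simp: lform_def)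
  show "H \<subseteq> range pt"
  proof
    fix p assume "p \<in> H"
    then have "p \<in> line_of (eqx H) (eqy H) (eqc H)" using line_eq(2)[OF line_H] by simp
    then have p: "eqx H * p $ 1 + eqy H * p $ 2 + eqc H = 0" by (simp add: line_of_def)
    define u where "u = p $ 1 - x0"
    define v where "v = p $ 2 - y0"
    have "eqx H * u + eqy H * v = (eqx H * p $ 1 + eqy H * p $ 2 + eqc H) - (eqx H * x0 + eqy H * y0 + eqc H)"
      by (simp add: u_def v_def algebra_simps)
    then have uv: "eqx H * u = - (eqy H * v)" using p base by (simp add: eq_neg_iff_add_eq_0)
    define t where "t = t1 * u + t2 * v"
    have "eqy H * t = (t1 * eqy H) * u + t2 * (eqy H * v)" by (simp add: t_def algebra_simps)
    also have "eqy H * v = - (eqx H * u)" using uv by simp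
    also have "(t1 * eqy H) * u + t2 * (- (eqx H * u)) = (t1 * eqy H - t2 * eqx H) * u"
      by (simp add: algebra_simps)
    finally have 1: "eqy H * t = u" using dual by simp
    have "- (eqx H * t) = - t1 * (eqx H * u) - t2 * eqx H * v" by (simp add: t_def algebra_simps)
    also have "\<dots> = (t1 * eqy H - t2 * eqx H) * v" unfolding uv by (simp add: algebra_simps)
    finally have 2: "- (eqx H * t) = v" using dual by simp
    have "p = pt t"
      unfolding vec2_eq_iff pt_nth using 1 2 by (simp add: u_def v_def algebra_simps)
    then show "p \<in> range pt" by blast
  qed
qed

lemma in_H_iff: "p \<in> H \<longleftrightarrow> (\<exists>t. p = pt t)"
  using H_eq by blast

lemma res_lform_nz: "K \<in> A \<Longrightarrow> res (lform K) \<noteq> 0"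
  using lform_dvd_lform[OF line_H line_A, of K] notin by (auto simp: res_eq_0_iff lform_def)

definition T :: "'a set" where "T = {t. \<exists>K\<in>A. pt t \<in> K}"

definition through :: "'a \<Rightarrow> ('a^2) set set" where "through t = {K \<in> A. pt t \<in> K}"

text \<open>In the projective plane these are the lines of \<open>A\<close> that meet
  \<open>H\<close> at infinity.\<close>

definition par :: "('a^2) set set" where
  "par = {K \<in> A. eqx K * eqy H = eqy K * eqx H}"

lemma finite_through [simp]: "finite (through t)" and finite_par [simp]: "finite par"
  using fin by (simp_all add: through_def par_def)

lemma T_eq: "T = (\<Union>K\<in>A. {t. poly (res (lform K)) t = 0})"
  using pt_in_iff line_A by (auto simp: T_def)

lemma finite_T [simp]: "finite T"
  unfolding T_eq using fin res_lform_nz poly_roots_finite by blast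

lemma par_res: "K \<in> par \<Longrightarrow> \<exists>c. c \<noteq> 0 \<and> res (lform K) = [:c:]"
  using res_lform_nz[of K] by (auto simp: par_def lform_def res_lin)

lemma not_par_res: "K \<in> A - par \<Longrightarrow> \<exists>c t. c \<noteq> 0 \<and> res (lform K) = smult c [:- t, 1:]"
proof -
  assume K: "K \<in> A - par"
  define c where "c = eqx K * eqy H - eqy K * eqx H"
  define d where "d = eqx K * x0 + eqy K * y0 + eqc K"
  have "c \<noteq> 0" using K by (auto simp: c_def par_def)
  then have "res (lform K) = smult c [:- (- d / c), 1:]"
    by (simp add: lform_def res_lin c_def[symmetric] d_def[symmetric])
  then show ?thesis using \<open>c \<noteq> 0\<close> by blast
qed

lemma through_par: "t \<in> T \<Longrightarrow> K \<in> through t \<Longrightarrow> K \<notin> par"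
  using par_res[of K] pt_in_iff[OF line_A] by (auto simp: through_def)

lemma through_res: "K \<in> through t \<Longrightarrow> [:- t, 1:] dvd res (lform K)"
  using pt_in_iff[OF line_A] by (auto simp: through_def poly_eq_0_iff_dvd)

lemma through_res_eq: "K \<in> through t \<Longrightarrow> \<exists>d. d \<noteq> 0 \<and> res (lform K) = smult d [:- t, 1:]"
proof -
  assume K: "K \<in> through t"
  then have "t \<in> T" "K \<in> A" by (auto simp: T_def through_def)
  then obtain d s where d: "d \<noteq> 0" "res (lform K) = smult d [:- s, 1:]"
    using not_par_res[of K] through_par[OF _ K] by blast
  have "s = t" using through_res[OF K] d by (simp add: poly_eq_0_iff_dvd[symmetric])
  then show ?thesis using d by blast
qed

lemma card_through_pos: "t \<in> T \<Longrightarrow> card (through t) \<ge> 1"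
proof -
  assume "t \<in> T"
  then have "through t \<noteq> {}" by (auto simp: T_def through_def)
  then show ?thesis by (simp add: Suc_le_eq card_gt_0_iff)
qed

lemma A_decomp: "A = par \<union> (\<Union>t\<in>T. through t)"
proof
  show "A \<subseteq> par \<union> (\<Union>t\<in>T. through t)"
  proof
    fix K assume K: "K \<in> A"
    show "K \<in> par \<union> (\<Union>t\<in>T. through t)"
    proof (cases "K \<in> par")
      case False
      then obtain c t where "c \<noteq> 0" "res (lform K) = smult c [:- t, 1:]"
        using not_par_res K by blast
      then have "pt t \<in> K" using pt_in_iff[OF line_A[OF K]] by simp
      then show ?thesis using K by (auto simp: T_def through_def)
    qed simp
  qed
qed (auto simp: par_def through_def)

text \<open>The restriction to \<open>H\<close> of a line that meets it is a nonconstant polynomial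
  of degree one.\<close>

lemma through_disj:
  assumes "s \<noteq> t" shows "through s \<inter> through t = {}"
proof (rule ccontr)
  assume "through s \<inter> through t \<noteq> {}"
  then obtain K where K: "K \<in> A" "poly (res (lform K)) s = 0" "poly (res (lform K)) t = 0"
    using pt_in_iff[OF line_A] by (auto simp: through_def)
  have "K \<notin> par" using par_res[of K] K by auto
  then obtain c u where "c \<noteq> 0" "res (lform K) = smult c [:- u, 1:]" using not_par_res K(1) by blast
  then show False using K(2,3) assms by simp
qed

lemma card_A: "card A = card par + (\<Sum>t\<in>T. card (through t))"
proof -
  have "card A = card par + card (\<Union>t\<in>T. through t)"
    by (subst A_decomp, rule card_Un_disjoint) (use through_par in auto)
  also have "card (\<Union>t\<in>T. through t) = (\<Sum>t\<in>T. card (through t))"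
    using through_disj by (intro card_UN_disjoint) auto
  finally show ?thesis .
qed

lemma card_T_le: "card par + card T \<le> card A"
proof -
  have "card T = (\<Sum>t\<in>T. 1)" by simp
  also have "\<dots> \<le> (\<Sum>t\<in>T. card (through t))" by (intro sum_mono card_through_pos)
  finally show ?thesis using card_A by simp
qed

text \<open>Connects the combinatorial number with zeros of polynomials: \<open>T\<close> holds the
  parameters of the points that \<open>restriction\<close> collects.\<close>

lemma n_points_eq: "n_points (insert H A) H = card T"
proof -
  have "restriction (insert H A) H = (\<lambda>t. {pt t}) ` T"
  proof (intro set_eqI iffI)
    fix X assume "X \<in> restriction (insert H A) H"
    then obtain K where K: "X = H \<inter> K" "K \<in> A" "X \<noteq> {}" by (auto simp: restriction_def)
    then obtain p where p: "p \<in> H" "p \<in> K" by blast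
    then obtain t where "p = pt t" using in_H_iff by blast
    with p have t: "pt t \<in> K" by simp
    have uniq: "s = t" if "pt s \<in> K" for s
      using through_disj[of s t] that t K(2) by (auto simp: through_def)
    have "X = {pt t}"
    proof (intro set_eqI iffI)
      fix p assume "p \<in> X"
      then obtain s where "p = pt s" "p \<in> K" using K(1) in_H_iff[of p] by blast
      then show "p \<in> {pt t}" using uniq by simp
    next
      fix p assume "p \<in> {pt t}"
      then show "p \<in> X" using K(1) t in_H_iff[of p] by blast
    qed
    moreover have "t \<in> T" using t K(2) by (auto simp: T_def)
    ultimately show "X \<in> (\<lambda>t. {pt t}) ` T" by blast
  next
    fix X assume "X \<in> (\<lambda>t. {pt t}) ` T"
    then obtain t K where K: "X = {pt t}" "K \<in> A" "pt t \<in> K" by (auto simp: T_def)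
    have uniq: "s = t" if "pt s \<in> K" for s
      using through_disj[of s t] that K(2,3) by (auto simp: through_def)
    have "X = H \<inter> K"
    proof (intro set_eqI iffI)
      fix p assume "p \<in> H \<inter> K"
      then obtain s where "p = pt s" "p \<in> K" using in_H_iff[of p] by blast
      then show "p \<in> X" using uniq K(1) by simp
    next
      fix p assume "p \<in> X"
      then show "p \<in> H \<inter> K" using K(1,3) in_H_iff[of p] by blast
    qed
    moreover have "K \<noteq> H" using K(2) notin by blast
    ultimately show "X \<in> restriction (insert H A) H" unfolding restriction_def using K(1,2) by blast
  qed
  moreover have "inj_on (\<lambda>t. {pt t}) T" using inj_pt by (auto simp: inj_on_def)
  ultimately show ?thesis by (simp add: n_points_def card_image)
qed

text \<open>\<open>B\<close> and \<open>PT\<close> collect the zeros forced on the values of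
  \<open>sigma\<close> and of \<open>rho\<close>: order \<open>m - 1\<close> and order 1 at a point
  of \<open>H\<close> that lies on \<open>m\<close> lines of \<open>A\<close>.\<close>

definition B :: "'a poly" where "B = (\<Prod>t\<in>T. [:- t, 1:] ^ (card (through t) - 1))"
definition PT :: "'a poly" where "PT = (\<Prod>t\<in>T. [:- t, 1:])"

lemma B_nz [simp]: "B \<noteq> 0" and PT_nz [simp]: "PT \<noteq> 0"
  by (simp_all add: B_def PT_def)

lemma degree_PT: "degree PT = card T"
  unfolding PT_def by (subst degree_prod_eq_sum_degree) auto

text \<open>The \<open>card par\<close> subtracted here is accounted for at infinity, by
  \<open>deg_lt_sigma_par\<close>.\<close>

lemma degree_B: "degree B = card A - card par - card T"
proof -
  have "degree B = (\<Sum>t\<in>T. card (through t) - 1)"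
    unfolding B_def by (subst degree_prod_eq_sum_degree) (auto simp: degree_power_eq)
  also have "\<dots> = (\<Sum>t\<in>T. card (through t)) - (\<Sum>t\<in>T. 1)"
    using card_through_pos by (intro sum_subtractf_nat) auto
  finally show ?thesis using card_A by simp
qed

text \<open>On \<open>H\<close>, a vector field in the kernel of \<open>sigma\<close> is \<open>rho\<close> times the direction of \<open>H\<close>.\<close>

definition sigma :: "'a poly poly \<times> 'a poly poly \<Rightarrow> 'a poly" where
  "sigma \<theta> = res (act H \<theta>)"

definition rho :: "'a poly poly \<times> 'a poly poly \<Rightarrow> 'a poly" where
  "rho \<theta> = smult t1 (res (fst \<theta>)) + smult t2 (res (snd \<theta>))"

lemma sigma_add: "sigma (\<theta> + \<eta>) = sigma \<theta> + sigma \<eta>"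
  and sigma_diff: "sigma (\<theta> - \<eta>) = sigma \<theta> - sigma \<eta>"
  and sigma_vscale: "sigma (vscale p \<theta>) = res p * sigma \<theta>"
  and sigma_0 [simp]: "sigma 0 = 0"
  by (simp_all add: sigma_def act_add act_diff act_vscale res_add res_diff res_mult)

lemma rho_add: "rho (\<theta> + \<eta>) = rho \<theta> + rho \<eta>"
  and rho_diff: "rho (\<theta> - \<eta>) = rho \<theta> - rho \<eta>"
  and rho_vscale: "rho (vscale p \<theta>) = res p * rho \<theta>"
  and rho_0 [simp]: "rho 0 = 0"
  by (simp_all add: rho_def res_add res_diff res_mult smult_add_right smult_diff_right algebra_simps)

lemma sigma_eq_0_iff: "sigma \<theta> = 0 \<longleftrightarrow> lform H dvd act H \<theta>"
  by (simp add: sigma_def res_eq_0_iff lform_def)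

lemma lfields_insert_iff: "\<theta> \<in> lfields M (insert H A) \<longleftrightarrow> \<theta> \<in> lfields M A \<and> sigma \<theta> = 0"
  by (auto simp: lfields_insert sigma_eq_0_iff)

lemma sigma_eq: "sigma \<theta> = smult (eqx H) (res (fst \<theta>)) + smult (eqy H) (res (snd \<theta>))"
  by (simp add: sigma_def act_def res_add res_smult)

text \<open>\<open>(eqx H, eqy H)\<close> and \<open>(t1, t2)\<close> form a basis of the linear
  functionals; once the first vanishes, a field on \<open>H\<close> is determined by the value
  \<open>rho\<close> of the second.\<close>

lemma res_of_rho:
  assumes "sigma \<theta> = 0"
  shows "res (fst \<theta>) = smult (eqy H) (rho \<theta>)" "res (snd \<theta>) = smult (- eqx H) (rho \<theta>)"
proof -
  have s: "smult (eqx H) (res (fst \<theta>)) = - smult (eqy H) (res (snd \<theta>))"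
    using assms unfolding sigma_eq by (simp add: eq_neg_iff_add_eq_0)
  have "smult (eqy H) (rho \<theta>) = smult (t1 * eqy H) (res (fst \<theta>)) + smult t2 (smult (eqy H) (res (snd \<theta>)))"
    by (simp add: rho_def smult_add_right mult.commute)
  also have "smult (eqy H) (res (snd \<theta>)) = - smult (eqx H) (res (fst \<theta>))" using s by simp
  also have "smult (t1 * eqy H) (res (fst \<theta>)) + smult t2 (- smult (eqx H) (res (fst \<theta>)))
      = smult (t1 * eqy H - t2 * eqx H) (res (fst \<theta>))"
    by (simp add: smult_diff_left)
  finally show "res (fst \<theta>) = smult (eqy H) (rho \<theta>)" using dual by simp
  have "smult (- eqx H) (rho \<theta>) = smult (- t1) (smult (eqx H) (res (fst \<theta>))) + smult (- t2 * eqx H) (res (snd \<theta>))"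
    by (simp add: rho_def smult_add_right mult.commute)
  also have "\<dots> = smult (t1 * eqy H - t2 * eqx H) (res (snd \<theta>))"
    unfolding s by (simp add: smult_diff_left)
  finally show "res (snd \<theta>) = smult (- eqx H) (rho \<theta>)" using dual by simp
qed

lemma deg_lt_rho: "\<theta> \<in> lfields M A \<Longrightarrow> deg_lt M (rho \<theta>)"
  by (auto simp: rho_def lfields_def intro!: deg_lt_add deg_lt_smult deg_lt_res)

end

section \<open>Images and kernels of \<open>sigma\<close> and \<open>rho\<close>\<close>

context added_line begin

lemma res_const: "res [:[:k:]:] = [:k:]"
  by (simp add: res_def ev2_pCons)

lemma sigma_const: "sigma ([:[:v:]:], [:[:w:]:]) = [:eqx H * v + eqy H * w:]"
  by (simp add: sigma_eq res_const)

text \<open>Let \<open>E\<close> be the radial field centred at \<open>pt t\<close>.  The determinant \<open>W\<close> of \<open>\<theta>\<close> and \<open>E\<close> is divisible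
  by every line of \<open>A\<close> through that point, and its restriction to \<open>H\<close> is \<open>- (x - t) sigma \<theta>\<close>.\<close>

lemma B_dvd_sigma:
  assumes "\<theta> \<in> lfields M A" shows "B dvd sigma \<theta>"
  unfolding B_def
proof (rule prod_linear_powers_dvd[OF finite_T])
  fix t assume t: "t \<in> T"
  define p where "p = x0 + eqy H * t"
  define q where "q = y0 - eqx H * t"
  define ex where "ex = lin 1 0 (- p)"
  define ey where "ey = lin 0 1 (- q)"
  define W where "W = fst \<theta> * ey - snd \<theta> * ex"
  have lform_eq: "lform K = smult [:eqx K:] ex + smult [:eqy K:] ey" if "K \<in> through t" for K
  proof -
    have "poly (res (lform K)) t = 0" using that pt_in_iff[OF line_A] by (auto simp: through_def)
    then have "eqc K = - (eqx K * p) - eqy K * q"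
      by (simp add: lform_def res_lin p_def q_def algebra_simps eq_neg_iff_add_eq_0)
    then show ?thesis by (simp add: lform_def lin_def ex_def ey_def)
  qed
  have "lform K dvd W" if K: "K \<in> through t" for K
  proof -
    have KA: "K \<in> A" using K by (simp add: through_def)
    have d: "lform K dvd act K \<theta>" using assms KA by (simp add: lfields_def)
    \<comment> \<open>Replacing \<open>ex\<close> by \<open>lform K\<close> in the determinant makes
      \<open>eqx K * W\<close> a combination of \<open>act K \<theta>\<close> and
      \<open>lform K\<close>; likewise for \<open>eqy K\<close> below.\<close>
    have "smult [:eqx K:] W = act K \<theta> * ey - snd \<theta> * lform K"
      unfolding W_def act_def lform_eq[OF K]
      by (simp add: algebra_simps smult_diff_right)
    then have 1: "lform K dvd smult [:eqx K:] W" using d by simp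
    have "smult [:eqy K:] W = fst \<theta> * lform K - act K \<theta> * ex"
      unfolding W_def act_def lform_eq[OF K]
      by (simp add: algebra_simps smult_diff_right)
    then have 2: "lform K dvd smult [:eqy K:] W" using d by simp
    have cancel: "lform K dvd W" if "c \<noteq> 0" "lform K dvd smult [:c:] W" for c
    proof -
      have "smult [:inverse c:] (smult [:c:] W) = W" using that(1) by (simp add: pCons_one)
      then show ?thesis using dvd_smult[OF that(2), of "[:inverse c:]"] by simp
    qed
    show ?thesis using 1 2 cancel line_eq(1)[OF line_A[OF KA]] by blast
  qed
  then have "(\<Prod>K\<in>through t. lform K) dvd W"
    using line_A by (intro prod_lform_dvd[OF finite_through]) (auto simp: through_def)
  then have "res (\<Prod>K\<in>through t. lform K) dvd res W" by (auto simp: res_mult elim!: dvdE)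
  moreover have "(\<Prod>K\<in>through t. [:- t, 1:]) dvd res (\<Prod>K\<in>through t. lform K)"
    unfolding res_prod by (rule prod_dvd_prod) (rule through_res)
  ultimately have d: "[:- t, 1:] ^ card (through t) dvd res W" using dvd_trans by auto
  define u where "u = [:- t, 1:]"
  \<comment> \<open>On \<open>H\<close> the radial field is \<open>x - t\<close> times the direction
    of \<open>H\<close>. This costs one of the zeros, hence the exponent
    \<open>card (through t) - 1\<close>.\<close>
  have rx: "res ex = smult (eqy H) u" "res ey = smult (- eqx H) u"
    by (simp_all add: ex_def ey_def res_lin p_def q_def u_def)
  have "res W = - (u * sigma \<theta>)"
    unfolding W_def res_diff res_mult rx sigma_eq
    by (simp add: algebra_simps smult_add_right smult_diff_right)
  then have "res W = - ([:- t, 1:] * sigma \<theta>)" by (simp only: u_def)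
  moreover obtain m where m: "card (through t) = Suc m"
    using card_through_pos[OF t] by (cases "card (through t)") auto
  ultimately have "[:- t, 1:] * [:- t, 1:] ^ m dvd [:- t, 1:] * sigma \<theta>"
    using d by (simp only: dvd_minus_iff power_Suc)
  then show "[:- t, 1:] ^ (card (through t) - 1) dvd sigma \<theta>"
    unfolding m diff_Suc_1 by (simp only: dvd_mult_cancel_left) simp
qed

text \<open>Parallel lines have, up to a factor, the same linear part, and a derivation does not see
  the constant term.\<close>

lemma par_proportional:
  assumes "K \<in> par" shows "\<exists>k. k \<noteq> 0 \<and> act H \<theta> = smult [:k:] (act K \<theta>)"
proof -
  have e: "eqx K * eqy H = eqy K * eqx H" and K: "affine_line K" using assms line_A by (auto simp: par_def)
  obtain l where x: "eqx K = l * eqx H" and y: "eqy K = l * eqy H"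
    using direction_proportional[OF e] by blast
  have "l \<noteq> 0" using x y line_eq(1)[OF K] by auto
  then have "[:inverse l:] * [:l * z:] = [:z:]" for z by (simp add: field_simps)
  then have "act H \<theta> = smult [:inverse l:] (act K \<theta>)"
    unfolding act_def x y smult_add_right smult_smult by (simp only:)
  then show ?thesis using \<open>l \<noteq> 0\<close> by (intro exI[of _ "inverse l"]) simp
qed

lemma res_prod_par:
  assumes "G \<subseteq> par" shows "\<exists>c. c \<noteq> 0 \<and> res (\<Prod>K\<in>G. lform K) = [:c:]"
  using finite_subset[OF assms finite_par] assms
proof (induction G)
  case (insert K G)
  then obtain c where "c \<noteq> 0" "res (\<Prod>K\<in>G. lform K) = [:c:]" by auto
  moreover obtain d where "d \<noteq> 0" "res (lform K) = [:d:]" using par_res insert.prems by blast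
  ultimately show ?case using insert.hyps by (simp add: res_mult)
qed (use exI[of "\<lambda>c. c \<noteq> 0 \<and> 1 = [:c:]" "1::'a"] in \<open>simp add: pCons_one\<close>)

text \<open>The zeros at infinity: all forms of lines parallel to \<open>H\<close> divide
  \<open>act H \<theta>\<close>, and on \<open>H\<close> they are nonzero constants. Their product
  therefore lowers the degree without contributing zeros.\<close>

lemma deg_lt_sigma_par:
  assumes "\<theta> \<in> lfields M A" shows "deg_lt (M - card par) (sigma \<theta>)"
proof -
  have "(\<Prod>K\<in>par. lform K) dvd act H \<theta>"
  proof (rule prod_lform_dvd, simp)
    fix K assume K: "K \<in> par"
    then have "K \<in> A" by (simp add: par_def)
    then have "lform K dvd act K \<theta>" using assms by (simp add: lfields_def)
    then show "affine_line K \<and> lform K dvd act H \<theta>"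
      using par_proportional[OF K, of \<theta>] line_A[OF \<open>K \<in> A\<close>] dvd_smult by metis
  qed
  then obtain s where s: "act H \<theta> = (\<Prod>K\<in>par. lform K) * s" ..
  have "tdeg_lt M (act H \<theta>)"
    using assms by (auto simp: act_def lfields_def intro!: tdeg_lt_add tdeg_lt_smult_const)
  then have "tdeg_lt (M - card par) s"
    unfolding s by (rule tdeg_lt_prod_lform_cancel[rotated 2]) (use finite_par in \<open>auto simp: par_def line_A\<close>)
  then have "deg_lt (M - card par) (res s)" by (rule deg_lt_res)
  moreover obtain c where "res (\<Prod>K\<in>par. lform K) = [:c:]" using res_prod_par by blast
  then have "sigma \<theta> = smult c (res s)" by (simp add: sigma_def s res_mult)
  ultimately show ?thesis by (simp add: deg_lt_smult)
qed

text \<open>The zeros at finite points and the drop in degree at infinity add up to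
  \<open>card A - card T\<close>.\<close>

lemma sigma_image_le:
  assumes "\<theta> \<in> lfields M A"
  shows "\<exists>q. deg_lt (M - (card A - card T)) q \<and> sigma \<theta> = B * q"
proof -
  obtain q where q: "sigma \<theta> = B * q" using B_dvd_sigma[OF assms] ..
  have "deg_lt (M - card par - degree B) q"
    using deg_lt_sigma_par[OF assms] unfolding q by (rule deg_lt_cancel[OF B_nz])
  moreover have "M - card par - degree B = M - (card A - card T)"
    using card_T_le by (simp add: degree_B)
  ultimately show ?thesis using q by auto
qed

text \<open>At a point where a line \<open>K\<close> of \<open>A\<close> crosses \<open>H\<close>,
  the field is tangent to two different directions, so it vanishes there.\<close>

lemma rho_image_le:
  assumes "\<theta> \<in> lfields M (insert H A)"
  shows "\<exists>u. deg_lt (M - card T) u \<and> rho \<theta> = PT * u"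
proof -
  have s0: "sigma \<theta> = 0" and \<theta>: "\<theta> \<in> lfields M A" using assms by (simp_all add: lfields_insert_iff)
  have "(\<Prod>t\<in>T. [:- t, 1:] ^ 1) dvd rho \<theta>"
  proof (rule prod_linear_powers_dvd[OF finite_T])
    fix t assume t: "t \<in> T"
    then obtain K where K: "K \<in> through t" by (auto simp: T_def through_def)
    then have KA: "K \<in> A" by (simp add: through_def)
    have "lform K dvd act K \<theta>" using \<theta> KA by (simp add: lfields_def)
    then obtain w where "act K \<theta> = lform K * w" ..
    moreover have "poly (res (lform K)) t = 0" using K pt_in_iff[OF line_A] by (auto simp: through_def)
    ultimately have "poly (res (act K \<theta>)) t = 0" by (simp add: res_mult)
    moreover have "res (act K \<theta>) = smult (eqx K * eqy H - eqy K * eqx H) (rho \<theta>)"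
      by (simp add: act_def res_add res_smult res_of_rho[OF s0] smult_diff_left)
    moreover have "eqx K * eqy H - eqy K * eqx H \<noteq> 0"
      using through_par[OF t K] KA by (simp add: par_def)
    ultimately show "[:- t, 1:] ^ 1 dvd rho \<theta>" by (simp add: poly_eq_0_iff_dvd)
  qed
  then obtain u where u: "rho \<theta> = PT * u" by (auto simp: PT_def elim!: dvdE)
  have "deg_lt (M - degree PT) u"
    using deg_lt_rho[OF \<theta>] unfolding u by (rule deg_lt_cancel[OF PT_nz])
  then show ?thesis using u by (auto simp: degree_PT)
qed

text \<open>A tangent field whose tangential component vanishes is zero on \<open>H\<close>, hence
  divisible by its form. The quotient remains tangent to each \<open>K\<close> in \<open>A\<close>,
  as \<open>lform K\<close> is prime and does not divide \<open>lform H\<close>.\<close>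

lemma rho_kernel:
  assumes "\<theta> \<in> lfields M (insert H A)" "rho \<theta> = 0"
  shows "\<exists>\<eta> \<in> lfields (M - 1) A. \<theta> = vscale (lform H) \<eta>"
proof -
  have s0: "sigma \<theta> = 0" and \<theta>: "\<theta> \<in> lfields M A" using assms by (simp_all add: lfields_insert_iff)
  have "lform H dvd fst \<theta>" "lform H dvd snd \<theta>"
    using res_of_rho[OF s0] assms(2) by (simp_all add: res_eq_0_iff lform_def)
  then obtain f g where fg: "fst \<theta> = lform H * f" "snd \<theta> = lform H * g" by (auto elim!: dvdE)
  then have eq: "\<theta> = vscale (lform H) (f, g)" by (simp add: prod_eq_iff)
  have "(f, g) \<in> lfields (M - 1) A"
    unfolding lfields_def
  proof (intro CollectI conjI ballI)
    have "tdeg_lt M (lform H * f)" "tdeg_lt M (lform H * g)" using \<theta> fg by (simp_all add: lfields_def)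
    then show "tdeg_lt (M - 1) (fst (f, g))" "tdeg_lt (M - 1) (snd (f, g))"
      unfolding lform_def fst_conv snd_conv using tdeg_lt_lin_cancel[OF nonzero] by blast+
    fix K assume K: "K \<in> A"
    have "lform K dvd lform H * act K (f, g)"
      using \<theta> K unfolding eq lfields_def by (auto simp: act_vscale)
    moreover have "\<not> lform K dvd lform H" using lform_dvd_lform[OF line_A[OF K] line_H] K notin by blast
    ultimately show "lform K dvd act K (f, g)" using lform_prime[OF line_A[OF K]] by blast
  qed
  then show ?thesis using eq by blast
qed

lemma vscale_lform_lfields:
  assumes "\<eta> \<in> lfields M A" shows "vscale (lform H) \<eta> \<in> lfields (Suc M) (insert H A)"
  using assms by (auto simp: lfields_def act_vscale lform_def intro: tdeg_lt_lin_mult)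

text \<open>Lagrange interpolation: the product of all lines yields the multiples of \<open>B\<close> that vanish on \<open>T\<close>,
  and constant fields along a line \<open>L\<close> through \<open>pt t\<close>, multiplied by the lines not parallel to \<open>L\<close>,
  take care of the value at \<open>t\<close>.\<close>

lemma sigma_image_ge:
  assumes M: "M \<ge> 2 * card A" and q: "deg_lt (M - (card A - card T)) q"
  shows "\<exists>\<theta> \<in> lfields M A. sigma \<theta> = B * q"
proof -
  have TA: "card T \<le> card A" using card_T_le by simp
  obtain w1 w2 where w: "eqx H * w1 + eqy H * w2 = 1"
  proof (cases "eqx H = 0")
    case True
    then show ?thesis using nonzero that[of 0 "1 / eqy H"] by simp
  next
    case False
    then show ?thesis using that[of "1 / eqx H" 0] by simp
  qed
  have const: "tdeg_lt 1 [:[:k:]:]" for k :: 'a by (simp add: tdeg_lt_pCons deg_lt_pCons)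
  \<comment> \<open>A line in \<open>G\<close> divides the product, and a line outside
    \<open>G\<close> is parallel to the direction \<open>(v1, v2)\<close>; so the field is tangent
    to both kinds.\<close>
  have lfields_prod: "vscale (\<Prod>K\<in>G. lform K) ([:[:v1:]:], [:[:v2:]:]) \<in> lfields (Suc (card G)) A"
    if "G \<subseteq> A" "\<And>K. K \<in> A - G \<Longrightarrow> eqx K * v1 + eqy K * v2 = 0" for G and v1 v2 :: 'a
  proof -
    have fG: "finite G" using that(1) fin finite_subset by blast
    have "tdeg_lt (Suc (card G)) ((\<Prod>K\<in>G. lform K) * [:[:k:]:])" for k :: 'a
      using tdeg_lt_mult[of "card G" "\<Prod>K\<in>G. lform K" 1 "[:[:k:]:]"] tdeg_lt_prod_lform[OF fG] const by simp
    moreover have "lform K dvd act K (vscale (\<Prod>K\<in>G. lform K) ([:[:v1:]:], [:[:v2:]:]))" if "K \<in> A" for K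
    proof (cases "K \<in> G")
      case True
      then show ?thesis unfolding act_vscale using fG by (intro dvd_mult2) (rule dvd_prodI)
    next
      case False
      then have "eqx K * v1 + eqy K * v2 = 0"
        using \<open>\<And>K. K \<in> A - G \<Longrightarrow> eqx K * v1 + eqy K * v2 = 0\<close> that by simp
      then have "act K ([:[:v1:]:], [:[:v2:]:]) = 0" by (simp add: act_def mult.commute)
      then show ?thesis by (simp add: act_vscale)
    qed
    ultimately show ?thesis by (simp add: lfields_def)
  qed
  have tdeg_lt_mono_lfields: "vscale p \<theta> \<in> lfields M A" if "\<theta> \<in> lfields (Suc d) A" "tdeg_lt n p" "n + d \<le> M" for p \<theta> d n
    using lfields_mono[OF lfields_vscale[OF that(2,1)] that(3)] .
  have full: "\<exists>\<theta> \<in> lfields M A. sigma \<theta> = B * (PT * u)" if u: "deg_lt (M - card A) u" for u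
  proof -
    define \<eta> where "\<eta> = vscale (\<Prod>K\<in>A. lform K) ([:[:w1:]:], [:[:w2:]:])"
    have \<eta>: "\<eta> \<in> lfields (Suc (card A)) A" unfolding \<eta>_def by (rule lfields_prod) auto
    have sg: "sigma \<eta> = res (\<Prod>K\<in>A. lform K)"
      using w by (simp add: \<eta>_def sigma_vscale sigma_const pCons_one)
    \<comment> \<open>On \<open>H\<close> the lines of \<open>par\<close> become constants and those
      of \<open>through t\<close> multiples of \<open>x - t\<close>; together they give
      \<open>B * PT\<close> up to a scalar.\<close>
    have "\<exists>c. c \<noteq> 0 \<and> res (\<Prod>K\<in>A. lform K) = smult c (B * PT)"
    proof -
      have two: "\<exists>c. c \<noteq> 0 \<and> res (\<Prod>K\<in>G. lform K) = smult c ([:- t, 1:] ^ card G)" if "G \<subseteq> through t" for G t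
        using finite_subset[OF that finite_through] that
      proof (induction G)
        case empty
        show ?case by (rule exI[of _ 1]) simp
      next
        case (insert K G)
        then obtain c where c: "c \<noteq> 0" "res (\<Prod>K\<in>G. lform K) = smult c ([:- t, 1:] ^ card G)" by auto
        have K: "K \<in> through t" using insert.prems by simp
        obtain d where d: "d \<noteq> 0" "res (lform K) = smult d [:- t, 1:]" using through_res_eq[OF K] by blast
        then show ?case using c d insert.hyps
          by (intro exI[of _ "c * d"])
             (simp only: prod.insert card_insert_disjoint res_mult power_Suc mult_smult_left
               mult_smult_right smult_smult mult_eq_0_iff simp_thms mult.commute[of d])
      qed
      have three: "\<exists>c. c \<noteq> 0 \<and> res (\<Prod>K\<in>(\<Union>t\<in>S. through t). lform K) = smult c (\<Prod>t\<in>S. [:- t, 1:] ^ card (through t))"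
        if "S \<subseteq> T" for S
        using finite_subset[OF that finite_T] that
      proof (induction S)
        case empty
        show ?case by (rule exI[of _ 1]) simp
      next
        case (insert t S)
        then obtain c where c: "c \<noteq> 0" "res (\<Prod>K\<in>(\<Union>t\<in>S. through t). lform K) = smult c (\<Prod>t\<in>S. [:- t, 1:] ^ card (through t))" by auto
        obtain d where d: "d \<noteq> 0" "res (\<Prod>K\<in>through t. lform K) = smult d ([:- t, 1:] ^ card (through t))"
          using two[of "through t" t] by auto
        have "through t \<inter> through s = {}" if "s \<in> S" for s
          using insert.hyps that by (intro through_disj) auto
        then have "through t \<inter> (\<Union>s\<in>S. through s) = {}" by blast
        then have "(\<Prod>K\<in>(\<Union>t\<in>insert t S. through t). lform K) = (\<Prod>K\<in>through t. lform K) * (\<Prod>K\<in>(\<Union>t\<in>S. through t). lform K)"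
          using insert.hyps by (simp add: prod.union_disjoint)
        then show ?case using c d insert.hyps
          by (intro exI[of _ "c * d"]) (simp add: res_mult mult.commute del: mult_pCons_left)
      qed
      obtain c where c: "c \<noteq> 0" "res (\<Prod>K\<in>par. lform K) = [:c:]" using res_prod_par by blast
      obtain d where d: "d \<noteq> 0" "res (\<Prod>K\<in>(\<Union>t\<in>T. through t). lform K) = smult d (\<Prod>t\<in>T. [:- t, 1:] ^ card (through t))"
        using three by blast
      have "(\<Prod>K\<in>A. lform K) = (\<Prod>K\<in>par. lform K) * (\<Prod>K\<in>(\<Union>t\<in>T. through t). lform K)"
        by (subst A_decomp, rule prod.union_disjoint) (use through_par in auto)
      moreover have "(\<Prod>t\<in>T. [:- t, 1:] ^ card (through t)) = B * PT"
        unfolding B_def PT_def prod.distrib[symmetric]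
      proof (rule prod.cong)
        fix t assume "t \<in> T"
        then obtain m where "card (through t) = Suc m" using card_through_pos[of t] by (cases "card (through t)") auto
        then show "[:- t, 1:] ^ card (through t) = [:- t, 1:] ^ (card (through t) - 1) * [:- t, 1:]"
          by (simp only: power_Suc2 diff_Suc_1)
      qed simp
      ultimately show ?thesis using c d by (intro exI[of _ "c * d"]) (simp add: res_mult mult.commute[of d])
    qed
    then obtain c where c: "c \<noteq> 0" "res (\<Prod>K\<in>A. lform K) = smult c (B * PT)" by blast
    have "vscale (lift (smult (inverse c) u)) \<eta> \<in> lfields M A"
      using \<eta> by (rule tdeg_lt_mono_lfields[OF _ tdeg_lt_lift[OF deg_lt_smult[OF u]]]) (use M in simp)
    moreover have "sigma (vscale (lift (smult (inverse c) u)) \<eta>) = B * (PT * u)"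
      using c by (simp add: sigma_vscale sg mult.commute mult.left_commute)
    ultimately show ?thesis by blast
  qed
  have point: "\<exists>\<theta> \<in> lfields M A. \<exists>e. sigma \<theta> = B * e \<and> deg_lt (M - (card A - card T)) e \<and> poly e t \<noteq> 0 \<and> (\<forall>s\<in>T - {t}. poly e s = 0)"
    if t: "t \<in> T" for t
  proof -
    obtain L where L: "L \<in> through t" using t by (auto simp: T_def through_def)
    then have LA: "L \<in> A" by (simp add: through_def)
    \<comment> \<open>The constant field points along \<open>L\<close>, so \<open>L\<close> and its
      parallels can be left out of the product; at \<open>t\<close> this saves one factor.\<close>
    define G where "G = {K \<in> A. eqx K * eqy L \<noteq> eqy K * eqx L}"
    have fG: "finite G" using fin by (simp add: G_def)
    have LG: "L \<notin> G" by (simp add: G_def)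
    have "G \<subseteq> A" by (auto simp: G_def)
    then have "card G < card A" using LA LG by (intro psubset_card_mono[OF fin]) blast
    define \<eta> where "\<eta> = vscale (\<Prod>K\<in>G. lform K) ([:[:eqy L:]:], [:[:- eqx L:]:])"
    have \<eta>: "\<eta> \<in> lfields (Suc (card G)) A"
      unfolding \<eta>_def by (rule lfields_prod) (auto simp: G_def)
    define k where "k = eqx H * eqy L - eqy H * eqx L"
    have k: "k \<noteq> 0" using through_par[OF t L] LA by (auto simp: par_def k_def mult.commute)
    have sg: "sigma \<eta> = smult k (res (\<Prod>K\<in>G. lform K))"
      by (simp add: \<eta>_def sigma_vscale sigma_const k_def)
    \<comment> \<open>Multiplied in through \<open>lift\<close>, this produces zeros at the other
      points of \<open>T\<close>.\<close>
    define v where "v = (\<Prod>s\<in>T - {t}. [:- s, 1:])"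
    have dv: "deg_lt (card T) v"
    proof -
      have "degree v = card T - 1" unfolding v_def by (subst degree_prod_eq_sum_degree) (use t in auto)
      moreover have "card T > 0" using t by (auto simp: card_gt_0_iff)
      ultimately show ?thesis unfolding deg_lt_iff_degree by simp
    qed
    define \<theta> where "\<theta> = vscale (lift v) \<eta>"
    \<comment> \<open>The degree is below \<open>card T\<close> for \<open>lift v\<close> and at
      most \<open>card G\<close> for \<open>\<eta>\<close>, which fits into
      \<open>2 * card A\<close>.\<close>
    have \<theta>: "\<theta> \<in> lfields M A" unfolding \<theta>_def
      using \<eta> by (rule tdeg_lt_mono_lfields[OF _ tdeg_lt_lift[OF dv]]) (use \<open>card G < card A\<close> M TA in simp)
    obtain e0 where e0: "sigma \<eta> = B * e0" using B_dvd_sigma[OF \<eta>] ..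
    obtain e where e: "sigma \<theta> = B * e" "deg_lt (M - (card A - card T)) e" using sigma_image_le[OF \<theta>] by blast
    have "B * e = B * (v * e0)" using e(1) e0 by (simp add: \<theta>_def sigma_vscale algebra_simps)
    then have e_eq: "e = v * e0" by simp
    have ve: "poly v s = 0" if "s \<in> T - {t}" for s using that by (auto simp: v_def poly_prod)
    have vt: "poly v t \<noteq> 0" by (auto simp: v_def poly_prod)
    \<comment> \<open>Otherwise \<open>sigma \<eta>\<close> would vanish at \<open>t\<close> to
      order \<open>card (through t)\<close>, but only lines of \<open>G\<close> through
      \<open>pt t\<close> contribute zeros there, and \<open>L\<close> is not among them.\<close>
    have "poly e0 t \<noteq> 0"
    proof
      assume "poly e0 t = 0"
      then obtain r where r: "e0 = [:- t, 1:] * r" by (auto simp: poly_eq_0_iff_dvd)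
      have Bt: "B = [:- t, 1:] ^ (card (through t) - 1) * (\<Prod>s\<in>T - {t}. [:- s, 1:] ^ (card (through s) - 1))"
        unfolding B_def using t by (simp add: prod.remove)
      have "[:- t, 1:] ^ card (through t) = [:- t, 1:] * [:- t, 1:] ^ (card (through t) - 1)"
        using card_through_pos[OF t] by (metis One_nat_def Suc_le_D diff_Suc_1 power_Suc)
      then have "smult k (res (\<Prod>K\<in>G. lform K)) = [:- t, 1:] ^ card (through t) *
          ((\<Prod>s\<in>T - {t}. [:- s, 1:] ^ (card (through s) - 1)) * r)"
        unfolding sg[symmetric] e0 r Bt by (simp only: mult_ac)
      then have "[:- t, 1:] ^ card (through t) dvd smult k (res (\<Prod>K\<in>G. lform K))" by (rule dvdI)
      then have d: "[:- t, 1:] ^ card (through t) dvd res (\<Prod>K\<in>G. lform K)"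
        by (rule dvd_smult_cancel) (rule k)
      have nz: "res (\<Prod>K\<in>G'. lform K) \<noteq> 0" if "G' \<subseteq> G" for G'
        using that finite_subset[OF that fG] res_lform_nz by (auto simp: res_prod G_def)
      have ord: "order t (res (lform K)) = (if K \<in> through t then 1 else 0)" if "K \<in> A" for K
      proof (cases "K \<in> through t")
        case True
        obtain d where "d \<noteq> 0" "res (lform K) = smult d [:- t, 1:]" using through_res_eq[OF True] by blast
        then have ds: "d \<noteq> 0" "res (lform K) = smult d ([:- t, 1:] ^ 1)" by simp_all
        then show ?thesis using True by (simp only: ds(2) order_smult[OF ds(1)] order_power_n_n if_True)
      next
        case False
        then have "poly (res (lform K)) t \<noteq> 0" using pt_in_iff[OF line_A[OF that]] that by (simp add: through_def)
        then show ?thesis using False by (simp add: order_0I)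
      qed
      have "order t (res (\<Prod>K\<in>G'. lform K)) = card (G' \<inter> through t)" if "G' \<subseteq> G" for G'
        using finite_subset[OF that fG] that
      proof (induction G')
        case (insert K G')
        have "res (lform K) * res (\<Prod>K\<in>G'. lform K) \<noteq> 0" using nz[OF insert.prems] insert.hyps by (simp add: res_mult)
        moreover have "K \<in> A" using insert.prems by (auto simp: G_def)
        moreover have "order t (res (\<Prod>K\<in>G'. lform K)) = card (G' \<inter> through t)" using insert by simp
        ultimately show ?case using insert.hyps ord[of K]
          by (simp add: res_mult order_mult Int_insert_left)
      qed simp
      then have "order t (res (\<Prod>K\<in>G. lform K)) = card (G \<inter> through t)" by simp
      also have "\<dots> < card (through t)" using L LG by (intro psubset_card_mono) auto
      finally show False using d nz[of G] order_divides[of t "card (through t)"] by auto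
    qed
    then show ?thesis using \<theta> e e_eq ve vt by (intro bexI[of _ \<theta>] exI[of _ e]) auto
  qed
  obtain \<Theta> E where E: "\<And>t. t \<in> T \<Longrightarrow> \<Theta> t \<in> lfields M A \<and> sigma (\<Theta> t) = B * E t \<and>
      deg_lt (M - (card A - card T)) (E t) \<and> poly (E t) t \<noteq> 0 \<and> (\<forall>s\<in>T - {t}. poly (E t) s = 0)"
    using point by metis
  \<comment> \<open>Interpolation coefficients: \<open>q'\<close> vanishes on \<open>T\<close>, so
    it is a multiple of \<open>PT\<close> and \<open>full\<close> applies to it.\<close>
  define a where "a t = poly q t / poly (E t) t" for t
  define q' where "q' = q - (\<Sum>t\<in>T. smult (a t) (E t))"
  have "poly q' s = 0" if s: "s \<in> T" for s
  proof -
    have "(\<Sum>t\<in>T. a t * poly (E t) s) = a s * poly (E s) s + (\<Sum>t\<in>T - {s}. a t * poly (E t) s)"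
      using s by (simp add: sum.remove)
    also have "(\<Sum>t\<in>T - {s}. a t * poly (E t) s) = 0"
      using E s by (intro sum.neutral) auto
    finally show ?thesis using E[OF s] by (simp add: q'_def poly_sum a_def)
  qed
  then have "(\<Prod>t\<in>T. [:- t, 1:] ^ 1) dvd q'"
    by (intro prod_linear_powers_dvd) (simp_all add: poly_eq_0_iff_dvd)
  then obtain u where u: "q' = PT * u" by (auto simp: PT_def elim!: dvdE)
  have "deg_lt (M - (card A - card T)) q'"
    unfolding q'_def using q E by (intro deg_lt_diff deg_lt_sum deg_lt_smult) auto
  then have "deg_lt (M - (card A - card T) - card T) u"
    unfolding u degree_PT[symmetric] by (rule deg_lt_cancel[OF PT_nz])
  then have "deg_lt (M - card A) u" using TA M by simp
  then obtain \<theta>' where \<theta>': "\<theta>' \<in> lfields M A" "sigma \<theta>' = B * q'" using full u by blast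
  have comb: "(\<Sum>t\<in>S. vscale [:[:a t:]:] (\<Theta> t)) \<in> lfields M A \<and>
      sigma (\<Sum>t\<in>S. vscale [:[:a t:]:] (\<Theta> t)) = B * (\<Sum>t\<in>S. smult (a t) (E t))" if "S \<subseteq> T" for S
    using finite_subset[OF that finite_T] that
  proof (induction S)
    case (insert t S)
    have "vscale [:[:a t:]:] (\<Theta> t) \<in> lfields M A"
      using E[of t] insert.prems by (auto simp: lfields_def act_vscale intro: tdeg_lt_smult_const dvd_smult)
    moreover have "sigma (vscale [:[:a t:]:] (\<Theta> t)) = B * smult (a t) (E t)"
      using E[of t] insert.prems by (simp add: sigma_vscale res_const)
    ultimately show ?case using insert
      by (simp add: lfields_add sigma_add algebra_simps)
  qed simp
  have "\<theta>' + (\<Sum>t\<in>T. vscale [:[:a t:]:] (\<Theta> t)) \<in> lfields M A" using \<theta>'(1) comb[of T] by (simp add: lfields_add)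
  moreover have "sigma (\<theta>' + (\<Sum>t\<in>T. vscale [:[:a t:]:] (\<Theta> t))) = B * q"
    using \<theta>'(2) comb[of T] by (simp add: sigma_add q'_def algebra_simps)
  ultimately show ?thesis by blast
qed

end

lemma ex_added_line:
  assumes "line_arrangement A" "affine_line H" "H \<notin> A"
  shows "\<exists>x0 y0 t1 t2. added_line H x0 y0 t1 t2 A"
proof -
  obtain x0 y0 t1 t2 where "line_param (eqx H) (eqy H) (eqc H) x0 y0 t1 t2"
    using ex_line_param[OF line_eq(1)[OF assms(2)]] by blast
  then have "added_line H x0 y0 t1 t2 A"
    using assms by (simp add: added_line_def added_line_axioms_def)
  then show ?thesis by blast
qed

section \<open>Counting vector fields\<close>

definition mult_at :: "('a^2) set set \<Rightarrow> 'a^2 \<Rightarrow> nat" where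
  "mult_at A p = card {H \<in> A. p \<in> H}"

definition mpts :: "('a^2) set set \<Rightarrow> ('a^2) set" where
  "mpts A = {p. \<exists>H\<in>A. \<exists>K\<in>A. H \<noteq> K \<and> p \<in> H \<and> p \<in> K}"

text \<open>The constant coefficient of the characteristic polynomial, as the Moebius function takes the value
  \<open>mult_at A p - 1\<close> at the flat \<open>{p}\<close>.\<close>

definition b2 :: "('a^2) set set \<Rightarrow> nat" where
  "b2 A = (\<Sum>p\<in>mpts A. mult_at A p - 1)"

lemma mult_at_not_mpts:
  assumes "finite A" "p \<notin> mpts A" shows "mult_at A p \<le> 1"
  unfolding mult_at_def using assms by (intro card_le_Suc0_iff_eq[THEN iffD2, folded One_nat_def]) (auto simp: mpts_def)

lemma mult_at_mpts:
  assumes "finite A" "p \<in> mpts A" shows "mult_at A p \<ge> 2"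
proof -
  obtain H K where HK: "H \<in> A" "K \<in> A" "H \<noteq> K" "p \<in> H" "p \<in> K" using assms(2) by (auto simp: mpts_def)
  then have "card {H, K} \<le> mult_at A p" unfolding mult_at_def using assms(1) by (intro card_mono) auto
  then show ?thesis using HK(3) by simp
qed

text \<open>Points outside \<open>mpts A\<close> lie on at most one line, and truncated subtraction
  turns their terms into 0. Arrangements with different \<open>mpts\<close> can thus be compared
  over a common set.\<close>

lemma b2_superset:
  assumes "finite A" "finite S" "mpts A \<subseteq> S" shows "b2 A = (\<Sum>p\<in>S. mult_at A p - 1)"
  unfolding b2_def using mult_at_not_mpts[OF assms(1)] by (intro sum.mono_neutral_left assms(2,3)) auto

context added_line begin

lemma mpts_insert_subset: "mpts (insert H A) \<subseteq> mpts A \<union> pt ` T"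
proof
  fix p assume "p \<in> mpts (insert H A)"
  then obtain H1 K1 where HK: "H1 \<in> insert H A" "K1 \<in> insert H A" "H1 \<noteq> K1" "p \<in> H1" "p \<in> K1"
    unfolding mpts_def mem_Collect_eq by (elim bexE conjE)
  have *: "p \<in> pt ` T" if "K \<in> A" "p \<in> K" "p \<in> H" for K
  proof -
    have "\<exists>t. p = pt t" using in_H_iff[of p] that(3) by (rule iffD1)
    then obtain t where t: "p = pt t" ..
    then have "t \<in> T" using that(1,2) by (auto simp: T_def)
    then show ?thesis using t by simp
  qed
  show "p \<in> mpts A \<union> pt ` T"
  proof (cases "H1 \<in> A \<and> K1 \<in> A")
    case True
    then have "p \<in> mpts A" using HK(3-5) unfolding mpts_def mem_Collect_eq by (intro bexI[of _ H1] bexI[of _ K1] conjI) auto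
    then show ?thesis by simp
  next
    case False
    then consider "H1 = H" "K1 \<in> A" | "K1 = H" "H1 \<in> A" using HK(1-3) by auto
    then show ?thesis using * HK(4,5) by cases simp_all
  qed
qed

text \<open>Every point of \<open>H\<close> on some line of \<open>A\<close> has its multiplicity
  raised by one, and no other term changes. Finiteness is supplied afterwards by
  \<open>finite_mpts\<close>.\<close>

lemma b2_insert_if_finite:
  assumes "finite (mpts A)"
  shows "b2 (insert H A) = b2 A + n_points (insert H A) H"
proof -
  define S where "S = mpts A \<union> pt ` T"
  have fS: "finite S" using assms by (simp add: S_def)
  have "mult_at (insert H A) p - 1 = (mult_at A p - 1) + (if p \<in> pt ` T then 1 else 0)" if p: "p \<in> S" for p
  proof (cases "p \<in> H")
    case True
    then have "{K \<in> insert H A. p \<in> K} = insert H {K \<in> A. p \<in> K}" by blast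
    then have m: "mult_at (insert H A) p = Suc (mult_at A p)" using fin notin by (simp add: mult_at_def)
    obtain t where t: "p = pt t" using True in_H_iff[of p] by blast
    have "p \<in> pt ` T"
    proof (cases "p \<in> mpts A")
      case True
      then have "t \<in> T" using t by (auto simp: mpts_def T_def)
      then show ?thesis using t by blast
    qed (use p in \<open>simp add: S_def\<close>)
    \<comment> \<open>A positive multiplicity is needed, since
      \<open>m + 1 - 1 = (m - 1) + 1\<close> fails for \<open>m = 0\<close>.\<close>
    moreover from this obtain K where "K \<in> A" "p \<in> K" by (auto simp: T_def)
    then have "mult_at A p > 0" using fin by (auto simp: mult_at_def card_gt_0_iff)
    ultimately show ?thesis using m by simp
  next
    case False
    then have "{K \<in> insert H A. p \<in> K} = {K \<in> A. p \<in> K}" by blast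
    moreover have "p \<notin> pt ` T" using False in_H_iff by blast
    ultimately show ?thesis by (simp add: mult_at_def)
  qed
  then have "(\<Sum>p\<in>S. mult_at (insert H A) p - 1) = (\<Sum>p\<in>S. mult_at A p - 1) + (\<Sum>p\<in>S. if p \<in> pt ` T then 1 else 0)"
    by (simp add: sum.distrib)
  also have "(\<Sum>p\<in>S. if p \<in> pt ` T then 1 else 0) = card (S \<inter> pt ` T)"
    using fS by (simp add: sum.If_cases Int_def)
  also have "S \<inter> pt ` T = pt ` T" by (auto simp: S_def)
  also have "card (pt ` T) = card T" using inj_pt by (simp add: card_image inj_on_subset)
  finally show ?thesis
    using b2_superset[of "insert H A" S] b2_superset[of A S] fin fS mpts_insert_subset
    by (simp add: n_points_eq S_def)
qed

end

lemma finite_mpts: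
  assumes "line_arrangement A" shows "finite (mpts A)"
proof -
  have "finite A" using assms by (simp add: line_arrangement_def)
  then show ?thesis using assms
  proof (induction A)
    case (insert H A)
    then have "line_arrangement A" "affine_line H" by (auto simp: line_arrangement_def)
    then obtain x0 y0 t1 t2 where "added_line H x0 y0 t1 t2 A"
      using ex_added_line insert.hyps by blast
    then interpret added_line H x0 y0 t1 t2 A .
    have "finite (mpts A \<union> pt ` T)" using insert.IH[OF arr] by simp
    then show ?case using mpts_insert_subset by (rule finite_subset[rotated])
  qed (simp add: mpts_def)
qed

lemma b2_insert:
  assumes "line_arrangement A" "affine_line H" "H \<notin> A"
  shows "b2 (insert H A) = b2 A + n_points (insert H A) H"
proof -
  obtain x0 y0 t1 t2 where "added_line H x0 y0 t1 t2 A" using ex_added_line[OF assms] by blast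
  then show ?thesis using added_line.b2_insert_if_finite finite_mpts[OF assms(1)] by blast
qed

section \<open>Dimensions of spaces of polynomials and vector fields\<close>

definition sc2 :: "'a::field \<Rightarrow> 'a poly poly \<Rightarrow> 'a poly poly" where "sc2 c p = smult [:c:] p"
text \<open>Scalars come from the ground field, as in \<open>sc2\<close>, because over it the spaces
  of bounded degree have finite dimension.\<close>

definition scv :: "'a::field \<Rightarrow> 'a poly poly \<times> 'a poly poly \<Rightarrow> 'a poly poly \<times> 'a poly poly" where
  "scv c = vscale [:[:c:]:]"

lemma vector_space_field: "vector_space ((*) :: 'a::field \<Rightarrow> 'a \<Rightarrow> 'a)"
  by unfold_locales (simp_all add: algebra_simps)
interpretation V1: vector_space "smult :: 'a::field \<Rightarrow> 'a poly \<Rightarrow> 'a poly"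
  by unfold_locales (simp_all add: smult_add_right smult_add_left)
interpretation V2: vector_space "sc2 :: 'a::field \<Rightarrow> 'a poly poly \<Rightarrow> 'a poly poly"
  by unfold_locales (simp_all add: sc2_def smult_add_right pCons_one mult.commute flip: smult_add_left)
interpretation VV: vector_space "scv :: 'a::field \<Rightarrow> 'a poly poly \<times> 'a poly poly \<Rightarrow> _"
  by unfold_locales (simp_all add: scv_def prod_eq_iff smult_add_right pCons_one mult.commute flip: smult_add_left)

lemmas vs1 = V1.vector_space_axioms
lemmas vs2 = V2.vector_space_axioms
lemmas vsv = VV.vector_space_axioms

lemma rank_nullity_eq:
  assumes "vector_space s1" "vector_space s2" "fin_dim s1 U" "Vector_Spaces.linear s1 s2 f"
  shows "vector_space.dim s1 U = vector_space.dim s1 {x \<in> U. f x = 0} + vector_space.dim s2 (f ` U)"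
  using vector_space_pair.rank_nullity[of s1 s2 U f] assms by (simp add: vector_space_pair_def)

lemma inj_image_dim:
  assumes "vector_space s1" "vector_space s2" "fin_dim s1 U" "Vector_Spaces.linear s1 s2 f"
    "\<And>x. x \<in> U \<Longrightarrow> f x = 0 \<Longrightarrow> x = 0"
  shows "fin_dim s2 (f ` U) \<and> vector_space.dim s2 (f ` U) = vector_space.dim s1 U"
proof
  interpret vector_space_pair s1 s2 using assms(1,2) by (simp add: vector_space_pair_def)
  interpret l: Vector_Spaces.linear s1 s2 f by fact
  show "fin_dim s2 (f ` U)" using fin_dim_image[OF assms(3,4)] .
  have "0 \<in> U" using assms(3) by (simp add: fin_dim_def vs1.subspace_0)
  then have "{x \<in> U. f x = 0} = {0}" using assms(5) l.zero by auto
  then show "vs2.dim (f ` U) = vs1.dim U" using rank_nullity[OF assms(3,4)] vs1.fin_dim_zero by simp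
qed

text \<open>Taking the coefficient at \<open>M\<close> maps onto the field, with the next smaller
  space as kernel.\<close>

lemma dim_deg_lt: "fin_dim smult {q :: 'a::field poly. deg_lt M q} \<and> V1.dim {q :: 'a poly. deg_lt M q} = M"
proof (induction M)
  case 0
  then show ?case using V1.fin_dim_zero by simp
next
  case (Suc M)
  have lin: "Vector_Spaces.linear smult (*) (\<lambda>q :: 'a poly. coeff q M)"
    unfolding Vector_Spaces.linear_iff using vector_space_field vs1 by simp
  have sub: "V1.subspace {q :: 'a poly. deg_lt (Suc M) q}"
    by (auto simp: V1.subspace_def deg_lt_add deg_lt_smult)
  have ker: "{q \<in> {q :: 'a poly. deg_lt (Suc M) q}. coeff q M = 0} = {q. deg_lt M q}"
    by (auto simp: deg_lt_def) (metis Suc_leI le_neq_implies_less)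
  have "coeff (monom x M) M = x" "deg_lt (Suc M) (monom x M)" for x :: 'a by (simp_all add: deg_lt_def)
  then have img: "(\<lambda>q :: 'a poly. coeff q M) ` {q. deg_lt (Suc M) q} = UNIV"
    by (metis (mono_tags, lifting) mem_Collect_eq surj_def image_eqI UNIV_eq_I)
  have one: "module.span (*) {1 :: 'a} = UNIV"
    using module.span_singleton[OF vector_space_field[folded module_iff_vector_space], of "1::'a"] by (auto simp: image_def)
  have f0: "fin_dim (*) (UNIV :: 'a set)"
    unfolding fin_dim_def using one by (auto intro!: exI[of _ "{1}"])
  have "vector_space.dim (*) (UNIV :: 'a set) = 1"
    using vector_space.dim_span_eq_card_independent[OF vector_space_field, of "{1 :: 'a}"] one
      vector_space.dependent_single[OF vector_space_field, of "1 :: 'a"] by simp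
  moreover have fd: "fin_dim smult {q :: 'a poly. deg_lt (Suc M) q}"
    by (rule fin_dim_by_map[OF vs1 vector_space_field sub lin])
       (use ker img f0 Suc in simp_all)
  ultimately show ?case
    using rank_nullity_eq[OF vs1 vector_space_field fd lin] ker img Suc by simp
qed

text \<open>The part without \<open>y\<close> is a polynomial in \<open>x\<close> of bounded degree,
  and the rest is \<open>y\<close> times a polynomial of smaller degree. The factor 2 avoids a
  division.\<close>

lemma dim_tdeg_lt:
  "fin_dim sc2 {p :: 'a::field poly poly. tdeg_lt M p} \<and> 2 * V2.dim {p :: 'a poly poly. tdeg_lt M p} = M * (M + 1)"
proof (induction M)
  case 0
  then show ?case using V2.fin_dim_zero by simp
next
  case (Suc M)
  let ?U = "{p :: 'a poly poly. tdeg_lt (Suc M) p}"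
  have lin: "Vector_Spaces.linear sc2 smult (\<lambda>p :: 'a poly poly. coeff p 0)"
    unfolding Vector_Spaces.linear_iff using vs1 vs2 by (simp add: sc2_def)
  have lin2: "Vector_Spaces.linear sc2 sc2 (\<lambda>p :: 'a poly poly. pCons 0 p)"
    unfolding Vector_Spaces.linear_iff using vs2 by (simp add: sc2_def)
  have sub: "V2.subspace ?U"
    by (auto simp: V2.subspace_def sc2_def tdeg_lt_add tdeg_lt_smult_const)
  have ker: "{p \<in> ?U. coeff p 0 = 0} = pCons 0 ` {p. tdeg_lt M p}"
  proof (intro set_eqI iffI)
    fix p :: "'a poly poly" assume "p \<in> {p \<in> ?U. coeff p 0 = 0}"
    then show "p \<in> pCons 0 ` {p. tdeg_lt M p}" by (cases p) (auto simp: tdeg_lt_pCons)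
  qed (auto simp: tdeg_lt_pCons)
  have img: "(\<lambda>p :: 'a poly poly. coeff p 0) ` ?U = {q. deg_lt (Suc M) q}"
  proof (intro set_eqI iffI)
    fix q :: "'a poly" assume "q \<in> {q. deg_lt (Suc M) q}"
    then show "q \<in> (\<lambda>p :: 'a poly poly. coeff p 0) ` ?U" by (intro image_eqI[of _ _ "[:q:]"]) (auto simp: tdeg_lt_pCons)
  next
    fix q :: "'a poly" assume "q \<in> (\<lambda>p :: 'a poly poly. coeff p 0) ` ?U"
    then show "q \<in> {q. deg_lt (Suc M) q}" by (auto simp: tdeg_lt_def deg_lt_def)
  qed
  have k: "fin_dim sc2 (pCons 0 ` {p :: 'a poly poly. tdeg_lt M p}) \<and>
      V2.dim (pCons 0 ` {p :: 'a poly poly. tdeg_lt M p}) = V2.dim {p :: 'a poly poly. tdeg_lt M p}"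
    by (rule inj_image_dim[OF vs2 vs2 _ lin2]) (use Suc in auto)
  have fd: "fin_dim sc2 ?U"
    by (rule fin_dim_by_map[OF vs2 vs1 sub lin])
       (use ker img k dim_deg_lt[where ?'a='a] in simp_all)
  show ?case
    using rank_nullity_eq[OF vs2 vs1 fd lin] ker img k fd Suc
      dim_deg_lt[where ?'a='a, of "Suc M"] by simp
qed

text \<open>Two separate bounds, since this is also the space of coefficient pairs for a basis whose
  degrees may differ.\<close>

definition Pair_tdeg_lt :: "nat \<Rightarrow> nat \<Rightarrow> ('a::field poly poly \<times> 'a poly poly) set" where
  "Pair_tdeg_lt a b = {\<theta>. tdeg_lt a (fst \<theta>) \<and> tdeg_lt b (snd \<theta>)}"

lemma dim_Pair_tdeg_lt:
  "fin_dim scv (Pair_tdeg_lt a b :: ('a::field poly poly \<times> _) set) \<and>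
   2 * VV.dim (Pair_tdeg_lt a b :: ('a::field poly poly \<times> _) set) = a * (a + 1) + b * (b + 1)"
proof -
  let ?U = "Pair_tdeg_lt a b :: ('a::field poly poly \<times> _) set"
  have lin: "Vector_Spaces.linear scv sc2 (fst :: 'a poly poly \<times> 'a poly poly \<Rightarrow> _)"
    unfolding Vector_Spaces.linear_iff using vsv vs2 by (simp add: sc2_def scv_def)
  have lin2: "Vector_Spaces.linear sc2 scv (\<lambda>p :: 'a poly poly. (0, p))"
    unfolding Vector_Spaces.linear_iff using vsv vs2 by (simp add: sc2_def scv_def vscale_def)
  have sub: "VV.subspace ?U"
    by (auto simp: VV.subspace_def scv_def tdeg_lt_add tdeg_lt_smult_const Pair_tdeg_lt_def)
  have ker: "{\<theta> \<in> ?U. fst \<theta> = 0} = (\<lambda>p. (0, p)) ` {p. tdeg_lt b p}"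
    by (auto simp: Pair_tdeg_lt_def image_iff prod_eq_iff)
  have img: "fst ` ?U = {p. tdeg_lt a p}"
    by (auto simp: Pair_tdeg_lt_def image_iff intro!: exI[of _ 0])
  have k: "fin_dim scv ((\<lambda>p. (0, p)) ` {p :: 'a poly poly. tdeg_lt b p}) \<and>
      VV.dim ((\<lambda>p. (0, p)) ` {p :: 'a poly poly. tdeg_lt b p}) = V2.dim {p :: 'a poly poly. tdeg_lt b p}"
    by (rule inj_image_dim[OF vs2 vsv _ lin2])
       (use dim_tdeg_lt in \<open>auto simp: zero_prod_def\<close>)
  have fd: "fin_dim scv ?U"
    by (rule fin_dim_by_map[OF vsv vs2 sub lin])
       (use ker img k dim_tdeg_lt[where ?'a='a] in simp_all)
  have "VV.dim ?U = V2.dim {p :: 'a poly poly. tdeg_lt b p} + V2.dim {p :: 'a poly poly. tdeg_lt a p}"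
    using rank_nullity_eq[OF vsv vs2 fd lin] ker img k by simp
  then show ?thesis using fd dim_tdeg_lt[where ?'a='a, of a] dim_tdeg_lt[where ?'a='a, of b] by simp
qed

lemma lfields_empty: "lfields M {} = Pair_tdeg_lt M M" by (simp add: lfields_def Pair_tdeg_lt_def)

lemma subspace_lfields: "VV.subspace (lfields M A)"
  by (auto simp: VV.subspace_def scv_def lfields_add) (auto simp: lfields_def act_vscale tdeg_lt_smult_const dvd_smult)

lemma fin_dim_lfields: "fin_dim scv (lfields M A)"
  using VV.fin_dim_subset[OF _ subspace_lfields] dim_Pair_tdeg_lt by (force simp: lfields_def Pair_tdeg_lt_def)

section \<open>Dimension estimates for adding a line\<close>

context added_line begin

lemma dim_mult_deg_lt:
  assumes "Q \<noteq> 0"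
  shows "fin_dim smult ((*) Q ` {q :: 'a poly. deg_lt m q}) \<and> V1.dim ((*) Q ` {q :: 'a poly. deg_lt m q}) = m"
proof -
  have "Vector_Spaces.linear smult smult ((*) Q)"
    unfolding Vector_Spaces.linear_iff using vs1 by (simp add: algebra_simps)
  then show ?thesis
    using inj_image_dim[OF vs1 vs1, of "{q :: 'a poly. deg_lt m q}" "(*) Q"]
      dim_deg_lt[where ?'a='a, of m] assms by auto
qed

lemma linear_sigma: "Vector_Spaces.linear scv smult sigma"
  unfolding Vector_Spaces.linear_iff
  using vs1 vsv by (simp add: scv_def sigma_add sigma_vscale res_const)

lemma linear_rho: "Vector_Spaces.linear scv smult rho"
  unfolding Vector_Spaces.linear_iff
  using vs1 vsv by (simp add: scv_def rho_add rho_vscale res_const)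

lemma dim_sigma_le: "VV.dim (lfields M A) \<le> VV.dim (lfields M (insert H A)) + (M - (card A - card T))"
proof -
  have "VV.dim (lfields M A) \<le> VV.dim (lfields M (insert H A)) + V1.dim ((*) B ` {q. deg_lt (M - (card A - card T)) q})"
  proof (rule rank_nullity_le[OF vsv vs1 fin_dim_lfields linear_sigma])
    show "sigma \<theta> \<in> (*) B ` {q. deg_lt (M - (card A - card T)) q}" if "\<theta> \<in> lfields M A" for \<theta>
      using sigma_image_le[OF that] by blast
  qed (simp_all add: lfields_insert_iff fin_dim_lfields dim_mult_deg_lt)
  then show ?thesis using dim_mult_deg_lt[OF B_nz] by simp
qed

text \<open>In large degree \<open>sigma\<close> maps onto all multiples of \<open>B\<close> that
  the degree permits, so the estimate of \<open>dim_sigma_le\<close> becomes an equality.\<close>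

lemma dim_sigma_eq:
  assumes "M \<ge> 2 * card A"
  shows "VV.dim (lfields M A) = VV.dim (lfields M (insert H A)) + (M - (card A - card T))"
proof -
  have "{\<theta> \<in> lfields M A. sigma \<theta> = 0} = lfields M (insert H A)" by (auto simp: lfields_insert_iff)
  moreover have "sigma ` lfields M A = (*) B ` {q. deg_lt (M - (card A - card T)) q}"
  proof (intro set_eqI iffI)
    fix x assume "x \<in> sigma ` lfields M A"
    then show "x \<in> (*) B ` {q. deg_lt (M - (card A - card T)) q}" using sigma_image_le by blast
  next
    fix x assume "x \<in> (*) B ` {q. deg_lt (M - (card A - card T)) q}"
    then obtain q where "x = B * q" "deg_lt (M - (card A - card T)) q" by blast
    then show "x \<in> sigma ` lfields M A" using sigma_image_ge[OF assms] by (metis imageI)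
  qed
  ultimately show ?thesis
    using rank_nullity_eq[OF vsv vs1 fin_dim_lfields linear_sigma, of M A]
      dim_mult_deg_lt[OF B_nz] by simp
qed

lemma dim_vscale_lform:
  "fin_dim scv (vscale (lform H) ` lfields M A) \<and> VV.dim (vscale (lform H) ` lfields M A) = VV.dim (lfields M A)"
proof (rule inj_image_dim[OF vsv vsv fin_dim_lfields])
  show "Vector_Spaces.linear scv scv (vscale (lform H))"
    unfolding Vector_Spaces.linear_iff using vsv
    by (simp add: scv_def vscale_add vscale_vscale mult.commute)
  show "x = 0" if "vscale (lform H) x = 0" for x
    using that line_eq(1)[OF line_H] by (auto simp: prod_eq_iff lform_def lin_eq_0_iff)
qed

text \<open>The kernel of \<open>rho\<close> consists of the form of \<open>H\<close> times fields
  of \<open>A\<close> of degree one less, and its values are multiples of \<open>PT\<close>.\<close>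

lemma dim_rho_le: "VV.dim (lfields M (insert H A)) \<le> VV.dim (lfields (M - 1) A) + (M - card T)"
proof -
  have "VV.dim (lfields M (insert H A)) \<le> VV.dim (vscale (lform H) ` lfields (M - 1) A) + V1.dim ((*) PT ` {q. deg_lt (M - card T) q})"
  proof (rule rank_nullity_le[OF vsv vs1 fin_dim_lfields linear_rho])
    show "rho \<theta> \<in> (*) PT ` {q. deg_lt (M - card T) q}" if "\<theta> \<in> lfields M (insert H A)" for \<theta>
      using rho_image_le[OF that] by blast
    show "\<theta> \<in> vscale (lform H) ` lfields (M - 1) A" if "\<theta> \<in> lfields M (insert H A)" "rho \<theta> = 0" for \<theta>
      using rho_kernel[OF that] by blast
  qed (simp_all only: dim_mult_deg_lt[OF PT_nz] dim_vscale_lform)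
  then show ?thesis using dim_mult_deg_lt[OF PT_nz] dim_vscale_lform by simp
qed

text \<open>Applied by contradiction, to find fields on which \<open>rho\<close> does not
  vanish.\<close>

lemma dim_rho_zero:
  assumes "\<And>\<theta>. \<theta> \<in> lfields M (insert H A) \<Longrightarrow> rho \<theta> = 0"
  shows "VV.dim (lfields M (insert H A)) \<le> VV.dim (lfields (M - 1) A)"
proof -
  have "lfields M (insert H A) \<subseteq> vscale (lform H) ` lfields (M - 1) A" using assms rho_kernel by blast
  then show ?thesis
    using VV.dim_mono_fin[OF _ subspace_lfields] dim_vscale_lform by metis
qed

lemma dim_sigma_zero:
  assumes "\<And>\<theta>. \<theta> \<in> lfields M A \<Longrightarrow> sigma \<theta> = 0"
  shows "VV.dim (lfields M A) = VV.dim (lfields M (insert H A))"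
proof -
  have "lfields M A = lfields M (insert H A)" using assms lfields_insert_iff by blast
  then show ?thesis by simp
qed

end

text \<open>Lines are added one by one. Each lowers the dimension by \<open>M - card A\<close> plus
  its number of points, and these numbers of points sum up to \<open>b2\<close>.\<close>

lemma dim_lfields:
  assumes "line_arrangement A" "M \<ge> 2 * card A"
  shows "2 * int (VV.dim (lfields M A)) = 2 * int M * (int M + 1) - 2 * int (card A) * int M
           + int (card A) * (int (card A) - 1) - 2 * int (b2 A)"
proof -
  have "finite A" using assms by (simp add: line_arrangement_def)
  then show ?thesis using assms
  proof (induction A)
    case empty
    have "2 * VV.dim (Pair_tdeg_lt M M :: ('a poly poly \<times> _) set) = M * (M + 1) + M * (M + 1)"
      using dim_Pair_tdeg_lt by blast
    then have "int (2 * VV.dim (Pair_tdeg_lt M M :: ('a poly poly \<times> _) set)) = int (M * (M + 1) + M * (M + 1))"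
      by simp
    then show ?case by (simp add: lfields_empty b2_def mpts_def algebra_simps)
  next
    case (insert H A)
    then have la: "line_arrangement A" "affine_line H" by (auto simp: line_arrangement_def)
    then obtain x0 y0 t1 t2 where "added_line H x0 y0 t1 t2 A"
      using ex_added_line insert.hyps by blast
    then interpret added_line H x0 y0 t1 t2 A .
    have M: "M \<ge> 2 * card A" using insert by simp
    have c: "card T \<le> card A" using card_T_le by simp
    have "int (VV.dim (lfields M A)) = int (VV.dim (lfields M (insert H A))) + (int M - int (card A) + int (card T))"
      using dim_sigma_eq[OF M] c M by (simp add: of_nat_diff)
    then show ?case
      using insert.IH[OF la(1) M] b2_insert[OF la insert.hyps(2)] insert.hyps n_points_eq
      by (simp add: algebra_simps)
  qed
qed

section \<open>Filtered bases\<close>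

text \<open>\<open>v\<close> and \<open>w\<close> of degrees \<open>d\<close> and \<open>e\<close> form a basis in which coefficients obey the expected degree
  bounds; this is what a homogeneous basis of the cone becomes for \<open>z = 1\<close>.\<close>

definition filt_basis :: "('a::field^2) set set \<Rightarrow> nat \<Rightarrow> nat \<Rightarrow>
    'a poly poly \<times> 'a poly poly \<Rightarrow> 'a poly poly \<times> 'a poly poly \<Rightarrow> bool" where
  "filt_basis A d e v w \<longleftrightarrow> v \<in> lfields (Suc d) A \<and> w \<in> lfields (Suc e) A \<and>
     (\<forall>M. \<forall>\<theta>\<in>lfields M A. \<exists>p q. tdeg_lt (M - d) p \<and> tdeg_lt (M - e) q \<and> \<theta> = vscale p v + vscale q w) \<and>
     (\<forall>p q. vscale p v + vscale q w = 0 \<longrightarrow> p = 0 \<and> q = 0)"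

lemma filt_basis_swap: "filt_basis A d e v w \<Longrightarrow> filt_basis A e d w v"
  unfolding filt_basis_def by (metis add.commute)

text \<open>The right-hand side is twice the dimension of the coefficient pairs for a basis with
  degrees \<open>a\<close> and \<open>b\<close>; the hypothesis bounds the growth of
  \<open>g\<close> by its increment.\<close>

lemma growth_bound:
  fixes g :: "nat \<Rightarrow> nat"
  assumes "g 0 = 0" "\<And>M. g (Suc M) \<le> g M + (Suc M - a) + (Suc M - b)"
  shows "2 * g M \<le> (M - a) * (M - a + 1) + (M - b) * (M - b + 1)"
proof (induction M)
  case (Suc M)
  have *: "(Suc M - c) * (Suc M - c + 1) = (M - c) * (M - c + 1) + 2 * (Suc M - c)" for c
    by (cases "c \<le> M") (simp_all add: Suc_diff_le)
  show ?case using Suc assms(2)[of M] unfolding * by linarith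
qed (simp add: assms)

text \<open>A deficit at one step is never made up. So equality for a single large \<open>M\<close>
  excludes deficits everywhere below.\<close>

lemma growth_bound_strict:
  fixes g :: "nat \<Rightarrow> nat"
  assumes "g 0 = 0" "\<And>M. g (Suc M) \<le> g M + (Suc M - a) + (Suc M - b)"
    "g (Suc N) < g N + (Suc N - a) + (Suc N - b)" "M > N"
  shows "2 * g M < (M - a) * (M - a + 1) + (M - b) * (M - b + 1)"
  using assms(4)
proof (induction M)
  case (Suc M)
  have *: "(Suc M - c) * (Suc M - c + 1) = (M - c) * (M - c + 1) + 2 * (Suc M - c)" for c
    by (cases "c \<le> M") (simp_all add: Suc_diff_le)
  show ?case
  proof (cases "M = N")
    case True
    then show ?thesis using growth_bound[of g a b N] assms(1-3) unfolding * by fastforce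
  next
    case False
    then show ?thesis using Suc assms(2)[of M] unfolding * by fastforce
  qed
qed simp

lemma dim_lfields_roots:
  assumes "line_arrangement A" "card A = a + b" "b2 A = a * b" "M \<ge> 2 * card A"
  shows "2 * VV.dim (lfields M A) = (M - a) * (M - a + 1) + (M - b) * (M - b + 1)"
proof -
  have i: "int (M - a) = int M - int a" "int (M - b) = int M - int b" using assms(2,4) by auto
  have "int (2 * VV.dim (lfields M A)) = int ((M - a) * (M - a + 1) + (M - b) * (M - b + 1))"
    using dim_lfields[OF assms(1,4)]
    unfolding of_nat_add of_nat_mult i assms(2,3) by (simp add: algebra_simps)
  then show ?thesis by linarith
qed

context added_line begin

lemma arr_insert: "line_arrangement (insert H A)"
  using arr line_H by (simp add: line_arrangement_def)

text \<open>The hypothesis says that \<open>card T\<close> and its complement to the number of lines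
  have the roots' product. The growth bounds then leave no slack in any degree, which yields fields
  with \<open>rho\<close> and \<open>sigma\<close> of the least possible degrees.\<close>

lemma filt_basis_if_root:
  assumes b: "b2 (insert H A) = card T * (Suc (card A) - card T)"
  shows "\<exists>v w. filt_basis (insert H A) (card T) (Suc (card A) - card T) v w"
proof -
  define N where "N = card T"
  define e where "e = Suc (card A) - N"
  define g where "g M = VV.dim (lfields M (insert H A))" for M
  have NA: "N \<le> card A" using card_T_le by (simp add: N_def)
  have c: "card (insert H A) = N + e" using fin notin NA by (simp add: e_def)
  \<comment> \<open>\<open>card A - card T\<close> equals \<open>e - 1\<close>, and this shift by
    one turns the bound for \<open>sigma\<close> into one in terms of
    \<open>Suc M - e\<close>.\<close>
  have se: "M - (card A - card T) = Suc M - e" for M using NA by (simp add: e_def N_def)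
  have g0: "g 0 = 0" using VV.fin_dim_zero by (simp add: g_def lfields_zero_eq)
  have r: "g (Suc M) \<le> VV.dim (lfields M A) + (Suc M - N)" for M
    using dim_rho_le[of "Suc M"] by (simp add: g_def N_def)
  have s: "VV.dim (lfields M A) \<le> g M + (Suc M - e)" for M
    using dim_sigma_le[of M] by (simp add: g_def se)
  have step: "g (Suc M) \<le> g M + (Suc M - N) + (Suc M - e)" for M using r[of M] s[of M] by linarith
  \<comment> \<open>By \<open>growth_bound_strict\<close> a deficit would persist up to a degree in
    which the dimension is known exactly.\<close>
  have no_strict: "\<not> g (Suc m) < g m + (Suc m - N) + (Suc m - e)" for m
  proof
    assume st: "g (Suc m) < g m + (Suc m - N) + (Suc m - e)"
    let ?M = "Suc m + 2 * card (insert H A)"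
    have "2 * g ?M < (?M - N) * (?M - N + 1) + (?M - e) * (?M - e + 1)"
      by (rule growth_bound_strict[of g N e m, OF g0 step st]) simp
    moreover have "2 * g ?M = (?M - N) * (?M - N + 1) + (?M - e) * (?M - e + 1)"
      unfolding g_def by (rule dim_lfields_roots[OF arr_insert c]) (use b in \<open>simp_all add: N_def e_def\<close>)
    ultimately show False by simp
  qed
  \<comment> \<open>In this degree \<open>rho\<close> takes only constant multiples of
    \<open>PT\<close> as values. If it were always 0, the step from \<open>N\<close> to
    \<open>Suc N\<close> would lose the summand \<open>Suc N - N = 1\<close>.\<close>
  obtain v where v: "v \<in> lfields (Suc N) (insert H A)" "rho v \<noteq> 0"
  proof -
    have "\<exists>v \<in> lfields (Suc N) (insert H A). rho v \<noteq> 0"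
    proof (rule ccontr)
      assume "\<not> ?thesis"
      then have "g (Suc N) \<le> VV.dim (lfields N A)" using dim_rho_zero[of "Suc N"] by (auto simp: g_def)
      then show False using s[of N] no_strict[of N] by simp
    qed
    then show ?thesis using that by blast
  qed
  \<comment> \<open>Likewise for \<open>sigma\<close> on fields of \<open>A\<close> of degree below
    \<open>e\<close>, where its values are constant multiples of \<open>B\<close>.\<close>
  obtain w where w: "w \<in> lfields e A" "sigma w \<noteq> 0"
  proof -
    have "\<exists>w \<in> lfields e A. sigma w \<noteq> 0"
    proof (rule ccontr)
      assume "\<not> ?thesis"
      then have "VV.dim (lfields e A) = g e" using dim_sigma_zero[of e] by (auto simp: g_def)
      then show False using r[of e] no_strict[of e] by simp
    qed
    then show ?thesis using that by blast
  qed
  have dl1: "\<exists>k. q = [:k:]" if "deg_lt 1 q" for q :: "'a poly"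
    using that by (cases q) (auto simp: deg_lt_pCons)
  obtain u where u: "rho v = PT * u" "deg_lt 1 u" using rho_image_le[OF v(1)] by (auto simp: N_def)
  then obtain k where k: "rho v = smult k PT" "k \<noteq> 0" using dl1[OF u(2)] v(2) by auto
  obtain s' where s': "sigma w = B * s'" "deg_lt 1 s'" using sigma_image_le[OF w(1)] by (auto simp: se Suc_diff_le)
  then obtain l where l: "sigma w = smult l B" "l \<noteq> 0" using dl1[OF s'(2)] w(2) by auto
  \<comment> \<open>Multiplication by the form of \<open>H\<close> makes \<open>w\<close> tangent to
    \<open>H\<close> and raises the degree bound by one.\<close>
  define W where "W = vscale (lform H) w"
  have W: "W \<in> lfields (Suc e) (insert H A)" unfolding W_def by (rule vscale_lform_lfields[OF w(1)])
  have e_pos: "e = Suc (e - 1)" using NA by (simp add: e_def)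
  \<comment> \<open>Descent on the degree: a multiple of \<open>v\<close> removes
    \<open>rho\<close>, the rest is divided by the form of \<open>H\<close>, and a multiple of
    \<open>w\<close> then removes \<open>sigma\<close>. What remains is tangent to \<open>H\<close>
    again and has smaller degree.\<close>
  have gen: "\<exists>p q. tdeg_lt (M - N) p \<and> tdeg_lt (M - e) q \<and> \<theta> = vscale p v + vscale q W"
    if "\<theta> \<in> lfields M (insert H A)" for M \<theta>
    using that
  proof (induction M arbitrary: \<theta>)
    case 0
    then have "\<theta> = vscale 0 v + vscale 0 W" by (simp add: lfields_zero_eq)
    then show ?case by (metis tdeg_lt_0)
  next
    case (Suc M)
    obtain a where a: "rho \<theta> = PT * a" "deg_lt (Suc M - N) a" using rho_image_le[OF Suc.prems] by (auto simp: N_def)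
    define p1 where "p1 = lift (smult (inverse k) a)"
    have p1: "tdeg_lt (Suc M - N) p1" unfolding p1_def by (intro tdeg_lt_lift deg_lt_smult a(2))
    have p1v: "vscale p1 v \<in> lfields (Suc M) (insert H A)"
    proof (cases "N \<le> Suc M")
      case True
      then show ?thesis using lfields_vscale[OF p1 v(1)] by simp
    next
      case False
      then show ?thesis using p1 by simp
    qed
    have "rho (\<theta> - vscale p1 v) = 0" using a(1) k by (simp add: rho_diff rho_vscale p1_def)
    then obtain \<eta> where \<eta>: "\<eta> \<in> lfields M A" "\<theta> - vscale p1 v = vscale (lform H) \<eta>"
      using rho_kernel[OF lfields_diff[OF Suc.prems p1v]] by auto
    obtain a' where a': "sigma \<eta> = B * a'" "deg_lt (Suc M - e) a'" using sigma_image_le[OF \<eta>(1)] by (auto simp: se)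
    define q1 where "q1 = lift (smult (inverse l) a')"
    have q1: "tdeg_lt (Suc M - e) q1" unfolding q1_def by (intro tdeg_lt_lift deg_lt_smult a'(2))
    have q1w: "vscale q1 w \<in> lfields M A"
    proof (cases "e \<le> Suc M")
      case True
      have "vscale q1 w \<in> lfields (Suc M - e + (e - 1)) A" by (rule lfields_vscale[OF q1]) (use w(1) e_pos in simp)
      then show ?thesis using True e_pos by simp
    next
      case False
      then show ?thesis using q1 by simp
    qed
    have "sigma (\<eta> - vscale q1 w) = 0" using a'(1) l by (simp add: sigma_diff sigma_vscale q1_def)
    then have "\<eta> - vscale q1 w \<in> lfields M (insert H A)" using lfields_diff[OF \<eta>(1) q1w] by (simp add: lfields_insert_iff)
    then obtain p q where pq: "tdeg_lt (M - N) p" "tdeg_lt (M - e) q" "\<eta> - vscale q1 w = vscale p v + vscale q W"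
      using Suc.IH by blast
    have "\<theta> = vscale p1 v + vscale (lform H) (vscale q1 w + (vscale p v + vscale q W))"
      using \<eta>(2) pq(3) by (simp add: algebra_simps)
    then have eq: "\<theta> = vscale (p1 + lform H * p) v + vscale (q1 + lform H * q) W"
      by (simp add: W_def vscale_add vscale_vscale vscale_add_left mult.commute algebra_simps)
    have up: "tdeg_lt (Suc M - d) (lform H * p')" if "tdeg_lt (M - d) p'" for d p'
    proof (cases "d \<le> M")
      case True
      then show ?thesis using tdeg_lt_lin_mult[OF that] by (simp add: lform_def Suc_diff_le)
    next
      case False
      then show ?thesis using that by simp
    qed
    show ?case
      by (rule exI[of _ "p1 + lform H * p"], rule exI[of _ "q1 + lform H * q"])
         (use eq p1 q1 up pq(1,2) in \<open>simp add: tdeg_lt_add\<close>)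
  qed
  have ind: "p = 0 \<and> q = 0" if pq: "vscale p v + vscale q W = 0" for p q
  proof -
    \<comment> \<open>The determinant of \<open>v\<close> and \<open>w\<close>. On \<open>H\<close>
      it equals \<open>rho v * sigma w\<close>, so it is not zero, and Cramer's rule
      applies.\<close>
    define D where "D = fst v * snd w - snd v * fst w"
    have "sigma v = 0" using v(1) by (simp add: lfields_insert_iff)
    then have "res D = smult (eqy H) (rho v) * res (snd w) - smult (- eqx H) (rho v) * res (fst w)"
      by (simp only: D_def res_diff res_mult res_of_rho)
    also have "\<dots> = rho v * sigma w" by (simp add: sigma_eq algebra_simps)
    finally have "res D \<noteq> 0" using v(2) w(2) by simp
    then have "D \<noteq> 0" by auto
    moreover have "lform H \<noteq> 0" using nonzero by (auto simp: lform_def lin_eq_0_iff)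
    ultimately have DH: "lform H * D \<noteq> 0" by simp
    have e1: "p * fst v = - (q * (lform H * fst w))" and e2: "p * snd v = - (q * (lform H * snd w))"
      using pq by (auto simp: prod_eq_iff W_def eq_neg_iff_add_eq_0)
    have "p * (lform H * D) = (p * fst v) * (lform H * snd w) - (p * snd v) * (lform H * fst w)"
      by (simp add: D_def algebra_simps)
    also have "\<dots> = 0" unfolding e1 e2 by (simp add: algebra_simps)
    finally have "p = 0" using DH by simp
    have z: "q * (lform H * fst w) = 0" "q * (lform H * snd w) = 0" using e1 e2 \<open>p = 0\<close> by simp_all
    have "q * (lform H * D) = fst v * (q * (lform H * snd w)) - snd v * (q * (lform H * fst w))"
      by (simp add: D_def algebra_simps)
    also have "\<dots> = 0" unfolding z by simp
    finally show ?thesis using DH \<open>p = 0\<close> by simp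
  qed
  have "filt_basis (insert H A) N e v W"
    unfolding filt_basis_def using v(1) W gen ind by blast
  then show ?thesis unfolding N_def e_def by blast
qed

end

text \<open>A filtered basis determines the dimension in every degree. Comparison with
  \<open>dim_lfields\<close> for all large \<open>M\<close> yields sum and product of the
  degrees.\<close>

lemma filt_basis_roots:
  assumes arr: "line_arrangement A" and fb: "filt_basis A d e v w"
  shows "d + e = card A" "d * e = b2 A"
proof -
  have v: "v \<in> lfields (Suc d) A" and w: "w \<in> lfields (Suc e) A"
    and gen: "\<And>M \<theta>. \<theta> \<in> lfields M A \<Longrightarrow> \<exists>p q. tdeg_lt (M - d) p \<and> tdeg_lt (M - e) q \<and> \<theta> = vscale p v + vscale q w"
    and ind: "\<And>p q. vscale p v + vscale q w = 0 \<Longrightarrow> p = 0 \<and> q = 0"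
    using fb unfolding filt_basis_def by blast+
  let ?f = "\<lambda>pq. vscale (fst pq) v + vscale (snd pq) w"
  have lin: "Vector_Spaces.linear scv scv ?f"
    unfolding Vector_Spaces.linear_iff using vsv
    by (simp add: scv_def vscale_add vscale_add_left vscale_vscale algebra_simps flip: smult_conv_map_poly)
  have dim: "2 * VV.dim (lfields M A) = (M - d) * (M - d + 1) + (M - e) * (M - e + 1)" for M
  proof -
    have mem: "vscale p u \<in> lfields M A" if "tdeg_lt (M - k) p" "u \<in> lfields (Suc k) A" for p u k
    proof (cases "k \<le> M")
      case True
      then show ?thesis using lfields_vscale[OF that] by simp
    next
      case False
      then show ?thesis using that by simp
    qed
    have "?f ` Pair_tdeg_lt (M - d) (M - e) = lfields M A"
    proof (intro set_eqI iffI)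
      fix \<theta> assume "\<theta> \<in> ?f ` Pair_tdeg_lt (M - d) (M - e)"
      then obtain p q where "tdeg_lt (M - d) p" "tdeg_lt (M - e) q" "\<theta> = vscale p v + vscale q w"
        by (auto simp: Pair_tdeg_lt_def)
      then show "\<theta> \<in> lfields M A" using mem[OF _ v] mem[OF _ w] lfields_add by blast
    next
      fix \<theta> assume "\<theta> \<in> lfields M A"
      then obtain p q where "tdeg_lt (M - d) p" "tdeg_lt (M - e) q" "\<theta> = vscale p v + vscale q w" using gen by blast
      then show "\<theta> \<in> ?f ` Pair_tdeg_lt (M - d) (M - e)"
        by (intro image_eqI[of _ _ "(p, q)"]) (simp_all add: Pair_tdeg_lt_def)
    qed
    moreover have "VV.dim (?f ` Pair_tdeg_lt (M - d) (M - e)) = VV.dim (Pair_tdeg_lt (M - d) (M - e) :: ('a poly poly \<times> _) set)"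
    proof (rule conjunct2[OF inj_image_dim[OF vsv vsv _ lin]])
      show "fin_dim scv (Pair_tdeg_lt (M - d) (M - e) :: ('a poly poly \<times> _) set)" using dim_Pair_tdeg_lt by blast
      show "x = 0" if "?f x = 0" for x using ind[OF that] by (simp add: prod_eq_iff)
    qed
    ultimately show ?thesis using dim_Pair_tdeg_lt[where ?'a='a, of "M - d" "M - e"] by simp
  qed
  define M0 where "M0 = 2 * card A + d + e"
  define c where "c = int (card A)"
  define b where "b = int (b2 A)"
  \<comment> \<open>The right-hand side does not depend on \<open>M\<close>, so the factor of
    \<open>M\<close> on the left is 0, and then so is the right-hand side.\<close>
  have eq: "2 * (int d + int e - c) * int M = int d * int d + int e * int e - (int d + int e) - c * (c - 1) + 2 * b"
    if "M \<ge> M0" for M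
  proof -
    have i: "int (M - d) = int M - int d" "int (M - e) = int M - int e" using that by (auto simp: M0_def)
    have "int (2 * VV.dim (lfields M A)) = int ((M - d) * (M - d + 1) + (M - e) * (M - e + 1))" by (simp only: dim)
    then have "2 * int (VV.dim (lfields M A)) = (int M - int d) * (int M - int d + 1) + (int M - int e) * (int M - int e + 1)"
      by (simp only: of_nat_add of_nat_mult i of_nat_numeral of_nat_1)
    moreover have "M \<ge> 2 * card A" using that by (simp add: M0_def)
    ultimately show ?thesis using dim_lfields[OF arr, of M] by (simp add: c_def b_def algebra_simps)
  qed
  have "2 * (int d + int e - c) * int M0 = 2 * (int d + int e - c) * int (Suc M0)"
    using eq[of M0] eq[of "Suc M0"] by simp
  then have s: "int d + int e = c" by (simp add: algebra_simps)
  then show "d + e = card A" by (simp add: c_def)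
  have "int d * int d + int e * int e - (int d + int e) - c * (c - 1) + 2 * b = 0" using eq[of M0] s by simp
  then have "2 * (int d * int e) = 2 * b" unfolding s[symmetric] by (simp add: algebra_simps)
  then have "int (d * e) = int (b2 A)" by (simp add: b_def)
  then show "d * e = b2 A" by (simp only: of_nat_eq_iff)
qed

context added_line begin

text \<open>If \<open>d < card T\<close>, the degree forces \<open>rho v = 0\<close>, and
  \<open>v\<close> is divisible by the form of \<open>H\<close>. The cases \<open>card T < e\<close>
  and \<open>card T > e\<close> are then refuted separately.\<close>

lemma card_T_filt_basis:
  assumes fb: "filt_basis (insert H A) d e v w" and de: "d \<le> e"
  shows "card T \<le> d \<or> card T = e"
proof (rule ccontr)
  assume neg: "\<not> ?thesis"
  have v: "v \<in> lfields (Suc d) (insert H A)" and w: "w \<in> lfields (Suc e) (insert H A)"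
    and gen: "\<And>M \<theta>. \<theta> \<in> lfields M (insert H A) \<Longrightarrow> \<exists>p q. tdeg_lt (M - d) p \<and> tdeg_lt (M - e) q \<and> \<theta> = vscale p v + vscale q w"
    and ind: "\<And>p q. vscale p v + vscale q w = 0 \<Longrightarrow> p = 0 \<and> q = 0"
    using fb unfolding filt_basis_def by blast+
  have c: "Suc (card A) = d + e" using filt_basis_roots(1)[OF arr_insert fb] fin notin by simp
  have rv: "rho v = 0" using rho_image_le[OF v] neg by auto
  then obtain \<eta> where \<eta>: "\<eta> \<in> lfields d A" "v = vscale (lform H) \<eta>" using rho_kernel[OF v] by auto
  have "card T \<ge> e"
  proof (rule ccontr)
    assume "\<not> ?thesis"
    \<comment> \<open>\<open>card A - card T\<close> is at least \<open>d\<close> here, because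
      \<open>card A = d + e - 1\<close>.\<close>
    then have "d - (card A - card T) = 0" using c by simp
    then have "sigma \<eta> = 0" using sigma_image_le[OF \<eta>(1)] by auto
    then have "\<eta> \<in> lfields d (insert H A)" using \<eta>(1) by (simp add: lfields_insert_iff)
    then obtain p q where "tdeg_lt (d - d) p" "tdeg_lt (d - e) q" "\<eta> = vscale p v + vscale q w" using gen by blast
    \<comment> \<open>Both coefficients obey the strict degree bound 0.\<close>
    then have "\<eta> = 0" using de by simp
    then have "vscale 1 v + vscale 0 w = 0" by (simp add: \<eta>(2))
    then show False using ind by fastforce
  qed
  then have "card T > e" using neg by simp
  then have rw: "rho w = 0" using rho_image_le[OF w] by auto
  have all: "rho \<theta> = 0" if \<theta>: "\<theta> \<in> lfields M (insert H A)" for M \<theta>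
  proof -
    obtain p q where "\<theta> = vscale p v + vscale q w" using gen[OF \<theta>] by blast
    then show ?thesis by (simp add: rho_add rho_vscale rv rw)
  qed
  \<comment> \<open>The product of the lines of \<open>A\<close> times the direction of
    \<open>H\<close> is tangent to all lines, and its \<open>rho\<close> is not zero.\<close>
  define Q where "Q = (\<Prod>K\<in>A. lform K)"
  define \<theta> where "\<theta> = vscale Q ([:[:eqy H:]:], [:[:- eqx H:]:])"
  obtain K1 K2 where "tdeg_lt K1 (fst \<theta>)" "tdeg_lt K2 (snd \<theta>)" using ex_tdeg_lt by meson
  then have "tdeg_lt (K1 + K2) (fst \<theta>)" "tdeg_lt (K1 + K2) (snd \<theta>)" by (auto intro: tdeg_lt_mono)
  moreover have "lform K dvd act K \<theta>" if "K \<in> insert H A" for K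
  proof (cases "K = H")
    case True
    then show ?thesis unfolding \<theta>_def act_vscale by (simp add: act_def mult.commute)
  next
    case False
    then have "lform K dvd Q" unfolding Q_def using fin that by (intro dvd_prodI) auto
    then show ?thesis unfolding \<theta>_def act_vscale by simp
  qed
  ultimately have "\<theta> \<in> lfields (K1 + K2) (insert H A)" by (simp add: lfields_def)
  then have "rho \<theta> = 0" by (rule all)
  moreover have "rho \<theta> = smult (t1 * eqy H - t2 * eqx H) (res Q)"
    unfolding \<theta>_def rho_vscale by (simp add: rho_def res_const)
  ultimately have "res Q = 0" using dual by simp
  then show False using res_lform_nz fin by (auto simp: Q_def res_prod)
qed

end

section \<open>Dehomogenization\<close>

text \<open>Setting \<open>z = 1\<close>.\<close>

abbreviation dehom :: "'a::field poly3 \<Rightarrow> 'a poly poly" where "dehom P \<equiv> poly P 1"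

abbreviation coeff3 :: "'a::field poly3 \<Rightarrow> nat \<Rightarrow> nat \<Rightarrow> nat \<Rightarrow> 'a" where
  "coeff3 P k j i \<equiv> coeff (coeff (coeff P k) j) i"

lemma homogeneous3D: "homogeneous3 d P \<Longrightarrow> i + j + k \<noteq> d \<Longrightarrow> coeff3 P k j i = 0"
  unfolding homogeneous3_def by blast

lemma homogeneous3_0 [simp]: "homogeneous3 d 0" by (simp add: homogeneous3_def)

lemma homogeneous3_add: "homogeneous3 d P \<Longrightarrow> homogeneous3 d Q \<Longrightarrow> homogeneous3 d (P + Q)"
  unfolding homogeneous3_def by (metis add_0 coeff_add)

lemma homogeneous3_diff: "homogeneous3 d P \<Longrightarrow> homogeneous3 d Q \<Longrightarrow> homogeneous3 d (P - Q)"
  unfolding homogeneous3_def by (metis diff_self coeff_diff)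

lemma homogeneous3_mult:
  assumes "homogeneous3 d P" "homogeneous3 e Q" shows "homogeneous3 (d + e) (P * Q)"
proof -
  have "coeff3 (P * Q) k j i = 0" if ne: "i + j + k \<noteq> d + e" for i j k
  proof -
    have "coeff3 P k' j' i' * coeff3 Q (k - k') (j - j') (i - i') = 0"
      if "k' \<le> k" "j' \<le> j" "i' \<le> i" for k' j' i'
    proof (cases "i' + j' + k' = d")
      case True
      then have "(i - i') + (j - j') + (k - k') \<noteq> e" using that ne by linarith
      then show ?thesis using homogeneous3D[OF assms(2)] by simp
    next
      case False
      then show ?thesis using homogeneous3D[OF assms(1)] by simp
    qed
    then have "coeff (coeff (coeff P k') j' * coeff (coeff Q (k - k')) (j - j')) i = 0"
      if "k' \<le> k" "j' \<le> j" for k' j'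
      using that unfolding coeff_mult[of "coeff (coeff P k') j'"] by (intro sum.neutral) simp
    then have "coeff (coeff (coeff P k' * coeff Q (k - k')) j) i = 0" if "k' \<le> k" for k'
      using that unfolding coeff_mult[of "coeff P k'"] coeff_sum by (intro sum.neutral) simp
    then show ?thesis unfolding coeff_mult[of P] coeff_sum by (intro sum.neutral) simp
  qed
  then show ?thesis unfolding homogeneous3_def by blast
qed

lemma homogeneous3_const3: "homogeneous3 0 (const3 c)"
  by (simp add: homogeneous3_def const3_def coeff_pCons split: nat.splits)
lemma homogeneous3_X3: "homogeneous3 1 X3"
  by (simp add: homogeneous3_def X3_def coeff_pCons split: nat.splits)
lemma homogeneous3_Y3: "homogeneous3 1 Y3"
  by (simp add: homogeneous3_def Y3_def coeff_pCons split: nat.splits)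
lemma homogeneous3_Z3: "homogeneous3 1 Z3"
  by (auto simp: homogeneous3_def Z3_def coeff_pCons split: nat.splits)

lemma homogeneous3_Z3_power: "homogeneous3 n (Z3 ^ n :: 'a::field poly3)"
proof (induction n)
  case 0
  have "(Z3 :: 'a poly3) ^ 0 = const3 1" by (simp add: const3_def pCons_one)
  then show ?case by (simp only: homogeneous3_const3)
next
  case (Suc n)
  then show ?case using homogeneous3_mult[OF homogeneous3_Z3 Suc] by simp
qed

lemma homogeneous3_const3_mult: "homogeneous3 d P \<Longrightarrow> homogeneous3 d (const3 c * P)"
  using homogeneous3_mult[OF homogeneous3_const3] by fastforce

lemma homogeneous3_cone_form: "homogeneous3 1 (cone_form a b c)"
  unfolding cone_form_def
  by (intro homogeneous3_add homogeneous3_const3_mult homogeneous3_X3 homogeneous3_Y3 homogeneous3_Z3)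

lemma dehom_const3 [simp]: "dehom (const3 c) = [:[:c:]:]" by (simp add: const3_def)
lemma dehom_X3 [simp]: "dehom X3 = [:[:0, 1:]:]" by (simp add: X3_def)
lemma dehom_Y3 [simp]: "dehom Y3 = [:0, 1:]" by (simp add: Y3_def)
lemma dehom_Z3 [simp]: "dehom Z3 = 1" by (simp add: Z3_def)
lemma dehom_cone_form: "dehom (cone_form a b c) = lin a b c"
  by (simp add: cone_form_def lin_def)

text \<open>In a homogeneous polynomial the exponent of \<open>z\<close> is determined by those of
  \<open>x\<close> and \<open>y\<close>, so setting \<open>z = 1\<close> merges no terms.\<close>

lemma coeff_dehom_homogeneous:
  assumes "homogeneous3 N P"
  shows "coeff (coeff (dehom P) j) i = (if i + j \<le> N then coeff3 P (N - i - j) j i else 0)"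
proof -
  have "coeff (coeff (dehom P) j) i = (\<Sum>k\<le>degree P. coeff3 P k j i)"
    by (simp add: poly_altdef coeff_sum)
  also have "\<dots> = (\<Sum>k\<le>degree P. if k = N - i - j \<and> i + j \<le> N then coeff3 P k j i else 0)"
    using homogeneous3D[OF assms] by (intro sum.cong refl) auto
  also have "\<dots> = (if i + j \<le> N then coeff3 P (N - i - j) j i else 0)"
    by (auto simp: coeff_eq_0)
  finally show ?thesis .
qed

lemma tdeg_lt_dehom: "homogeneous3 N P \<Longrightarrow> tdeg_lt (Suc N) (dehom P)"
  unfolding tdeg_lt_def by (simp add: coeff_dehom_homogeneous)

lemma dehom_eq_0:
  assumes "homogeneous3 N P" "dehom P = 0" shows "P = 0"
proof -
  have "coeff3 P k j i = 0" for i j k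
  proof (cases "i + j + k = N")
    case True
    then have "N - i - j = k" "i + j \<le> N" by auto
    then show ?thesis using coeff_dehom_homogeneous[OF assms(1), of j i] assms(2) by simp
  next
    case False
    then show ?thesis using homogeneous3D[OF assms(1)] by simp
  qed
  then show ?thesis by (simp add: poly_eq_iff)
qed

lemma dehom_inj:
  assumes "homogeneous3 N P" "homogeneous3 N Q" "dehom P = dehom Q" shows "P = Q"
  using dehom_eq_0[OF homogeneous3_diff[OF assms(1,2)]] assms(3) by simp

text \<open>Built along the Horner scheme; the power of \<open>Z3\<close> brings the constant term
  to degree \<open>N\<close>.\<close>

lemma homogenize1:
  assumes "deg_lt (Suc N) q" shows "\<exists>P. homogeneous3 N P \<and> dehom P = [:q:]"
  using assms
proof (induction q arbitrary: N)
  case 0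
  show ?case by (rule exI[of _ 0]) simp
next
  case (pCons a q)
  show ?case
  proof (cases N)
    case 0
    then have "q = 0" using pCons.prems by (simp add: deg_lt_pCons)
    then show ?thesis using 0 by (intro exI[of _ "const3 a"]) (simp add: homogeneous3_const3)
  next
    case (Suc N')
    then obtain P where P: "homogeneous3 N' P" "dehom P = [:q:]"
      using pCons by (auto simp: deg_lt_pCons)
    have "homogeneous3 N (const3 a * Z3 ^ N + X3 * P)"
      using homogeneous3_mult[OF homogeneous3_X3 P(1)] Suc
      by (intro homogeneous3_add homogeneous3_const3_mult homogeneous3_Z3_power) simp
    then show ?thesis using P(2) by (intro exI[of _ "const3 a * Z3 ^ N + X3 * P"]) simp
  qed
qed

lemma homogenize:
  assumes "tdeg_lt (Suc N) p" shows "\<exists>P. homogeneous3 N P \<and> dehom P = p"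
  using assms
proof (induction p arbitrary: N)
  case 0
  show ?case by (rule exI[of _ 0]) simp
next
  case (pCons q p)
  obtain Q where Q: "homogeneous3 N Q" "dehom Q = [:q:]"
    using homogenize1 pCons.prems by (auto simp: tdeg_lt_pCons)
  show ?case
  proof (cases N)
    case 0
    then have "p = 0" using pCons.prems by (simp add: tdeg_lt_pCons)
    then show ?thesis using Q by (intro exI[of _ Q]) simp
  next
    case (Suc N')
    then obtain P where P: "homogeneous3 N' P" "dehom P = p"
      using pCons by (auto simp: tdeg_lt_pCons)
    have "homogeneous3 N (Q + Y3 * P)"
      using homogeneous3_mult[OF homogeneous3_Y3 P(1)] Suc Q(1) by (intro homogeneous3_add) simp_all
    then show ?thesis using P(2) Q(2) by (intro exI[of _ "Q + Y3 * P"]) simp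
  qed
qed

section \<open>Homogeneous components\<close>

definition hcomp :: "nat \<Rightarrow> 'a::field poly3 \<Rightarrow> 'a poly3" where
  "hcomp n P = (\<Sum>k\<le>n. monom (\<Sum>j\<le>n - k. monom (monom (coeff3 P k j (n - k - j)) (n - k - j)) j) k)"

lemma coeff3_hcomp: "coeff3 (hcomp n P) k j i = (if i + j + k = n then coeff3 P k j i else 0)"
proof -
  have mon: "coeff (\<Sum>k\<le>n. monom (f k) k) k' = (if k' \<le> n then f k' else 0)" for f :: "nat \<Rightarrow> 'b::comm_monoid_add" and k' n
    by (simp add: coeff_sum)
  have "coeff (hcomp n P) k = (if k \<le> n then (\<Sum>j\<le>n - k. monom (monom (coeff3 P k j (n - k - j)) (n - k - j)) j) else 0)"
    unfolding hcomp_def by (rule mon)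
  then have "coeff (coeff (hcomp n P) k) j = (if k \<le> n \<and> j \<le> n - k then monom (coeff3 P k j (n - k - j)) (n - k - j) else 0)"
    by (simp add: mon)
  then show ?thesis by auto
qed

lemma homogeneous3_hcomp: "homogeneous3 n (hcomp n P)"
  unfolding homogeneous3_def by (simp add: coeff3_hcomp)

lemma poly3_eqI: "(\<And>i j k. coeff3 P k j i = coeff3 Q k j i) \<Longrightarrow> P = Q"
  by (simp add: poly_eq_iff)

lemma hcomp_add: "hcomp n (P + Q) = hcomp n P + hcomp n Q"
  by (rule poly3_eqI) (simp add: coeff3_hcomp)

lemma hcomp_0 [simp]: "hcomp n 0 = 0"
  by (rule poly3_eqI) (simp add: coeff3_hcomp)

lemma hcomp_sum: "hcomp n (\<Sum>x\<in>I. f x) = (\<Sum>x\<in>I. hcomp n (f x))"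
  by (induction I rule: infinite_finite_induct) (simp_all add: hcomp_add)

lemma hcomp_homogeneous: "homogeneous3 d P \<Longrightarrow> hcomp n P = (if n = d then P else 0)"
  by (rule poly3_eqI) (auto simp: coeff3_hcomp homogeneous3D)

lemma ex_degree_bound: "\<exists>K. \<forall>i j k. coeff3 P k j i \<noteq> 0 \<longrightarrow> i + j + k < K"
proof (induction P)
  case 0
  show ?case by simp
next
  case (pCons p P)
  then obtain K where K: "\<And>i j k. coeff3 P k j i \<noteq> 0 \<Longrightarrow> i + j + k < K" by blast
  obtain L where L: "tdeg_lt L p" using ex_tdeg_lt by blast
  have "i + j + k < Suc (K + L)" if "coeff3 (pCons p P) k j i \<noteq> 0" for i j k
  proof (cases k)
    case 0
    then have "i + j < L" using that L unfolding tdeg_lt_def by (metis coeff_pCons_0 not_less)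
    then show ?thesis using 0 by simp
  next
    case (Suc k')
    then show ?thesis using that K[of k' j i] by simp
  qed
  then show ?case by blast
qed

text \<open>The lower bound \<open>L\<close> serves to enlarge the range, as when a given degree
  must lie in it or when two polynomials share it.\<close>

lemma sum_hcomp: "\<exists>K\<ge>L. P = (\<Sum>n<K. hcomp n P)"
proof -
  obtain K0 where K0: "\<And>i j k. coeff3 P k j i \<noteq> 0 \<Longrightarrow> i + j + k < K0" using ex_degree_bound by metis
  define K where "K = K0 + L"
  have "P = (\<Sum>n<K. hcomp n P)"
  proof (rule poly3_eqI)
    fix i j k
    have "coeff3 (\<Sum>n<K. hcomp n P) k j i = (\<Sum>n<K. if n = i + j + k then coeff3 P k j i else 0)"
      unfolding coeff_sum by (intro sum.cong) (auto simp: coeff3_hcomp)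
    also have "\<dots> = coeff3 P k j i" using K0[of k j i] by (cases "coeff3 P k j i = 0") (auto simp: K_def)
    finally show "coeff3 P k j i = coeff3 (\<Sum>n<K. hcomp n P) k j i" ..
  qed
  then show ?thesis by (intro exI[of _ K]) (simp add: K_def)
qed

text \<open>After splitting \<open>P\<close> into components only the one of degree
  \<open>n - d\<close> contributes; for \<open>d > n\<close> there is none.\<close>

lemma hcomp_mult:
  assumes "homogeneous3 d C"
  shows "hcomp n (C * P) = C * (if d \<le> n then hcomp (n - d) P else 0)"
proof -
  obtain K where K: "K \<ge> Suc n" "P = (\<Sum>m<K. hcomp m P)" using sum_hcomp by blast
  have "C * P = (\<Sum>m<K. C * hcomp m P)" by (subst K(2)) (simp add: sum_distrib_left)
  then have "hcomp n (C * P) = (\<Sum>m<K. hcomp n (C * hcomp m P))" by (simp add: hcomp_sum)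
  also have "\<dots> = (\<Sum>m<K. if n = d + m then C * hcomp m P else 0)"
    using hcomp_homogeneous[OF homogeneous3_mult[OF assms homogeneous3_hcomp]] by (intro sum.cong) auto
  also have "\<dots> = (\<Sum>m<K. if m = n - d \<and> d \<le> n then C * hcomp m P else 0)"
    by (intro sum.cong) auto
  also have "\<dots> = C * (if d \<le> n then hcomp (n - d) P else 0)" using K(1) by auto
  finally show ?thesis .
qed

section \<open>Derivations of the polynomial ring in three variables\<close>

lemma derivation3D:
  assumes "derivation3 \<theta>"
  shows "\<theta> (p + q) = \<theta> p + \<theta> q" "\<theta> (const3 c * p) = const3 c * \<theta> p" "\<theta> (p * q) = p * \<theta> q + q * \<theta> p"
  using assms unfolding derivation3_def by blast+

lemma derivation3_const3:
  assumes "derivation3 \<theta>" shows "\<theta> (const3 c) = 0"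
proof -
  have "\<theta> 1 + 0 = \<theta> 1 + \<theta> 1" using derivation3D(3)[OF assms, of 1 1] by (simp only: mult_1 add_0_right)
  then have "\<theta> 1 = 0" by (simp only: add_left_cancel)
  then show ?thesis using derivation3D(2)[OF assms, of c 1] by simp
qed

lemma derivation3_cone_form:
  assumes "derivation3 \<theta>"
  shows "\<theta> (cone_form a b c) = const3 a * \<theta> X3 + const3 b * \<theta> Y3 + const3 c * \<theta> Z3"
  by (simp add: cone_form_def derivation3D(1,2)[OF assms])

text \<open>Three nested inductions, one for each layer of \<open>K[x][y][z]\<close>: constants are
  killed, and the product rule reduces each further layer to the value on its variable.\<close>

lemma derivation3_ext:
  assumes d: "derivation3 \<theta>" "derivation3 \<eta>"
    and eq: "\<theta> X3 = \<eta> X3" "\<theta> Y3 = \<eta> Y3" "\<theta> Z3 = \<eta> Z3"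
  shows "\<theta> = \<eta>"
proof
  fix P
  have z: "\<theta> 0 = 0" "\<eta> 0 = 0" using derivation3_const3[OF d(1), of 0] derivation3_const3[OF d(2), of 0]
    by (simp_all add: const3_def)
  have 1: "\<theta> [:[:q:]:] = \<eta> [:[:q:]:]" for q
  proof (induction q)
    case (pCons a q)
    have "[:[:pCons a q:]:] = const3 a + X3 * [:[:q:]:]" by (simp add: const3_def X3_def)
    then show ?case using pCons eq
      by (simp only: derivation3D(1,3)[OF d(1)] derivation3D(1,3)[OF d(2)]
          derivation3_const3[OF d(1)] derivation3_const3[OF d(2)])
  qed (simp add: z)
  have 2: "\<theta> [:p:] = \<eta> [:p:]" for p
  proof (induction p)
    case (pCons q p)
    have "[:pCons q p:] = [:[:q:]:] + Y3 * [:p:]" by (simp add: Y3_def)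
    then show ?case using pCons eq 1
      by (simp only: derivation3D(1,3)[OF d(1)] derivation3D(1,3)[OF d(2)])
  qed (simp add: z)
  show "\<theta> P = \<eta> P"
  proof (induction P)
    case (pCons p P)
    have "pCons p P = [:p:] + Z3 * P" by (simp add: Z3_def)
    then show ?case using pCons eq 2
      by (simp only: derivation3D(1,3)[OF d(1)] derivation3D(1,3)[OF d(2)])
  qed (simp add: z)
qed

text \<open>A derivation of the coefficients extends coefficientwise. Applied once and twice, this
  gives the partial derivatives by the inner variables.\<close>

lemma map_poly_derivation:
  fixes \<delta> :: "'b::comm_ring_1 \<Rightarrow> 'b"
  assumes add: "\<And>p q. \<delta> (p + q) = \<delta> p + \<delta> q" and mult: "\<And>p q. \<delta> (p * q) = p * \<delta> q + q * \<delta> p"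
  shows "map_poly \<delta> (p + q) = map_poly \<delta> p + map_poly \<delta> q"
    "map_poly \<delta> (p * q) = p * map_poly \<delta> q + q * map_poly \<delta> p"
proof -
  have z: "\<delta> 0 = 0" using add[of 0 0] by simp
  show a: "map_poly \<delta> (p + q) = map_poly \<delta> p + map_poly \<delta> q" for p q
    by (rule poly_eqI) (simp add: coeff_map_poly z add)
  have s: "map_poly \<delta> (smult a q) = smult a (map_poly \<delta> q) + smult (\<delta> a) q" for a q
    by (rule poly_eqI) (simp add: coeff_map_poly z mult mult.commute)
  show "map_poly \<delta> (p * q) = p * map_poly \<delta> q + q * map_poly \<delta> p"
    by (induction p) (simp_all add: a s map_poly_pCons z algebra_simps)
qed

definition dx3 :: "'a::field poly3 \<Rightarrow> 'a poly3" where "dx3 = map_poly (map_poly pderiv)"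
definition dy3 :: "'a::field poly3 \<Rightarrow> 'a poly3" where "dy3 = map_poly pderiv"

lemma dx3_derivation: "dx3 (p + q) = dx3 p + dx3 q" "dx3 (p * q) = p * dx3 q + q * dx3 p"
  unfolding dx3_def
  by (rule map_poly_derivation; rule map_poly_derivation; simp add: pderiv_add pderiv_mult)+

lemma dy3_derivation: "dy3 (p + q) = dy3 p + dy3 q" "dy3 (p * q) = p * dy3 q + q * dy3 p"
  unfolding dy3_def by (rule map_poly_derivation; simp add: pderiv_add pderiv_mult)+

lemma partials [simp]:
  "dx3 (const3 c) = 0" "dx3 X3 = 1" "dx3 Y3 = 0" "dx3 Z3 = 0"
  "dy3 (const3 c) = 0" "dy3 X3 = 0" "dy3 Y3 = 1" "dy3 Z3 = 0"
  "pderiv (const3 c) = 0" "pderiv X3 = 0" "pderiv Y3 = 0" "pderiv Z3 = 1"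
  by (simp_all add: dx3_def dy3_def const3_def X3_def Y3_def Z3_def map_poly_pCons pderiv_pCons map_poly_1
      flip: one_pCons)

definition der3 :: "'a::field poly3 \<Rightarrow> 'a poly3 \<Rightarrow> 'a poly3 \<Rightarrow> 'a poly3 \<Rightarrow> 'a poly3" where
  "der3 u w s p = u * dx3 p + w * dy3 p + s * pderiv p"

lemma derivation3_der3: "derivation3 (der3 u w s)"
  unfolding derivation3_def der3_def dx3_derivation dy3_derivation pderiv_add pderiv_mult
  by (simp add: algebra_simps)

lemma der3_gens [simp]: "der3 u w s X3 = u" "der3 u w s Y3 = w" "der3 u w s Z3 = s"
  by (simp_all add: der3_def)

lemma euler_der_eq: "euler_der = der3 X3 Y3 Z3"
  by (rule ext) (simp add: euler_der_def der3_def dx3_def dy3_def)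

lemma derivation3_euler: "derivation3 euler_der"
  and euler_gens [simp]: "euler_der X3 = X3" "euler_der Y3 = Y3" "euler_der Z3 = Z3"
  by (simp_all add: euler_der_eq derivation3_der3)

lemma derivation3_comb:
  assumes "derivation3 \<theta>" "derivation3 \<eta>" "derivation3 \<zeta>"
  shows "derivation3 (\<lambda>p. f * \<theta> p + g * \<eta> p + h * \<zeta> p)"
proof -
  have "f * \<theta> (const3 c * p) + g * \<eta> (const3 c * p) + h * \<zeta> (const3 c * p) =
      const3 c * (f * \<theta> p + g * \<eta> p + h * \<zeta> p)" for c p
    unfolding assms[THEN derivation3D(2)] by (simp add: algebra_simps)
  moreover have "f * \<theta> (p * q) + g * \<eta> (p * q) + h * \<zeta> (p * q) =
      p * (f * \<theta> q + g * \<eta> q + h * \<zeta> q) + q * (f * \<theta> p + g * \<eta> p + h * \<zeta> p)" for p q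
    unfolding assms[THEN derivation3D(3)] by (simp add: algebra_simps)
  moreover have "f * \<theta> (p + q) + g * \<eta> (p + q) + h * \<zeta> (p + q) =
      (f * \<theta> p + g * \<eta> p + h * \<zeta> p) + (f * \<theta> q + g * \<eta> q + h * \<zeta> q)" for p q
    unfolding assms[THEN derivation3D(1)] by (simp add: algebra_simps)
  ultimately show ?thesis unfolding derivation3_def by blast
qed

section \<open>Derivations of the cone and vector fields on the plane\<close>

lemma const3_mult: "const3 a * const3 b = const3 (a * b)" by (simp add: const3_def)
text \<open>The second equation is evaluated at two points of the line, \<open>(x0, y0)\<close> and
  its translate by \<open>(b, - a)\<close>; this works over every field.\<close>

lemma line_of_eqD:
  assumes "(a, b) \<noteq> (0, 0)" "(a', b') \<noteq> (0, 0)" "line_of a b c = line_of a' b' c'"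
  shows "\<exists>l. l \<noteq> 0 \<and> a' = l * a \<and> b' = l * b \<and> c' = l * c"
proof -
  obtain x0 y0 t1 t2 where "line_param a b c x0 y0 t1 t2" using ex_line_param[OF assms(1)] by blast
  then interpret line_param a b c x0 y0 t1 t2 .
  have "vector [x0, y0] \<in> line_of a b c" using base by (simp add: line_of_def)
  then have p: "a' * x0 + b' * y0 + c' = 0" unfolding assms(3) by (simp add: line_of_def)
  have "a * (x0 + b) + b * (y0 - a) + c = a * x0 + b * y0 + c" by (simp add: algebra_simps)
  then have "vector [x0 + b, y0 - a] \<in> line_of a b c" using base by (simp add: line_of_def)
  then have q: "a' * (x0 + b) + b' * (y0 - a) + c' = 0" unfolding assms(3) by (simp add: line_of_def)
  have "a' * b - b' * a = (a' * (x0 + b) + b' * (y0 - a) + c') - (a' * x0 + b' * y0 + c')"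
    by (simp add: algebra_simps)
  then have "a' * b = b' * a" using p q by simp
  then show ?thesis using proportional[OF p] assms(2) by auto
qed

abbreviation cone :: "('a::field^2) set \<Rightarrow> 'a poly3" where
  "cone H \<equiv> cone_form (eqx H) (eqy H) (eqc H)"

text \<open>Any equation of a line is a scalar multiple of the chosen one, and scalars pass through
  \<open>\<theta>\<close>.\<close>

lemma cone_derivations_iff:
  assumes "line_arrangement A"
  shows "\<theta> \<in> cone_derivations A \<longleftrightarrow> derivation3 \<theta> \<and> (\<forall>H\<in>A. cone H dvd \<theta> (cone H)) \<and> Z3 dvd \<theta> Z3"
proof
  assume L: "\<theta> \<in> cone_derivations A"
  have "cone H dvd \<theta> (cone H)" if "H \<in> A" for H
  proof -
    have "affine_line H" using that assms by (simp add: line_arrangement_def)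
    then show ?thesis using L that line_eq[of H] unfolding cone_derivations_def by blast
  qed
  then show "derivation3 \<theta> \<and> (\<forall>H\<in>A. cone H dvd \<theta> (cone H)) \<and> Z3 dvd \<theta> Z3"
    using L by (simp add: cone_derivations_def)
next
  assume R: "derivation3 \<theta> \<and> (\<forall>H\<in>A. cone H dvd \<theta> (cone H)) \<and> Z3 dvd \<theta> Z3"
  have "cone_form a b c dvd \<theta> (cone_form a b c)"
    if H: "H \<in> A" and n: "(a, b) \<noteq> (0, 0)" and e: "H = line_of a b c" for H a b c
  proof -
    have "affine_line H" using H assms by (simp add: line_arrangement_def)
    then have "(eqx H, eqy H) \<noteq> (0, 0)" "line_of (eqx H) (eqy H) (eqc H) = line_of a b c"
      using line_eq[of H] e by simp_all
    then obtain l where l: "l \<noteq> 0" "a = l * eqx H" "b = l * eqy H" "c = l * eqc H"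
      using line_of_eqD[OF _ n] by blast
    have c: "cone_form a b c = const3 l * cone H"
      by (simp add: cone_form_def l const3_mult[symmetric] algebra_simps)
    have "cone H dvd \<theta> (cone H)" using R H by blast
    then show ?thesis unfolding c using R by (simp add: derivation3D(2) mult_dvd_mono)
  qed
  then show "\<theta> \<in> cone_derivations A" using R by (auto simp: cone_derivations_def)
qed

text \<open>The quotient for \<open>z = 1\<close> has degree below \<open>N\<close>, so it
  homogenizes to degree \<open>N - 1\<close>; \<open>dehom\<close> is injective on forms of degree
  \<open>N\<close>, which gives the factorization. For \<open>N = 0\<close> the bound leaves only
  \<open>R = 0\<close>.\<close>

lemma cone_dvd_homogeneous:
  assumes "homogeneous3 N R" "lin a b c dvd dehom R" "(a, b) \<noteq> (0, 0)"
  shows "cone_form a b c dvd R"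
proof -
  obtain s where s: "dehom R = lin a b c * s" using assms(2) ..
  have "tdeg_lt (Suc N) (lin a b c * s)" using tdeg_lt_dehom[OF assms(1)] s by simp
  then have ts: "tdeg_lt N s" using tdeg_lt_lin_cancel[OF assms(3)] by fastforce
  show ?thesis
  proof (cases N)
    case 0
    then show ?thesis using ts s dehom_eq_0[OF assms(1)] by simp
  next
    case (Suc N')
    then obtain S where S: "homogeneous3 N' S" "dehom S = s" using homogenize ts by blast
    have "R = cone_form a b c * S"
      using assms(1) homogeneous3_mult[OF homogeneous3_cone_form S(1)] Suc
      by (intro dehom_inj[of N]) (simp_all add: s S(2) dehom_cone_form)
    then show ?thesis by simp
  qed
qed

lemma der3_in_cone_derivations:
  assumes "line_arrangement A" "homogeneous3 N U" "homogeneous3 N W" "(dehom U, dehom W) \<in> lfields M A"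
  shows "der3 U W 0 \<in> cone_derivations A"
  unfolding cone_derivations_iff[OF assms(1)]
proof (intro conjI ballI)
  fix H assume H: "H \<in> A"
  have h: "homogeneous3 N (const3 (eqx H) * U + const3 (eqy H) * W)"
    by (intro homogeneous3_add homogeneous3_const3_mult assms(2,3))
  have "lform H dvd act H (dehom U, dehom W)" using assms(4) H by (simp add: lfields_def)
  then have "lin (eqx H) (eqy H) (eqc H) dvd dehom (const3 (eqx H) * U + const3 (eqy H) * W)"
    by (simp add: act_def lform_def)
  moreover have "(eqx H, eqy H) \<noteq> (0, 0)" using line_eq assms(1) H by (auto simp: line_arrangement_def)
  ultimately show "cone H dvd der3 U W 0 (cone H)"
    using cone_dvd_homogeneous[OF h] by (simp add: derivation3_cone_form[OF derivation3_der3])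
qed (simp_all add: derivation3_der3)

text \<open>Subtracting \<open>f\<close> times the Euler derivation removes the
  \<open>z\<close>-component, and it changes the value on \<open>cone H\<close> by a multiple of
  \<open>cone H\<close>, as the Euler derivation fixes forms of degree one.\<close>

lemma cone_derivation_reduce:
  assumes "line_arrangement A" "\<theta> \<in> cone_derivations A" "\<theta> Z3 = Z3 * f" "H \<in> A"
  shows "cone H dvd const3 (eqx H) * (\<theta> X3 - f * X3) + const3 (eqy H) * (\<theta> Y3 - f * Y3)"
proof -
  have \<theta>: "derivation3 \<theta>" "cone H dvd \<theta> (cone H)"
    using assms(2,4) unfolding cone_derivations_iff[OF assms(1)] by blast+
  have "const3 (eqx H) * (\<theta> X3 - f * X3) + const3 (eqy H) * (\<theta> Y3 - f * Y3) = \<theta> (cone H) - f * cone H"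
    unfolding derivation3_cone_form[OF \<theta>(1)] assms(3) by (simp add: cone_form_def algebra_simps)
  then show ?thesis using \<theta>(2) by simp
qed

lemma cone_reduce_lfields:
  assumes "homogeneous3 n U" "homogeneous3 n W"
    "\<And>H. H \<in> A \<Longrightarrow> cone H dvd const3 (eqx H) * U + const3 (eqy H) * W"
  shows "(dehom U, dehom W) \<in> lfields (Suc n) A"
proof -
  have "lform H dvd act H (dehom U, dehom W)" if HA: "H \<in> A" for H
  proof -
    obtain S where "const3 (eqx H) * U + const3 (eqy H) * W = cone H * S"
      using assms(3)[OF HA] by (elim dvdE)
    then have "dehom (const3 (eqx H) * U + const3 (eqy H) * W) = dehom (cone H) * dehom S" by simp
    then show ?thesis by (simp add: act_def lform_def dehom_cone_form)
  qed
  then show ?thesis using tdeg_lt_dehom[OF assms(1)] tdeg_lt_dehom[OF assms(2)] by (simp add: lfields_def)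
qed

text \<open>Expresses without a subtraction that \<open>f\<close> has degree \<open>d - 1\<close>;
  used for the components of \<open>f\<close> times the Euler derivation.\<close>

lemma homogeneous3_shift:
  assumes "homogeneous3 d (Z3 * f)" shows "homogeneous3 d (f * X3)" "homogeneous3 d (f * Y3)"
proof -
  have f: "i + j + Suc k = d" if "coeff3 f k j i \<noteq> 0" for i j k
  proof -
    have "coeff3 (Z3 * f) (Suc k) j i = coeff3 f k j i" by (simp add: Z3_def)
    then show ?thesis using assms that unfolding homogeneous3_def by metis
  qed
  have "coeff3 (f * X3) k j i = (if i = 0 then 0 else coeff3 f k j (i - 1))" for i j k
    by (simp add: X3_def coeff_pCons split: nat.splits)
  then show "homogeneous3 d (f * X3)" unfolding homogeneous3_def
    using f by (auto split: if_splits) fastforce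
  have "coeff3 (f * Y3) k j i = (if j = 0 then 0 else coeff3 f k (j - 1) i)" for i j k
    by (simp add: Y3_def coeff_pCons split: nat.splits)
  then show "homogeneous3 d (f * Y3)" unfolding homogeneous3_def
    using f by (auto split: if_splits) fastforce
qed

lemma ex1_eq: "\<exists>!x. P x \<Longrightarrow> P a \<Longrightarrow> P b \<Longrightarrow> a = b"
  by blast

text \<open>The Euler derivation is split off from both basis elements, and \<open>z = 1\<close> is
  set.\<close>

lemma filt_basis_if_free:
  fixes A :: "('a::field^2) set set"
  assumes arr: "line_arrangement A" and free: "free_with_exponents A d e"
  shows "\<exists>v w. filt_basis A d e v w"
proof -
  obtain \<theta>\<^sub>1 \<theta>\<^sub>2 where h: "homogeneous_der d \<theta>\<^sub>1" "homogeneous_der e \<theta>\<^sub>2"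
    and basis: "is_basis3 (cone_derivations A) euler_der \<theta>\<^sub>1 \<theta>\<^sub>2"
    using free unfolding free_with_exponents_def by blast
  have mem: "\<theta>\<^sub>1 \<in> cone_derivations A" "\<theta>\<^sub>2 \<in> cone_derivations A"
    and uniq: "\<And>\<theta>. \<theta> \<in> cone_derivations A \<Longrightarrow>
      \<exists>!(f, g, h). \<theta> = (\<lambda>p. f * euler_der p + g * \<theta>\<^sub>1 p + h * \<theta>\<^sub>2 p)"
    using basis unfolding is_basis3_def by blast+
  have reduce: "\<exists>f U W. \<theta> Z3 = Z3 * f \<and> U = \<theta> X3 - f * X3 \<and> W = \<theta> Y3 - f * Y3 \<and>
      homogeneous3 k U \<and> homogeneous3 k W \<and> (dehom U, dehom W) \<in> lfields (Suc k) A"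
    if \<theta>: "\<theta> \<in> cone_derivations A" and k: "homogeneous_der k \<theta>" for \<theta> k
  proof -
    obtain f where f: "\<theta> Z3 = Z3 * f"
      using \<theta> unfolding cone_derivations_iff[OF arr] by (auto elim: dvdE)
    have hom: "homogeneous3 k (\<theta> X3 - f * X3)" "homogeneous3 k (\<theta> Y3 - f * Y3)"
      using k homogeneous3_shift[of k f] f unfolding homogeneous_der_def
      by (auto intro: homogeneous3_diff)
    then show ?thesis
      using f cone_reduce_lfields[OF hom cone_derivation_reduce[OF arr \<theta> f]] by blast
  qed
  obtain f1 U1 W1 where 1: "\<theta>\<^sub>1 Z3 = Z3 * f1" "U1 = \<theta>\<^sub>1 X3 - f1 * X3" "W1 = \<theta>\<^sub>1 Y3 - f1 * Y3"
    "homogeneous3 d U1" "homogeneous3 d W1" "(dehom U1, dehom W1) \<in> lfields (Suc d) A"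
    using reduce[OF mem(1) h(1)] by blast
  obtain f2 U2 W2 where 2: "\<theta>\<^sub>2 Z3 = Z3 * f2" "U2 = \<theta>\<^sub>2 X3 - f2 * X3" "W2 = \<theta>\<^sub>2 Y3 - f2 * Y3"
    "homogeneous3 e U2" "homogeneous3 e W2" "(dehom U2, dehom W2) \<in> lfields (Suc e) A"
    using reduce[OF mem(2) h(2)] by blast
  define v where "v = (dehom U1, dehom W1)"
  define w where "w = (dehom U2, dehom W2)"
  have der: "derivation3 \<theta>\<^sub>1" "derivation3 \<theta>\<^sub>2" using mem unfolding cone_derivations_iff[OF arr] by blast+
  have gen: "\<exists>p q. tdeg_lt (M - d) p \<and> tdeg_lt (M - e) q \<and> \<theta> = vscale p v + vscale q w" if \<theta>: "\<theta> \<in> lfields M A" for M \<theta>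
  proof (cases M)
    case 0
    then have "\<theta> = vscale 0 v + vscale 0 w" using \<theta> by (simp add: lfields_zero_eq)
    then show ?thesis by (metis tdeg_lt_0)
  next
    case (Suc N)
    obtain U where U: "homogeneous3 N U" "dehom U = fst \<theta>" using homogenize[of N "fst \<theta>"] \<theta> Suc by (auto simp: lfields_def)
    obtain W where W: "homogeneous3 N W" "dehom W = snd \<theta>" using homogenize[of N "snd \<theta>"] \<theta> Suc by (auto simp: lfields_def)
    have "der3 U W 0 \<in> cone_derivations A"
      using der3_in_cone_derivations[OF arr U(1) W(1)] U(2) W(2) \<theta> by simp
    from uniq[OF this] obtain f g h where eq: "der3 U W 0 = (\<lambda>p. f * euler_der p + g * \<theta>\<^sub>1 p + h * \<theta>\<^sub>2 p)"
      by (auto elim: ex1E)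
    \<comment> \<open>The \<open>z\<close>-component of the equation determines \<open>f\<close>;
      inserted into the others, it leaves only the reduced fields.\<close>
    have "Z3 * (f + g * f1 + h * f2) = 0"
      using fun_cong[OF eq, of Z3] 1(1) 2(1) by (simp add: algebra_simps)
    moreover have "Z3 \<noteq> (0 :: 'a poly3)" by (simp add: Z3_def)
    ultimately have "f + g * f1 + h * f2 = 0" by (simp only: mult_eq_0_iff) simp
    then have f: "f = - (g * f1) - h * f2" by (simp add: algebra_simps eq_neg_iff_add_eq_0)
    have Ueq: "U = U1 * g + U2 * h"
      using fun_cong[OF eq, of X3] by (simp add: 1(2) 2(2) f algebra_simps)
    have Weq: "W = W1 * g + W2 * h"
      using fun_cong[OF eq, of Y3] by (simp add: 1(3) 2(3) f algebra_simps)
    \<comment> \<open>\<open>U\<close> and \<open>W\<close> are homogeneous of degree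
      \<open>N\<close>, so only these components of \<open>g\<close> and \<open>h\<close>
      contribute. They carry the degree bounds.\<close>
    define g' where "g' = (if d \<le> N then hcomp (N - d) g else 0)"
    define h' where "h' = (if e \<le> N then hcomp (N - e) h else 0)"
    have "U = U1 * g' + U2 * h'"
      using hcomp_homogeneous[OF U(1), of N] hcomp_mult[OF 1(4), of N g] hcomp_mult[OF 2(4), of N h]
      by (simp add: Ueq hcomp_add g'_def h'_def)
    moreover have "W = W1 * g' + W2 * h'"
      using hcomp_homogeneous[OF W(1), of N] hcomp_mult[OF 1(5), of N g] hcomp_mult[OF 2(5), of N h]
      by (simp add: Weq hcomp_add g'_def h'_def)
    ultimately have "\<theta> = vscale (dehom g') v + vscale (dehom h') w"
      using U(2) W(2) by (simp add: prod_eq_iff v_def w_def mult.commute)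
    moreover have "tdeg_lt (M - d) (dehom g')" "tdeg_lt (M - e) (dehom h')"
      by (simp_all add: g'_def h'_def Suc Suc_diff_le tdeg_lt_dehom[OF homogeneous3_hcomp])
    ultimately show ?thesis by blast
  qed
  have ind: "p = 0 \<and> q = 0" if pq: "vscale p v + vscale q w = 0" for p q
  proof -
    obtain K L where "tdeg_lt K p" "tdeg_lt L q" using ex_tdeg_lt by meson
    \<comment> \<open>A common degree, large enough for both products after homogenization.\<close>
    define N where "N = K + L + d + e"
    have "tdeg_lt (Suc (N - d)) p" "tdeg_lt (Suc (N - e)) q"
      by (rule tdeg_lt_mono[OF \<open>tdeg_lt K p\<close>], simp add: N_def, rule tdeg_lt_mono[OF \<open>tdeg_lt L q\<close>], simp add: N_def)
    then obtain g h where g: "homogeneous3 (N - d) g" "dehom g = p" and h: "homogeneous3 (N - e) h" "dehom h = q"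
      using homogenize by metis
    have N: "N - d + d = N" "N - e + e = N" by (simp_all add: N_def)
    have "homogeneous3 N (g * U1 + h * U2)" "homogeneous3 N (g * W1 + h * W2)"
      using homogeneous3_mult[OF g(1)] homogeneous3_mult[OF h(1)] 1(4,5) 2(4,5) N
      by (metis homogeneous3_add)+
    moreover have "dehom (g * U1 + h * U2) = 0" "dehom (g * W1 + h * W2) = 0"
      using pq g(2) h(2) by (simp_all add: prod_eq_iff v_def w_def)
    ultimately have z: "g * U1 + h * U2 = 0" "g * W1 + h * W2 = 0" using dehom_eq_0 by blast+
    \<comment> \<open>Chosen such that the \<open>z\<close>-component of the combination
      vanishes.\<close>
    define f where "f = - (g * f1) - h * f2"
    have "derivation3 (\<lambda>p. f * euler_der p + g * \<theta>\<^sub>1 p + h * \<theta>\<^sub>2 p)"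
      by (rule derivation3_comb[OF derivation3_euler der])
    moreover have d0: "derivation3 (\<lambda>p. 0)" by (simp add: derivation3_def)
    ultimately have e1: "(\<lambda>p. 0) = (\<lambda>p. f * euler_der p + g * \<theta>\<^sub>1 p + h * \<theta>\<^sub>2 p)"
      using z by (intro derivation3_ext) (simp_all add: 1(1-3) 2(1-3) f_def algebra_simps)
    have e2: "(\<lambda>p. 0) = (\<lambda>p. 0 * euler_der p + 0 * \<theta>\<^sub>1 p + 0 * \<theta>\<^sub>2 p)" by simp
    have "(\<lambda>p. 0) \<in> cone_derivations A" unfolding cone_derivations_iff[OF arr] using d0 by simp
    from uniq[OF this] have "(f, g, h) = (0, 0, 0)"
      by (rule ex1_eq) (unfold prod.case, rule e1, rule e2)
    then show ?thesis using g(2) h(2) by simp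
  qed
  have "filt_basis A d e v w"
    unfolding filt_basis_def using 1(6) 2(6) gen ind by (simp add: v_def w_def)
  then show ?thesis by blast
qed

text \<open>The fields are homogenized to derivations with \<open>z\<close>-component 0; the Euler
  derivation accounts for the value on \<open>z\<close>.\<close>

lemma free_if_filt_basis:
  fixes A :: "('a::field^2) set set"
  assumes arr: "line_arrangement A" and fb: "filt_basis A d e v w"
  shows "free_with_exponents A d e"
proof -
  have v: "v \<in> lfields (Suc d) A" and w: "w \<in> lfields (Suc e) A"
    and gen: "\<And>M \<theta>. \<theta> \<in> lfields M A \<Longrightarrow> \<exists>p q. tdeg_lt (M - d) p \<and> tdeg_lt (M - e) q \<and> \<theta> = vscale p v + vscale q w"
    and ind: "\<And>p q. vscale p v + vscale q w = 0 \<Longrightarrow> p = 0 \<and> q = 0"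
    using fb unfolding filt_basis_def by blast+
  obtain U1 W1 where 1: "homogeneous3 d U1" "homogeneous3 d W1" "dehom U1 = fst v" "dehom W1 = snd v"
    using homogenize[of d "fst v"] homogenize[of d "snd v"] v by (auto simp: lfields_def)
  obtain U2 W2 where 2: "homogeneous3 e U2" "homogeneous3 e W2" "dehom U2 = fst w" "dehom W2 = snd w"
    using homogenize[of e "fst w"] homogenize[of e "snd w"] w by (auto simp: lfields_def)
  define \<theta>\<^sub>1 where "\<theta>\<^sub>1 = der3 U1 W1 0"
  define \<theta>\<^sub>2 where "\<theta>\<^sub>2 = der3 U2 W2 0"
  have h: "homogeneous_der d \<theta>\<^sub>1" "homogeneous_der e \<theta>\<^sub>2"
    using 1 2 by (simp_all add: homogeneous_der_def \<theta>\<^sub>1_def \<theta>\<^sub>2_def)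
  have mem: "\<theta>\<^sub>1 \<in> cone_derivations A" "\<theta>\<^sub>2 \<in> cone_derivations A"
    unfolding \<theta>\<^sub>1_def \<theta>\<^sub>2_def
    using der3_in_cone_derivations[OF arr 1(1,2)] der3_in_cone_derivations[OF arr 2(1,2)] 1(3,4) 2(3,4) v w
    by simp_all
  have der: "derivation3 \<theta>\<^sub>1" "derivation3 \<theta>\<^sub>2" by (simp_all add: \<theta>\<^sub>1_def \<theta>\<^sub>2_def derivation3_der3)
  have eul: "euler_der \<in> cone_derivations A"
    unfolding cone_derivations_iff[OF arr]
    by (simp add: derivation3_euler derivation3_cone_form[OF derivation3_euler]) (simp add: cone_form_def)
  \<comment> \<open>Determinant of the two fields; if it vanished, the entries would give a
    nontrivial relation between \<open>v\<close> and \<open>w\<close>.\<close>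
  define D where "D = U1 * W2 - W1 * U2"
  have "dehom D \<noteq> 0"
  proof
    assume "dehom D = 0"
    then have D: "fst v * snd w = snd v * fst w" by (simp add: D_def 1 2)
    have "vscale (snd w) v + vscale (- snd v) w = 0" using D by (simp add: prod_eq_iff mult.commute)
    then have s: "snd v = 0" using ind by fastforce
    have "vscale (fst w) v + vscale (- fst v) w = 0" using D by (simp add: prod_eq_iff mult.commute)
    then have "fst v = 0" using ind by fastforce
    with s have "vscale 1 v + vscale 0 w = 0" by (simp add: prod_eq_iff)
    then show False using ind by fastforce
  qed
  then have D: "D \<noteq> 0" by auto
  \<comment> \<open>A derivation of the cone need not be homogeneous, so each degree
    \<open>n\<close> is treated separately.\<close>
  have comp: "\<exists>g h. hcomp n U = g * U1 + h * U2 \<and> hcomp n W = g * W1 + h * W2"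
    if UW: "\<And>H. H \<in> A \<Longrightarrow> cone H dvd const3 (eqx H) * U + const3 (eqy H) * W" for n U W
  proof -
    have "cone H dvd const3 (eqx H) * hcomp n U + const3 (eqy H) * hcomp n W" if H: "H \<in> A" for H
    proof -
      obtain S where S: "const3 (eqx H) * U + const3 (eqy H) * W = cone H * S" using UW[OF H] by (elim dvdE)
      have "hcomp n (const3 (eqx H) * U + const3 (eqy H) * W) = const3 (eqx H) * hcomp n U + const3 (eqy H) * hcomp n W"
        by (simp add: hcomp_add hcomp_mult[OF homogeneous3_const3])
      moreover have "cone H dvd hcomp n (cone H * S)" unfolding hcomp_mult[OF homogeneous3_cone_form] by simp
      ultimately show ?thesis using S by simp
    qed
    then have "(dehom (hcomp n U), dehom (hcomp n W)) \<in> lfields (Suc n) A"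
      by (intro cone_reduce_lfields homogeneous3_hcomp)
    then obtain p q where pq: "tdeg_lt (Suc n - d) p" "tdeg_lt (Suc n - e) q"
      "(dehom (hcomp n U), dehom (hcomp n W)) = vscale p v + vscale q w" using gen by blast
    \<comment> \<open>For \<open>k > n\<close> the strict bound \<open>Suc n - k\<close> is 0, and
      the coefficient must be 0.\<close>
    have ex: "\<exists>g. dehom g = p \<and> (\<forall>V. homogeneous3 k V \<longrightarrow> homogeneous3 n (g * V))" if t: "tdeg_lt (Suc n - k) p" for k p
    proof (cases "k \<le> n")
      case True
      then obtain g where "homogeneous3 (n - k) g" "dehom g = p" using homogenize[of "n - k" p] t by (auto simp: Suc_diff_le)
      then show ?thesis using homogeneous3_mult[of "n - k" g k] True by (intro exI[of _ g]) auto
    next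
      case False
      then show ?thesis using t by (intro exI[of _ 0]) simp
    qed
    obtain g where g: "dehom g = p" "\<And>V. homogeneous3 d V \<Longrightarrow> homogeneous3 n (g * V)" using ex[OF pq(1)] by blast
    obtain h where h: "dehom h = q" "\<And>V. homogeneous3 e V \<Longrightarrow> homogeneous3 n (h * V)" using ex[OF pq(2)] by blast
    have "hcomp n U = g * U1 + h * U2"
      by (rule dehom_inj[OF homogeneous3_hcomp homogeneous3_add[OF g(2)[OF 1(1)] h(2)[OF 2(1)]]])
         (use pq(3) in \<open>simp add: g(1) h(1) 1 2 prod_eq_iff\<close>)
    moreover have "hcomp n W = g * W1 + h * W2"
      by (rule dehom_inj[OF homogeneous3_hcomp homogeneous3_add[OF g(2)[OF 1(2)] h(2)[OF 2(2)]]])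
         (use pq(3) in \<open>simp add: g(1) h(1) 1 2 prod_eq_iff\<close>)
    ultimately show ?thesis by blast
  qed
  have "\<exists>!(f, g, h). \<theta> = (\<lambda>p. f * euler_der p + g * \<theta>\<^sub>1 p + h * \<theta>\<^sub>2 p)" if \<theta>: "\<theta> \<in> cone_derivations A" for \<theta>
  proof -
    obtain f where f: "\<theta> Z3 = Z3 * f" using \<theta> unfolding cone_derivations_iff[OF arr] by (auto elim: dvdE)
    have d\<theta>: "derivation3 \<theta>" using \<theta> unfolding cone_derivations_iff[OF arr] by blast
    define U where "U = \<theta> X3 - f * X3"
    define W where "W = \<theta> Y3 - f * Y3"
    have UW: "cone H dvd const3 (eqx H) * U + const3 (eqy H) * W" if "H \<in> A" for H
      unfolding U_def W_def by (rule cone_derivation_reduce[OF arr \<theta> f that])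
    obtain G R where GR: "\<And>n. hcomp n U = G n * U1 + R n * U2 \<and> hcomp n W = G n * W1 + R n * W2"
      using comp[OF UW] by metis
    obtain K1 where K1: "U = (\<Sum>n<K1. hcomp n U)" using sum_hcomp by blast
    obtain K2 where K2: "K2 \<ge> K1" "W = (\<Sum>n<K2. hcomp n W)" using sum_hcomp by blast
    \<comment> \<open>One range for both sums: the components of \<open>W\<close> from
      \<open>K2\<close> on vanish.\<close>
    obtain K where K: "K \<ge> K2" "U = (\<Sum>n<K. hcomp n U)" using sum_hcomp by blast
    have "W = (\<Sum>n<K. hcomp n W)"
    proof -
      have "hcomp n W = 0" if "n \<ge> K2" for n
      proof -
        have "hcomp n W = (\<Sum>m<K2. hcomp n (hcomp m W))" by (subst K2(2)) (simp add: hcomp_sum)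
        also have "\<dots> = 0" using that by (intro sum.neutral) (auto simp: hcomp_homogeneous[OF homogeneous3_hcomp])
        finally show ?thesis .
      qed
      then have "(\<Sum>n<K. hcomp n W) = (\<Sum>n<K2. hcomp n W)" using K(1) by (intro sum.mono_neutral_right) auto
      then show ?thesis using K2(2) by simp
    qed
    define g where "g = (\<Sum>n<K. G n)"
    define h where "h = (\<Sum>n<K. R n)"
    have Ueq: "U = g * U1 + h * U2"
      by (subst K(2)) (simp add: GR sum.distrib g_def h_def sum_distrib_right)
    have Weq: "W = g * W1 + h * W2"
      by (subst \<open>W = (\<Sum>n<K. hcomp n W)\<close>) (simp add: GR sum.distrib g_def h_def sum_distrib_right)
    have eq: "\<theta> = (\<lambda>p. f * euler_der p + g * \<theta>\<^sub>1 p + h * \<theta>\<^sub>2 p)"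
    proof (rule derivation3_ext[OF d\<theta> derivation3_comb[OF derivation3_euler der]])
      show "\<theta> X3 = f * euler_der X3 + g * \<theta>\<^sub>1 X3 + h * \<theta>\<^sub>2 X3"
        using Ueq by (simp add: U_def \<theta>\<^sub>1_def \<theta>\<^sub>2_def algebra_simps)
      show "\<theta> Y3 = f * euler_der Y3 + g * \<theta>\<^sub>1 Y3 + h * \<theta>\<^sub>2 Y3"
        using Weq by (simp add: W_def \<theta>\<^sub>1_def \<theta>\<^sub>2_def algebra_simps)
      show "\<theta> Z3 = f * euler_der Z3 + g * \<theta>\<^sub>1 Z3 + h * \<theta>\<^sub>2 Z3"
        using f by (simp add: \<theta>\<^sub>1_def \<theta>\<^sub>2_def)
    qed
    have unique: "f' = f \<and> g' = g \<and> h' = h"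
      if e': "\<theta> = (\<lambda>p. f' * euler_der p + g' * \<theta>\<^sub>1 p + h' * \<theta>\<^sub>2 p)" for f' g' h'
    proof -
      have "\<theta> Z3 = f' * Z3" using fun_cong[OF e', of Z3] by (simp add: \<theta>\<^sub>1_def \<theta>\<^sub>2_def)
      then have "f' * Z3 = f * Z3" unfolding f by (simp only: mult.commute)
      moreover have "Z3 \<noteq> (0 :: 'a poly3)" by (simp add: Z3_def)
      ultimately have ff: "f' = f" by simp
      have "\<theta> X3 = f * X3 + g' * U1 + h' * U2" "\<theta> Y3 = f * Y3 + g' * W1 + h' * W2"
        using fun_cong[OF e', of X3] fun_cong[OF e', of Y3] by (simp_all add: \<theta>\<^sub>1_def \<theta>\<^sub>2_def ff)
      then have "g' * U1 + h' * U2 = g * U1 + h * U2" "g' * W1 + h' * W2 = g * W1 + h * W2"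
        using Ueq Weq by (simp_all add: U_def W_def algebra_simps)
      then have zx: "(g' - g) * U1 + (h' - h) * U2 = 0" and zy: "(g' - g) * W1 + (h' - h) * W2 = 0"
        by (simp_all add: algebra_simps)
      \<comment> \<open>Cramer's rule with \<open>D\<close>, here and below.\<close>
      have "(g' - g) * D = ((g' - g) * U1 + (h' - h) * U2) * W2 - ((g' - g) * W1 + (h' - h) * W2) * U2"
        by (simp add: D_def algebra_simps)
      then have "g' - g = 0" using zx zy D by simp
      have "(h' - h) * D = ((g' - g) * W1 + (h' - h) * W2) * U1 - ((g' - g) * U1 + (h' - h) * U2) * W1"
        by (simp add: D_def algebra_simps)
      then have "h' - h = 0" using zx zy D by simp
      then show ?thesis using ff \<open>g' - g = 0\<close> by simp
    qed
    show ?thesis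
    proof (rule ex1I[of _ "(f, g, h)"])
      show "case (f, g, h) of (f, g, h) \<Rightarrow> \<theta> = (\<lambda>p. f * euler_der p + g * \<theta>\<^sub>1 p + h * \<theta>\<^sub>2 p)"
        unfolding prod.case by (rule eq)
    next
      fix t assume t: "case t of (f, g, h) \<Rightarrow> \<theta> = (\<lambda>p. f * euler_der p + g * \<theta>\<^sub>1 p + h * \<theta>\<^sub>2 p)"
      obtain f' g' h' where t': "t = (f', g', h')" by (cases t)
      show "t = (f, g, h)" using unique[OF t[unfolded t' prod.case]] t' by simp
    qed
  qed
  then have "is_basis3 (cone_derivations A) euler_der \<theta>\<^sub>1 \<theta>\<^sub>2"
    unfolding is_basis3_def using eul mem by blast
  then show ?thesis unfolding free_with_exponents_def using h by blast
qed

section \<open>The intersection poset\<close>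

text \<open>Inside \<open>H\<close> a point is given by its parameter, and \<open>K\<close> belongs
  to \<open>through\<close> of only one parameter.\<close>

lemma lines_meet_once:
  assumes "affine_line H" "affine_line K" "H \<noteq> K" "p \<in> H" "p \<in> K" "q \<in> H" "q \<in> K"
  shows "p = q"
proof -
  have "line_arrangement {K}" using assms(2) by (simp add: line_arrangement_def)
  then obtain x0 y0 t1 t2 where "added_line H x0 y0 t1 t2 {K}"
    using ex_added_line[of "{K}" H] assms(1,3) by auto
  then interpret added_line H x0 y0 t1 t2 "{K}" .
  obtain s where s: "p = pt s" using in_H_iff[of p] assms(4) by (auto dest: iffD1)
  obtain t where t: "q = pt t" using in_H_iff[of q] assms(6) by (auto dest: iffD1)
  have "K \<in> through s \<inter> through t" using assms(5,7) s t by (simp add: through_def)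
  then have "s = t" using through_disj[of s t] by blast
  then show ?thesis using s t by simp
qed

lemma line_directions:
  assumes "affine_line H"
  shows "\<exists>d. d \<noteq> 0 \<and> {p - q | p q. p \<in> H \<and> q \<in> H} = vec.span {d}"
proof -
  obtain x0 y0 t1 t2 where "added_line H x0 y0 t1 t2 {}"
    using ex_added_line[of "{}" H] assms by (auto simp: line_arrangement_def)
  then interpret added_line H x0 y0 t1 t2 "{}" .
  define d :: "'a^2" where "d = vector [eqy H, - eqx H]"
  have "d \<noteq> 0" using nonzero by (auto simp: d_def vec2_eq_iff)
  have diff: "pt s - pt t = (s - t) *s d" for s t
    by (simp add: vec2_eq_iff d_def algebra_simps)
  have "{p - q | p q. p \<in> H \<and> q \<in> H} = {pt s - pt t | s t. True}"
    using in_H_iff by (intro set_eqI) (simp only: mem_Collect_eq, metis)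
  also have "\<dots> = range (\<lambda>k. k *s d)"
  proof (intro set_eqI iffI)
    fix x assume "x \<in> range (\<lambda>k. k *s d)"
    then obtain k where "x = k *s d" by blast
    then have "x = pt k - pt 0" by (simp add: diff)
    then show "x \<in> {pt s - pt t | s t. True}" by blast
  next
    fix x assume "x \<in> {pt s - pt t | s t. True}"
    then obtain s t where "x = pt s - pt t" by blast
    then have "x = (s - t) *s d" by (simp only: diff)
    then show "x \<in> range (\<lambda>k. k *s d)" by blast
  qed
  finally show ?thesis using \<open>d \<noteq> 0\<close> by (auto simp: vec.span_singleton)
qed

lemma flat_dim_line: "affine_line H \<Longrightarrow> flat_dim H = 1"
  using line_directions[of H] by (auto simp: flat_dim_def)

lemma flat_dim_UNIV: "flat_dim (UNIV :: ('a::field^2) set) = 2"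
proof -
  have "x \<in> {p - q | p q. p \<in> UNIV \<and> q \<in> UNIV}" for x :: "'a^2"
    by (intro CollectI exI[of _ x] exI[of _ 0]) simp
  then have "{p - q | p q. p \<in> UNIV \<and> q \<in> UNIV} = (UNIV :: ('a^2) set)" by blast
  then show ?thesis by (simp add: flat_dim_def card_cart_basis)
qed

lemma flat_dim_point: "flat_dim {p :: 'a::field^2} = 0"
proof -
  have "{q - q' | q q'. q \<in> {p} \<and> q' \<in> {p}} = {0}" by auto
  then show ?thesis by (simp add: flat_dim_def)
qed

text \<open>Dimensions separate points, lines and the plane over every field, finite ones
  included.\<close>

lemma line_not_singleton: "affine_line H \<Longrightarrow> H \<noteq> {p}"
  using flat_dim_line[of H] flat_dim_point[of p] by auto

lemma line_not_UNIV: "affine_line (H :: ('a::field^2) set) \<Longrightarrow> H \<noteq> UNIV"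
  using flat_dim_line[of H] flat_dim_UNIV[where ?'a='a] by auto

lemma line_nonempty: "affine_line H \<Longrightarrow> H \<noteq> {}"
  using line_directions[of H] vec.span_zero by fastforce

text \<open>Two different lines share at most one point, so nonempty intersections of more than one
  line are points of \<open>mpts A\<close>.\<close>

lemma flats_eq:
  assumes "line_arrangement A"
  shows "flats A = insert UNIV (A \<union> (\<lambda>p. {p}) ` mpts A)"
proof (intro set_eqI iffI)
  fix X assume "X \<in> flats A"
  then obtain C where C: "C \<subseteq> A" "X = \<Inter>C" "X \<noteq> {}" by (auto simp: flats_def)
  show "X \<in> insert UNIV (A \<union> (\<lambda>p. {p}) ` mpts A)"
  proof (cases "\<exists>H\<in>C. \<exists>K\<in>C. H \<noteq> K")
    case True
    then obtain H K where HK: "H \<in> C" "K \<in> C" "H \<noteq> K" by blast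
    obtain p where p: "p \<in> X" using C(3) by blast
    have lines: "affine_line H" "affine_line K" using HK C(1) assms by (auto simp: line_arrangement_def)
    have "q = p" if "q \<in> X" for q
      using lines_meet_once[OF lines HK(3)] that p C(2) HK by blast
    then have "X = {p}" using p by blast
    moreover have "p \<in> mpts A" using HK C p unfolding mpts_def by blast
    ultimately show ?thesis by blast
  next
    case False
    then have "C = {} \<or> (\<exists>H. C = {H})" by blast
    then show ?thesis using C by auto
  qed
next
  fix X assume "X \<in> insert UNIV (A \<union> (\<lambda>p. {p}) ` mpts A)"
  then consider "X = UNIV" | "X \<in> A" | p where "X = {p}" "p \<in> mpts A" by blast
  then show "X \<in> flats A"
  proof cases
    case 1
    then have "X = \<Inter>{}" by simp
    then show ?thesis unfolding flats_def using 1 by blast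
  next
    case 2
    then have "X \<noteq> {}" using line_nonempty assms by (auto simp: line_arrangement_def)
    moreover have "X = \<Inter>{X}" by simp
    ultimately show ?thesis unfolding flats_def using 2 by blast
  next
    case 3
    then obtain H K where HK: "H \<in> A" "K \<in> A" "H \<noteq> K" "p \<in> H" "p \<in> K" unfolding mpts_def by blast
    then have "q = p" if "q \<in> H" "q \<in> K" for q
      using lines_meet_once[of H K q p] that assms by (auto simp: line_arrangement_def)
    then have "H \<inter> K = {p}" using HK(4,5) by blast
    then have "X = \<Inter>{H, K}" using 3(1) by simp
    then show ?thesis unfolding flats_def using HK 3 by blast
  qed
qed

text \<open>The cardinalities of these sets are preserved by isomorphisms; lines, \<open>b2\<close>
  and the numbers of points on lines are recovered from them.\<close>

definition above :: "'b set set \<Rightarrow> 'b set \<Rightarrow> 'b set set" where "above P X = {Y \<in> P. X \<subset> Y}"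
definition below :: "'b set set \<Rightarrow> 'b set \<Rightarrow> 'b set set" where "below P X = {Y \<in> P. Y \<subset> X}"

context
  fixes A :: "('a::field^2) set set"
  assumes arr: "line_arrangement A"
begin

lemma fin_A: "finite A" and line_A: "H \<in> A \<Longrightarrow> affine_line H"
  using arr by (auto simp: line_arrangement_def)

lemma above_UNIV: "above (flats A) UNIV = {}" by (auto simp: above_def)

lemma above_line:
  assumes "H \<in> A" shows "above (flats A) H = {UNIV}"
proof -
  have "\<not> H \<subset> K" if "K \<in> A" for K
  proof
    assume K: "H \<subset> K"
    obtain p where p: "p \<in> H" using line_nonempty line_A[OF assms] by blast
    then obtain q where "q \<in> H" "q \<noteq> p" using line_not_singleton[OF line_A[OF assms], of p] by blast
    then show False using lines_meet_once[OF line_A[OF assms] line_A[OF that], of p q] p K by blast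
  qed
  moreover have "\<not> H \<subset> {p}" for p
    using line_nonempty[OF line_A[OF assms]] by blast
  moreover have "H \<subset> UNIV" using line_not_UNIV[OF line_A[OF assms]] by blast
  ultimately show ?thesis unfolding above_def flats_eq[OF arr] by blast
qed

lemma above_point: "above (flats A) {p} = insert UNIV {H \<in> A. p \<in> H}"
proof -
  have "{p} \<subset> H" if "H \<in> A" "p \<in> H" for H using that line_not_singleton[OF line_A] by blast
  moreover have "{p} \<subset> UNIV"
    using flat_dim_point[of p] flat_dim_UNIV[where ?'a='a] by (metis psubsetI subset_UNIV zero_neq_numeral)
  ultimately show ?thesis unfolding above_def flats_eq[OF arr] by blast
qed

lemma UNIV_notin_A: "UNIV \<notin> A" using line_not_UNIV line_A by blast

lemma card_above_point: "card (above (flats A) {p}) = Suc (mult_at A p)"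
  using fin_A UNIV_notin_A by (simp add: above_point mult_at_def)

lemma point_notin_A: "{p} \<notin> A" using line_not_singleton line_A by blast
lemma point_not_UNIV: "{p :: 'a^2} \<noteq> UNIV"
  using flat_dim_point[of p] flat_dim_UNIV[where ?'a='a] by (metis zero_neq_numeral)

lemma sum_flats:
  "(\<Sum>X\<in>flats A. g X) = g UNIV + (\<Sum>H\<in>A. g H) + (\<Sum>p\<in>mpts A. g {p})" for g :: "_ \<Rightarrow> 'b::comm_monoid_add"
proof -
  have "(\<Sum>X\<in>flats A. g X) = g UNIV + (\<Sum>X\<in>A \<union> (\<lambda>p. {p}) ` mpts A. g X)"
    unfolding flats_eq[OF arr] using fin_A finite_mpts[OF arr] UNIV_notin_A point_not_UNIV
    by (subst sum.insert) (auto dest: sym)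
  also have "(\<Sum>X\<in>A \<union> (\<lambda>p. {p}) ` mpts A. g X) = (\<Sum>H\<in>A. g H) + (\<Sum>X\<in>(\<lambda>p. {p}) ` mpts A. g X)"
    using fin_A finite_mpts[OF arr] point_notin_A by (intro sum.union_disjoint) auto
  also have "(\<Sum>X\<in>(\<lambda>p. {p}) ` mpts A. g X) = (\<Sum>p\<in>mpts A. g {p})"
    by (subst sum.reindex) (auto simp: inj_on_def)
  finally show ?thesis by (simp add: add.assoc)
qed

lemma moebius_UNIV: "moebius A UNIV = 1"
  using fin_A by (simp add: moebius.simps)

lemma moebius_line:
  assumes "H \<in> A" shows "moebius A H = - 1"
proof -
  have "{Y \<in> flats A. H \<subset> Y} = {UNIV}" using above_line[OF assms] by (simp add: above_def)
  then show ?thesis using fin_A line_not_UNIV[OF line_A[OF assms]]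
    by (simp add: moebius.simps[of A H] moebius_UNIV)
qed

lemma moebius_point: "moebius A {p} = int (mult_at A p) - 1"
proof -
  have "{Y \<in> flats A. {p} \<subset> Y} = insert UNIV {H \<in> A. p \<in> H}" using above_point by (simp add: above_def)
  then have "moebius A {p} = - (\<Sum>Y\<in>insert UNIV {H \<in> A. p \<in> H}. moebius A Y)"
    using fin_A point_not_UNIV by (simp add: moebius.simps[of A "{p}"])
  also have "(\<Sum>Y\<in>insert UNIV {H \<in> A. p \<in> H}. moebius A Y) = 1 + (\<Sum>Y\<in>{H \<in> A. p \<in> H}. moebius A Y)"
    using fin_A UNIV_notin_A by (simp add: moebius_UNIV)
  also have "(\<Sum>Y\<in>{H \<in> A. p \<in> H}. moebius A Y) = (\<Sum>Y\<in>{H \<in> A. p \<in> H}. - 1)"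
    by (intro sum.cong) (simp_all add: moebius_line)
  finally show ?thesis by (simp add: mult_at_def)
qed

text \<open>The Moebius values are 1 on the plane, -1 on lines and \<open>mult_at A p - 1\<close> on
  points, in dimensions 2, 1 and 0.\<close>

lemma charpoly_arr_eq: "charpoly_arr A = [:int (b2 A), - int (card A), 1:]"
proof -
  have "charpoly_arr A = monom 1 2 + (\<Sum>H\<in>A. monom (- 1) 1) + (\<Sum>p\<in>mpts A. monom (int (mult_at A p) - 1) 0)"
    unfolding charpoly_arr_def sum_flats
    by (simp add: moebius_UNIV flat_dim_UNIV moebius_line flat_dim_line line_A moebius_point flat_dim_point)
  also have "(\<Sum>p\<in>mpts A. monom (int (mult_at A p) - 1) 0) = [:int (b2 A):]"
  proof -
    have "(\<Sum>p\<in>mpts A. int (mult_at A p) - 1) = int (b2 A)"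
      unfolding b2_def of_nat_sum
    proof (rule sum.cong)
      fix p assume "p \<in> mpts A"
      then have "mult_at A p \<ge> 1" using mult_at_mpts[OF fin_A, of p] by simp
      then show "int (mult_at A p) - 1 = int (mult_at A p - 1)" by (simp add: of_nat_diff)
    qed simp
    then show ?thesis unfolding monom_sum[symmetric] by (simp only: monom_0)
  qed
  also have "(\<Sum>H\<in>A. monom (- 1) 1) = (monom (- int (card A)) 1 :: int poly)"
    by (simp only: monom_sum[symmetric]) simp
  finally show ?thesis by (simp add: monom_altdef numeral_2_eq_2)
qed

text \<open>Above the plane there is nothing, above a line only the plane, and above a multiple
  point the plane and at least two lines.\<close>

lemma in_A_iff: "H \<in> A \<longleftrightarrow> H \<in> flats A \<and> card (above (flats A) H) = 1"
proof
  assume "H \<in> A"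
  then show "H \<in> flats A \<and> card (above (flats A) H) = 1"
    using above_line[of H] flats_eq[OF arr] by simp
next
  assume H: "H \<in> flats A \<and> card (above (flats A) H) = 1"
  then consider "H = UNIV" | "H \<in> A" | p where "H = {p}" "p \<in> mpts A"
    using flats_eq[OF arr] by blast
  then show "H \<in> A"
  proof cases
    case 1
    then show ?thesis using H above_UNIV by simp
  next
    case 3
    then show ?thesis using H card_above_point[of p] mult_at_mpts[OF fin_A, of p] by simp
  qed
qed

text \<open>Truncated subtraction removes the plane and the lines; above a point there are
  \<open>mult_at A p\<close> lines and the plane, whence the 2.\<close>

lemma b2_flats: "b2 A = (\<Sum>X\<in>flats A. card (above (flats A) X) - 2)"
  unfolding sum_flats by (simp add: above_UNIV above_line card_above_point b2_def)

text \<open>No line contains another, so the flats strictly below \<open>H\<close> are the points in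
  which other lines meet it.\<close>

lemma n_points_below:
  assumes "H \<in> A" shows "n_points A H = card (below (flats A) H)"
proof -
  have "restriction A H = below (flats A) H"
  proof (intro set_eqI iffI)
    fix X assume "X \<in> restriction A H"
    then obtain K where K: "X = H \<inter> K" "K \<in> A" "K \<noteq> H" "X \<noteq> {}" by (auto simp: restriction_def)
    then have "X = \<Inter>{H, K}" by simp
    then have "X \<in> flats A" unfolding flats_def using K(2,4) assms by blast
    moreover have "X \<noteq> H"
    proof
      assume "X = H"
      then have "H \<subset> K" using K(1,3) by blast
      moreover have "K \<in> flats A" using K(2) in_A_iff by blast
      ultimately have "K \<in> above (flats A) H" by (simp add: above_def)
      then show False using above_line[OF assms] K(2) UNIV_notin_A by simp
    qed
    ultimately show "X \<in> below (flats A) H" using K(1) by (auto simp: below_def)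
  next
    fix X assume "X \<in> below (flats A) H"
    then have X: "X \<in> flats A" "X \<subset> H" by (auto simp: below_def)
    have "X \<notin> A"
    proof
      assume XA: "X \<in> A"
      have "H \<in> flats A" using assms in_A_iff by blast
      then have "H \<in> above (flats A) X" using X(2) by (simp add: above_def)
      then show False using above_line[OF XA] assms UNIV_notin_A by simp
    qed
    moreover have "X \<noteq> UNIV" using X(2) by blast
    ultimately obtain p where p: "X = {p}" "p \<in> mpts A" using X(1) unfolding flats_eq[OF arr] by blast
    then obtain K where K: "K \<in> A" "K \<noteq> H" "p \<in> K" unfolding mpts_def by blast
    have "X = H \<inter> K"
      using lines_meet_once[OF line_A[OF assms] line_A[OF K(1)]] K p X(2) by blast
    then show "X \<in> restriction A H" unfolding restriction_def using K p(1) by blast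
  qed
  then show ?thesis by (simp add: n_points_def)
qed

end

lemma poset_iso_invariants:
  assumes bij: "bij_betw f P Q" and ord: "\<And>X Y. X \<in> P \<Longrightarrow> Y \<in> P \<Longrightarrow> X \<subseteq> Y \<longleftrightarrow> f X \<subseteq> f Y"
    and X: "X \<in> P"
  shows "card (above Q (f X)) = card (above P X)" "card (below Q (f X)) = card (below P X)"
proof -
  have s: "X \<subset> Y \<longleftrightarrow> f X \<subset> f Y" if "X \<in> P" "Y \<in> P" for X Y
    using ord[OF that] ord[OF that(2,1)] by (auto simp: less_le_not_le)
  have im: "f ` P = Q" and inj: "inj_on f P" using bij by (auto simp: bij_betw_def)
  have "above P X = {Y \<in> P. f X \<subset> f Y}" "below P X = {Y \<in> P. f Y \<subset> f X}"
    unfolding above_def below_def by (simp_all add: s[OF X] s[OF _ X] cong: conj_cong)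
  moreover have "{y \<in> f ` P. R y} = f ` {x \<in> P. R (f x)}" for R by blast
  then have "above Q (f X) = f ` {Y \<in> P. f X \<subset> f Y}" "below Q (f X) = f ` {Y \<in> P. f Y \<subset> f X}"
    unfolding above_def below_def im[symmetric] by simp_all
  moreover have "inj_on f (above P X)" "inj_on f (below P X)"
    using inj by (auto simp: above_def below_def inj_on_def)
  ultimately show "card (above Q (f X)) = card (above P X)" "card (below Q (f X)) = card (below P X)"
    by (simp_all add: card_image)
qed

text \<open>By \<open>in_A_iff\<close> the isomorphism maps lines to lines; sums and counts are then
  transported along it.\<close>

lemma poset_iso_flats:
  assumes A: "line_arrangement A" and A': "line_arrangement A'" and iso: "poset_iso (flats A) (flats A')"
  shows "card A = card A'" "b2 A = b2 A'" "n_points A ` A = n_points A' ` A'"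
proof -
  let ?P = "flats A" and ?Q = "flats A'"
  obtain f where f: "bij_betw f ?P ?Q" "\<forall>X\<in>?P. \<forall>Y\<in>?P. X \<subseteq> Y \<longleftrightarrow> f X \<subseteq> f Y"
    using iso unfolding poset_iso_def by (elim exE conjE)
  note bij = f(1)
  have ord: "X \<subseteq> Y \<longleftrightarrow> f X \<subseteq> f Y" if "X \<in> ?P" "Y \<in> ?P" for X Y
    using f(2)[rule_format, OF that] .
  note inv = poset_iso_invariants[OF bij ord]
  have im: "f ` ?P = ?Q" and inj: "inj_on f ?P" using bij by (auto simp: bij_betw_def)
  have fA: "f ` A = A'"
  proof (intro set_eqI iffI)
    fix K assume "K \<in> f ` A"
    then show "K \<in> A'" using in_A_iff[OF A] in_A_iff[OF A'] inv im by auto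
  next
    fix K assume K: "K \<in> A'"
    then obtain X where X: "X \<in> ?P" "K = f X" using in_A_iff[OF A'] im by blast
    then have "X \<in> A" using in_A_iff[OF A] in_A_iff[OF A'] inv(1)[OF _ _ X(1)] K by simp
    then show "K \<in> f ` A" using X(2) by blast
  qed
  have sub: "A \<subseteq> ?P" using in_A_iff[OF A] by blast
  then have "inj_on f A" using inj inj_on_subset by blast
  then show "card A = card A'" using fA card_image by metis
  have "(\<Sum>X\<in>?Q. card (above ?Q X) - 2) = (\<Sum>X\<in>?P. card (above ?Q (f X)) - 2)"
    using sum.reindex_bij_betw[OF bij, of "\<lambda>X. card (above ?Q X) - 2"] by simp
  also have "\<dots> = (\<Sum>X\<in>?P. card (above ?P X) - 2)" using inv(1) by (intro sum.cong) auto
  finally show "b2 A = b2 A'" by (simp add: b2_flats[OF A] b2_flats[OF A'])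
  have "n_points A' (f H) = n_points A H" if "H \<in> A" for H
    using n_points_below[OF A that] n_points_below[OF A', of "f H"] fA that inv(2)[of H] sub by auto
  then have "(\<lambda>H. n_points A' (f H)) ` A = n_points A ` A" by (intro image_cong) auto
  then show "n_points A ` A = n_points A' ` A'" using fA by (metis image_image)
qed

section \<open>The criterion for freeness\<close>

text \<open>The lines outside \<open>B\<close> are added one by one. At each stage the new line has
  at most as many points as in \<open>A\<close>.\<close>

lemma b2_le_subarrangement:
  assumes A: "line_arrangement A" and "B \<subseteq> A" and m: "\<And>H. H \<in> A \<Longrightarrow> n_points A H \<le> m"
  shows "b2 A \<le> b2 B + card (A - B) * m"
proof -
  have fin: "finite A" using A by (simp add: line_arrangement_def)
  have "b2 (B \<union> C) \<le> b2 B + card C * m" if "C \<subseteq> A" "C \<inter> B = {}" for C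
    using finite_subset[OF that(1) fin] that
  proof (induction C)
    case (insert H C)
    have la: "line_arrangement (B \<union> C)" "affine_line H" "H \<notin> B \<union> C"
      using A insert.prems insert.hyps assms(2) finite_subset[OF _ fin] by (auto simp: line_arrangement_def)
    have "n_points (insert H (B \<union> C)) H \<le> n_points A H"
      unfolding n_points_def
    proof (rule card_mono)
      have "restriction A H \<subseteq> (\<lambda>K. H \<inter> K) ` A" by (auto simp: restriction_def)
      then show "finite (restriction A H)" using fin finite_subset by blast
      show "restriction (insert H (B \<union> C)) H \<subseteq> restriction A H"
        using insert.prems assms(2) by (auto simp: restriction_def)
    qed
    then have "n_points (insert H (B \<union> C)) H \<le> m" using m[of H] insert.prems by simp
    then show ?case using b2_insert[OF la] insert by simp
  qed simp
  moreover have "B \<union> (A - B) = A" "(A - B) \<inter> B = {}" using assms(2) by blast+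
  ultimately show ?thesis by (metis Diff_subset)
qed

text \<open>Sum and product determine a quadratic polynomial and hence its roots;
  \<open>d \<le> e\<close> fixes the order.\<close>

lemma sum_product_eq:
  fixes d e :: nat
  assumes "d \<le> e" "d + e = 2 * n + r" "d * e = n * (n + r)"
  shows "d = n \<and> e = n + r"
proof -
  have e: "int e = 2 * int n + int r - int d" using assms(2) by linarith
  have "int d * int e = int n * (int n + int r)" using assms(3) by (metis of_nat_add of_nat_mult)
  then have "(int d - int n) * (int d - (int n + int r)) = 0" unfolding e by (simp add: algebra_simps)
  then have "int d = int n \<or> int d = int n + int r" by auto
  then show ?thesis using assms(1,2) by auto
qed

lemma free_iff_filt_basis:
  assumes "line_arrangement A"
  shows "free_arrangement A \<longleftrightarrow> (\<exists>d e v w. d \<le> e \<and> filt_basis A d e v w)"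
proof
  assume "free_arrangement A"
  then obtain d e v w where "filt_basis A d e v w"
    using filt_basis_if_free[OF assms] unfolding free_arrangement_def by blast
  then show "\<exists>d e v w. d \<le> e \<and> filt_basis A d e v w"
    using filt_basis_swap nat_le_linear by metis
next
  assume "\<exists>d e v w. d \<le> e \<and> filt_basis A d e v w"
  then show "free_arrangement A" using free_if_filt_basis[OF assms] unfolding free_arrangement_def by blast
qed

text \<open>Comparing coefficients with \<open>charpoly_arr_eq\<close> turns both factorizations
  into sums and products of roots.\<close>

lemma roots_conditionD:
  assumes "roots_condition A n r"
  shows "line_arrangement A" "card A = 2 * n + r" "b2 A = n * (n + r)"
    "\<exists>B \<alpha> \<beta>. B \<subset> A \<and> \<alpha> + \<beta> = real (card B) \<and> \<alpha> * \<beta> = real (b2 B) \<and> \<alpha> \<le> real n \<and> real n - 1 \<le> \<beta>"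
proof -
  show A: "line_arrangement A" and "card A = 2 * n + r" using assms by (simp_all add: roots_condition_def)
  have "[:int (b2 A), - int (card A), 1:] = [:- int n, 1:] * [:- int (n + r), 1:]"
    using assms charpoly_arr_eq[OF A] by (simp add: roots_condition_def)
  then have "int (b2 A) = int n * int (n + r)" by (simp add: algebra_simps)
  then show "b2 A = n * (n + r)" by (metis of_nat_eq_iff of_nat_mult)
  obtain B and \<alpha> \<beta> :: real where B: "B \<subset> A"
    "map_poly real_of_int (charpoly_arr B) = [:- \<alpha>, 1:] * [:- \<beta>, 1:]" "\<alpha> \<le> real n" "real n - 1 \<le> \<beta>"
    using assms unfolding roots_condition_def by blast
  have lB: "line_arrangement B" using A B(1) finite_subset by (auto simp: line_arrangement_def)
  have "map_poly real_of_int (charpoly_arr B) = [:real (b2 B), - real (card B), 1:]"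
    unfolding charpoly_arr_eq[OF lB] by (simp add: map_poly_pCons)
  then have "\<alpha> + \<beta> = real (card B)" "\<alpha> * \<beta> = real (b2 B)" using B(2) by (auto simp: mult.commute)
  then show "\<exists>B \<alpha> \<beta>. B \<subset> A \<and> \<alpha> + \<beta> = real (card B) \<and> \<alpha> * \<beta> = real (b2 B) \<and> \<alpha> \<le> real n \<and> real n - 1 \<le> \<beta>"
    using B by blast
qed

lemma free_iff_n_points:
  assumes rc: "roots_condition A n r"
  shows "free_arrangement A \<longleftrightarrow> (\<exists>H\<in>A. n_points A H \<in> {n, n + r})"
proof
  note rc = roots_conditionD[OF rc]
  have added: "\<exists>x0 y0 t1 t2. added_line H x0 y0 t1 t2 (A - {H})" if "H \<in> A" for H
    using rc(1) that by (intro ex_added_line) (auto simp: line_arrangement_def)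
  have finA: "finite A" using rc(1) by (simp add: line_arrangement_def)
  {
    assume "\<exists>H\<in>A. n_points A H \<in> {n, n + r}"
    then obtain H where H: "H \<in> A" "n_points A H \<in> {n, n + r}" by blast
    then obtain x0 y0 t1 t2 where "added_line H x0 y0 t1 t2 (A - {H})" using added by blast
    then interpret added_line H x0 y0 t1 t2 "A - {H}" .
    have ins: "insert H (A - {H}) = A" using H(1) by blast
    have T: "card T = n_points A H" using n_points_eq ins by simp
    have c: "Suc (card (A - {H})) = 2 * n + r" using card_Suc_Diff1[OF finA H(1)] rc(2) by simp
    have "b2 A = card T * (Suc (card (A - {H})) - card T)"
      unfolding c T rc(3) using H(2) by (auto simp: algebra_simps)
    then obtain v w where fb: "filt_basis A (card T) (Suc (card (A - {H})) - card T) v w"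
      using filt_basis_if_root ins by auto
    then show "free_arrangement A"
      using free_if_filt_basis[OF rc(1)] unfolding free_arrangement_def by blast
  }
  assume "free_arrangement A"
  then obtain d e v w where fb: "d \<le> e" "filt_basis A d e v w" using free_iff_filt_basis[OF rc(1)] by blast
  have de: "d = n" "e = n + r"
    using sum_product_eq[OF fb(1), of n r] filt_basis_roots[OF rc(1) fb(2)] rc(2,3) by auto
  show "\<exists>H\<in>A. n_points A H \<in> {n, n + r}"
  proof (rule ccontr)
    assume neg: "\<not> ?thesis"
    \<comment> \<open>\<open>d = n\<close> and \<open>e = n + r\<close> give
      \<open>n_points A H \<le> n\<close> or equality with \<open>n + r\<close>; both roots are
      excluded.\<close>
    have lt: "n_points A H < n" if H: "H \<in> A" for H
    proof -
      obtain x0 y0 t1 t2 where "added_line H x0 y0 t1 t2 (A - {H})" using added[OF H] by blast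
      then interpret added_line H x0 y0 t1 t2 "A - {H}" .
      have ins: "insert H (A - {H}) = A" using H by blast
      have "card T \<le> n \<or> card T = n + r"
        using card_T_filt_basis[of d e v w] fb ins de by simp
      moreover have "card T = n_points A H" using n_points_eq ins by simp
      ultimately show ?thesis using neg H by force
    qed
    obtain B and \<alpha> \<beta> :: real where B: "B \<subset> A" "\<alpha> + \<beta> = real (card B)" "\<alpha> * \<beta> = real (b2 B)"
      "\<alpha> \<le> real n" "real n - 1 \<le> \<beta>" using rc(4) by blast
    obtain H where "H \<in> A" using B(1) by blast
    \<comment> \<open>\<open>A\<close> has a line, and its number of points is below
      \<open>n\<close>; so \<open>n - 1\<close> is not truncated in what follows.\<close>
    then have n: "n \<ge> 1" using lt by fastforce
    define k where "k = card (A - B)"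
    have "A - B \<noteq> {}" using B(1) by blast
    \<comment> \<open>\<open>B\<close> is proper, which makes \<open>(1 - x) * (1 - y)\<close>
      strictly positive below.\<close>
    then have k: "k \<ge> 1" using finA by (simp add: k_def card_gt_0_iff Suc_le_eq)
    have "card A = card B + k"
      unfolding k_def using B(1) finA by (metis card_Diff_subset card_mono finite_subset le_add_diff_inverse psubset_imp_subset)
    then have s: "\<alpha> + \<beta> = 2 * real n + real r - real k" using rc(2) B(2) by simp
    have "b2 A \<le> b2 B + k * (n - 1)"
      unfolding k_def using B(1) lt by (intro b2_le_subarrangement[OF rc(1)]) fastforce+
    then have "real (b2 A) \<le> real (b2 B + k * (n - 1))" by linarith
    then have P: "real n * (real n + real r) - real k * (real n - 1) \<le> \<alpha> * \<beta>"
      using n by (simp add: rc(3) B(3) of_nat_diff)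
    \<comment> \<open>With this shift \<open>x * y\<close> is \<open>\<chi>(B, n - 1)\<close> and
      \<open>(1 - x) * (1 - y)\<close> is \<open>\<chi>(B, n)\<close>.\<close>
    define x where "x = \<alpha> - (real n - 1)"
    define y where "y = \<beta> - (real n - 1)"
    have "x * y = \<alpha> * \<beta> - (real n - 1) * (\<alpha> + \<beta>) + (real n - 1) * (real n - 1)"
      by (simp add: x_def y_def algebra_simps)
    then have xy: "x * y \<ge> 1 + real r"
      using P unfolding s by (simp add: algebra_simps)
    have "(1 - x) * (1 - y) = \<alpha> * \<beta> - real n * (\<alpha> + \<beta>) + real n * real n"
      by (simp add: x_def y_def algebra_simps)
    then have "(1 - x) * (1 - y) \<ge> real k"
      using P unfolding s by (simp add: algebra_simps)
    then have pos: "(1 - x) * (1 - y) > 0" using k by linarith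
    have "x \<le> 1" "y \<ge> 0" using B(4,5) by (simp_all add: x_def y_def)
    \<comment> \<open>As \<open>1 - x \<ge> 0\<close>, positivity of the product forces
      \<open>1 - y > 0\<close>. Then \<open>x \<le> 1\<close> and \<open>0 \<le> y < 1\<close>
      contradict \<open>x * y \<ge> 1 + r\<close>.\<close>
    then have "y < 1" using pos by (smt (verit) mult_nonneg_nonpos)
    then have "x * y < 1" using \<open>x \<le> 1\<close> \<open>y \<ge> 0\<close> by (smt (verit) mult_left_le_one_le mult_nonpos_nonneg)
    then show False using xy by linarith
  qed
qed

text \<open>The second half follows from the first: by the criterion, freeness depends only on
  \<open>n\<close>, \<open>r\<close> and the set of values of \<open>n_points\<close>, which the
  poset determines.\<close>

theorem theorem1p7:
  fixes A :: "('a::field^2) set set" and n r :: nat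
  assumes "roots_condition A n r"
  shows "(free_arrangement A \<longleftrightarrow> (\<exists>H\<in>A. n_points A H \<in> {n, n + r})) \<and>
         (\<forall>(A' :: ('a^2) set set) n' r'.
            roots_condition A' n' r' \<and> poset_iso (flats A) (flats A') \<longrightarrow>
            (free_arrangement A \<longleftrightarrow> free_arrangement A'))"
proof (intro conjI allI impI)
  show "free_arrangement A \<longleftrightarrow> (\<exists>H\<in>A. n_points A H \<in> {n, n + r})"
    by (rule free_iff_n_points[OF assms])
  fix A' :: "('a^2) set set" and n' r'
  assume *: "roots_condition A' n' r' \<and> poset_iso (flats A) (flats A')"
  note A = roots_conditionD[OF assms] and A' = roots_conditionD[OF conjunct1[OF *]]
  note iso = poset_iso_flats[OF A(1) A'(1) conjunct2[OF *]]
  \<comment> \<open>An isomorphism preserves sum and product of the roots, hence \<open>n\<close>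
    and \<open>r\<close> themselves.\<close>
  have "n' = n \<and> n' + r' = n + r"
    by (rule sum_product_eq) (use iso A(2,3) A'(2,3) in auto)
  then have "n' = n" "r' = r" by auto
  moreover have "(\<exists>H\<in>A. n_points A H \<in> S) \<longleftrightarrow> (\<exists>k\<in>n_points A ` A. k \<in> S)"
    "(\<exists>H\<in>A'. n_points A' H \<in> S) \<longleftrightarrow> (\<exists>k\<in>n_points A' ` A'. k \<in> S)" for S
    by simp_all
  ultimately show "free_arrangement A \<longleftrightarrow> free_arrangement A'"
    unfolding free_iff_n_points[OF assms] free_iff_n_points[OF conjunct1[OF *]] by (simp only: iso(3))
qed

end
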